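(* Let $\phi:\mathbb{Z}^d\rightarrow\mathbb{C}$ be finitely supported and such that $\sup_{\xi\in\mathbb{T}^d}|\hat\phi(\xi)|=1$. Suppose additionally that each $\xi\in\Omega(\phi)$ is of positive homogeneous type for $\hat\phi$ and hence $\Omega(\phi)=\{\xi_1,\xi_2,\dots,\xi_Q\}$ is finite. Let $\alpha_q\in\mathbb{R}^d$ and the positive homogeneous polynomial $P_{q}$ be those associated to $\xi_q$ for $q=1,2,\dots, Q$. Moreover, for each $q=1,2,\dots,Q$, set $\mu_q=\mu_{P_q}$ and let $E_q\in\mathrm{Exp}(P_q)$. Then, for any $N\geq 0$, there is a positive constant $C_N$ such that $$|\phi^{(n)}(x)|\leq C_N\sum_{q=1}^Q\frac{1}{n^{\mu_q}}\left(1+|n^{-E_q^*}(x-n\alpha_q)|\right)^{-N}$$ for all $x\in\mathbb{Z}^d$ and $n\in\mathbb{N}_+=\{1,2,\dots\}$. The constant $C_N$ is independent of the choice of $E_q\in\mathrm{Exp}(P_q)$ for $q=1,2,\dots, Q$.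
   Context: Let $d\ge 1$. For finitely supported $\phi:\mathbb{Z}^d\to\mathbb{C}$, set $\phi^{(1)}=\phi$ and $\phi^{(n)}=\phi^{(n-1)}*\phi$, where $(\psi*\phi)(x)=\sum_{y\in\mathbb{Z}^d}\psi(x-y)\phi(y)$. The Fourier transform is $\hat\phi(\xi)=\sum_{x\in\mathbb{Z}^d}\phi(x)e^{ix\cdot\xi}$, $\xi\in\mathbb{R}^d$. Let $\mathbb{T}^d=(-\pi,\pi]^d$; $|\cdot|$ is the euclidean norm. For $E\in M_d(\mathbb{R})$ and $t>0$, $t^E=\exp((\log t)E)$; $E^*$ is the adjoint (transpose) of $E$. For a continuous $P:\mathbb{R}^d\to\mathbb{C}$, $\mathrm{Exp}(P)$ is the set of $E\in M_d(\mathbb{R})$ with $tP(\xi)=P(t^E\xi)$ for all $t>0$, $\xi\in\mathbb{R}^d$. $P$ is positive homogeneous if $R=\operatorname{Re}P$ is positive definite ($R(\xi)\ge 0$, with $R(\xi)=0$ only when $\xi=0$) and $\mathrm{Exp}(P)$ contains a matrix with real spectrum. For a positive homogeneous polynomial $P$ (complex coefficients, $d$ real variables), $\mu_P:=\operatorname{tr}E$ for any $E\in\mathrm{Exp}(P)$ (this is independent of the choice of $E$). When $\sup|\hat\phi|=1$, $\Omega(\phi)=\{\xi\in\mathbb{T}^d:|\hat\phi(\xi)|=1\}$. For $\xi_0\in\Omega(\phi)$ put $\Gamma_{\xi_0}(\xi)=\log\big(\hat\phi(\xi+\xi_0)/\hat\phi(\xi_0)\big)$ (principal branch) on a sufficiently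 small convex open neighborhood $\mathcal{U}$ of $0$. The point $\xi_0$ is of positive homogeneous type for $\hat\phi$ if the Taylor expansion of $\Gamma_{\xi_0}$ about $0$ is of the form $\Gamma_{\xi_0}(\xi)=i\alpha_{\xi_0}\cdot\xi-P_{\xi_0}(\xi)+\Upsilon_{\xi_0}(\xi)$, where $\alpha_{\xi_0}\in\mathbb{R}^d$ (the drift), $P_{\xi_0}$ is a positive homogeneous polynomial, and $\Upsilon_{\xi_0}(\xi)=o(\operatorname{Re}P_{\xi_0}(\xi))$ as $\xi\to 0$; then $\alpha_{\xi_0}$ and $P_{\xi_0}$ are unique and are said to be associated to $\xi_0$. *)

theory Defs
  imports "HOL-Analysis.Analysis" "HOL-Library.Landau_Symbols"
begin

definition real_vec :: "int ^ 'd \<Rightarrow> real ^ 'd" where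
  "real_vec x = (\<chi> i. real_of_int (x $ i))"

definition finitely_supported :: "(int ^ 'd \<Rightarrow> complex) \<Rightarrow> bool" where
  "finitely_supported \<phi> \<longleftrightarrow> finite {x. \<phi> x \<noteq> 0}"

definition convolution ::
    "(int ^ 'd \<Rightarrow> complex) \<Rightarrow> (int ^ 'd \<Rightarrow> complex) \<Rightarrow> int ^ 'd \<Rightarrow> complex" where
  "convolution \<psi> \<phi> x = (\<Sum>\<^sub>\<infinity>y. \<psi> (x - y) * \<phi> y)"

text \<open>The \<open>n\<close>-th convolution power is meant for \<open>n \<ge> 1\<close> only; the first power
  is \<open>\<phi>\<close> itself, and the value at \<open>n = 0\<close> carries no meaning.\<close>

definition convolution_power ::
    "(int ^ 'd \<Rightarrow> complex) \<Rightarrow> nat \<Rightarrow> int ^ 'd \<Rightarrow> complex" where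
  "convolution_power \<phi> n = ((\<lambda>\<psi>. convolution \<psi> \<phi>) ^^ (n - 1)) \<phi>"

definition fourier :: "(int ^ 'd \<Rightarrow> complex) \<Rightarrow> real ^ 'd \<Rightarrow> complex" where
  "fourier \<phi> \<xi> = (\<Sum>\<^sub>\<infinity>x. \<phi> x * exp (\<i> * complex_of_real (real_vec x \<bullet> \<xi>)))"

definition torus :: "(real ^ 'd) set" where
  "torus = {\<xi>. \<forall>i. - pi < \<xi> $ i \<and> \<xi> $ i \<le> pi}"

definition Omega :: "(int ^ 'd \<Rightarrow> complex) \<Rightarrow> (real ^ 'd) set" where
  "Omega \<phi> = {\<xi> \<in> torus. cmod (fourier \<phi> \<xi>) = 1}"

text \<open>The type \<open>real ^ 'd ^ 'd\<close> carries the componentwise product, so neither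
  \<open>(^)\<close> nor \<open>exp\<close> of the library give matrix powers or the matrix exponential.\<close>

definition matrix_power :: "real ^ 'd ^ 'd \<Rightarrow> nat \<Rightarrow> real ^ 'd ^ 'd" where
  "matrix_power A k = (((**) A) ^^ k) (mat 1)"

definition matrix_exp :: "real ^ 'd ^ 'd \<Rightarrow> real ^ 'd ^ 'd" where
  "matrix_exp A = (\<Sum>k. (1 / fact k) *\<^sub>R matrix_power A k)"

definition matrix_powr :: "real \<Rightarrow> real ^ 'd ^ 'd \<Rightarrow> real ^ 'd ^ 'd" where
  "matrix_powr t E = matrix_exp (ln t *\<^sub>R E)"

definition spectrum :: "real ^ 'd ^ 'd \<Rightarrow> complex set" where
  "spectrum E = {z. \<not> invertible (map_matrix complex_of_real E - mat z)}"

definition Exp_set :: "(real ^ 'd \<Rightarrow> complex) \<Rightarrow> (real ^ 'd ^ 'd) set" where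
  "Exp_set P = {E. \<forall>t>0. \<forall>\<xi>. complex_of_real t * P \<xi> = P (matrix_powr t E *v \<xi>)}"

definition positive_definite_fun :: "(real ^ 'd \<Rightarrow> real) \<Rightarrow> bool" where
  "positive_definite_fun R \<longleftrightarrow> (\<forall>\<xi>. R \<xi> \<ge> 0 \<and> (R \<xi> = 0 \<longrightarrow> \<xi> = 0))"

definition positive_homogeneous :: "(real ^ 'd \<Rightarrow> complex) \<Rightarrow> bool" where
  "positive_homogeneous P \<longleftrightarrow>
     continuous_on UNIV P \<and>
     positive_definite_fun (\<lambda>\<xi>. Re (P \<xi>)) \<and>
     (\<exists>E \<in> Exp_set P. spectrum E \<subseteq> \<real>)"

text \<open>For complex-valued functions on \<open>real ^ 'd\<close>, \<open>polynomial_function\<close> says that the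
  real and imaginary parts are real polynomials in the coordinates, i.e. that the function
  is a polynomial in \<open>d\<close> real variables with complex coefficients.\<close>

definition positive_homogeneous_polynomial :: "(real ^ 'd \<Rightarrow> complex) \<Rightarrow> bool" where
  "positive_homogeneous_polynomial P \<longleftrightarrow> polynomial_function P \<and> positive_homogeneous P"

text \<open>All elements of \<open>Exp_set P\<close> have the same trace when \<open>P\<close> is a positive homogeneous
  polynomial, so the choice made here is immaterial.\<close>

definition mu :: "(real ^ 'd \<Rightarrow> complex) \<Rightarrow> real" where
  "mu P = trace (SOME E. E \<in> Exp_set P)"

text \<open>\<open>Ln\<close> is the principal branch. Away from a neighbourhood of \<open>0\<close> the values of
  \<open>Gamma_at\<close> are irrelevant, as it is only used locally at \<open>0\<close>.\<close>

definition Gamma_at :: "(int ^ 'd \<Rightarrow> complex) \<Rightarrow> real ^ 'd \<Rightarrow> real ^ 'd \<Rightarrow> complex" where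
  "Gamma_at \<phi> \<xi>\<^sub>0 \<xi> = Ln (fourier \<phi> (\<xi> + \<xi>\<^sub>0) / fourier \<phi> \<xi>\<^sub>0)"

definition associated_to ::
    "(int ^ 'd \<Rightarrow> complex) \<Rightarrow> real ^ 'd \<Rightarrow> real ^ 'd \<Rightarrow> (real ^ 'd \<Rightarrow> complex) \<Rightarrow> bool" where
  "associated_to \<phi> \<xi>\<^sub>0 \<alpha> P \<longleftrightarrow>
     positive_homogeneous_polynomial P \<and>
     (\<exists>\<Upsilon>. (\<forall>\<^sub>F \<xi> in nhds 0.
             Gamma_at \<phi> \<xi>\<^sub>0 \<xi> = \<i> * complex_of_real (\<alpha> \<bullet> \<xi>) - P \<xi> + \<Upsilon> \<xi>) \<and>
          \<Upsilon> \<in> o[at 0](\<lambda>\<xi>. complex_of_real (Re (P \<xi>))))"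

definition positive_homogeneous_type :: "(int ^ 'd \<Rightarrow> complex) \<Rightarrow> real ^ 'd \<Rightarrow> bool" where
  "positive_homogeneous_type \<phi> \<xi>\<^sub>0 \<longleftrightarrow> (\<exists>\<alpha> P. associated_to \<phi> \<xi>\<^sub>0 \<alpha> P)"

end

theory Submission
  imports Defs "HOL-Complex_Analysis.Cauchy_Integral_Formula" "HOL-Computational_Algebra.Polynomial"
begin

text \<open>The value of a convolution power at \<open>x\<close> is a Fourier coefficient of the \<open>n\<close>-th power of the symbol
  \<open>fourier \<phi>\<close>, whose modulus is at most 1 and equals 1 only at the finitely many points of \<open>Omega \<phi>\<close> modulo the
  lattice. Near such a point \<open>q\<close> and after removal of the drift, the symbol is \<open>W = exp (- P + o(Re P))\<close>.
  The substitution \<open>\<xi> = q + n^(-E) \<eta>\<close> turns \<open>n P\<close> into \<open>P \<eta>\<close> and has the Jacobian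
  \<open>n^(- trace E) = n^(- mu P)\<close>, so that \<open>q\<close> contributes a constant times \<open>n^(- mu P)\<close>. For decay in
  \<open>y = n^(-E*) (x - n \<alpha>)\<close> one has to gain \<open>norm y ^ (-N)\<close> from the smoothness of \<open>W ^ n\<close> in the variable \<open>\<eta>\<close>.

  Integration by parts is replaced by finite differences. Multiplying the coefficients by
  \<open>(exp (i (k - n \<alpha>) \<bullet> h) - 1) ^ N\<close> replaces the transform by its \<open>N\<close>-th difference with step \<open>h\<close>,
  twisted by the drift. For \<open>h = n^(-E) (pi y / norm y ^ 2)\<close> the multiplier at \<open>x\<close> is \<open>(-2) ^ N\<close>, and the
  difference near \<open>q\<close> is \<open>O(norm y ^ (-N))\<close> times an integrable function of \<open>\<eta>\<close>. Real steps give multipliers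
  of modulus at most \<open>2 ^ N\<close>, so the differences belonging to all points of \<open>Omega \<phi>\<close>, each with its own
  drift, can be applied together: near \<open>q\<close> the differences of the other points merely translate the
  domain of integration (lemmas \<open>ball_integral_twists\<close> and
  \<open>convolution_power_bound\<close>).

  The uniform smoothness of \<open>W ^ n\<close> is the heart of the matter (lemmas \<open>line_variation\<close> and
  \<open>line_power_derivative_bound\<close>). It is obtained from the size of \<open>W - 1\<close> on real vectors alone. Since
  \<open>n^(-E)\<close> contracts like a power of \<open>n\<close>, all but finitely many Taylor terms of \<open>n (W - 1)\<close> are negligible
  after rescaling, and what remains is a polynomial of fixed degree; a polynomial that is bounded on a
  real interval is bounded on complex discs, and Cauchy's inequality applies.

  Away from the points where the modulus is 1 the symbol is exponentially small after taking powers. As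
  the \<open>n\<close>-th convolution power is supported in \<open>norm x = O(n)\<close>, where the right-hand side of the theorem is at least
  a power of \<open>1/n\<close>, this error is harmless (lemma \<open>profile_lower_bound\<close>). Finally, \<open>t^E t^(-F)\<close> preserves
  \<open>Re P\<close> for any two exponents and is therefore bounded uniformly in \<open>t\<close>, which makes the estimate
  independent of the exponents (lemma \<open>exponents_comparable\<close>).\<close>

section \<open>The one-parameter group of a matrix\<close>

lemma matrix_power_0 [simp]: "matrix_power A 0 = mat 1"
  by (simp add: matrix_power_def)

lemma matrix_power_Suc [simp]: "matrix_power A (Suc k) = A ** matrix_power A k"
  by (simp add: matrix_power_def)

lemma matrix_power_add: "matrix_power A (j + k) = matrix_power A j ** matrix_power A k"
  by (induction j) (simp_all add: matrix_mul_assoc)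

lemma matrix_power_scaleR: "matrix_power (s *\<^sub>R A) k = s ^ k *\<^sub>R matrix_power A k"
proof (induction k)
  case 0
  show ?case by simp
next
  case (Suc k)
  have "matrix_power (s *\<^sub>R A) (Suc k) = (s *\<^sub>R A) ** (s ^ k *\<^sub>R matrix_power A k)"
    using Suc by simp
  also have "\<dots> = s ^ k *\<^sub>R (s *\<^sub>R (A ** matrix_power A k))"
    by (simp only: matrix_scalar_ac scalar_matrix_assoc)
  finally show ?case by (simp add: mult.commute)
qed

definition entry_sum :: "real ^ 'd ^ 'd \<Rightarrow> real" where
  "entry_sum A = (\<Sum>i\<in>UNIV. \<Sum>j\<in>UNIV. \<bar>A $ i $ j\<bar>)"

lemma entry_sum_nonneg: "0 \<le> entry_sum A"
  by (simp add: entry_sum_def sum_nonneg)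

lemma row_sum_le: "(\<Sum>j\<in>UNIV. \<bar>A $ i $ j\<bar>) \<le> entry_sum A"
  unfolding entry_sum_def by (rule member_le_sum) (auto simp: sum_nonneg)

lemma matrix_power_entry_le: "\<bar>matrix_power A k $ i $ j\<bar> \<le> entry_sum A ^ k"
proof (induction k arbitrary: i)
  case 0
  then show ?case by (simp add: mat_def)
next
  case (Suc k)
  have "\<bar>matrix_power A (Suc k) $ i $ j\<bar> \<le> (\<Sum>l\<in>UNIV. \<bar>A $ i $ l * matrix_power A k $ l $ j\<bar>)"
    by (simp add: matrix_matrix_mult_def)
  also have "\<dots> \<le> (\<Sum>l\<in>UNIV. \<bar>A $ i $ l\<bar> * entry_sum A ^ k)"
    by (rule sum_mono) (auto simp: abs_mult intro!: mult_left_mono Suc)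
  also have "\<dots> = (\<Sum>l\<in>UNIV. \<bar>A $ i $ l\<bar>) * entry_sum A ^ k"
    by (simp add: sum_distrib_right)
  also have "\<dots> \<le> entry_sum A * entry_sum A ^ k"
    by (intro mult_right_mono row_sum_le) (simp add: entry_sum_nonneg)
  finally show ?case by simp
qed

text \<open>For a fixed matrix \<open>A\<close> every entry of the exponential of \<open>s A\<close> is a scalar power series
  in \<open>s\<close>. Working with these series entry by entry reduces the functional equation and the
  derivative to facts on real power series.\<close>

definition exp_coeff :: "real ^ 'd ^ 'd \<Rightarrow> 'd \<Rightarrow> 'd \<Rightarrow> nat \<Rightarrow> real" where
  "exp_coeff A i j k = matrix_power A k $ i $ j / fact k"

lemma exp_coeff_bound:
  "norm (exp_coeff A i j k * s ^ k) \<le> inverse (fact k) * (entry_sum A * \<bar>s\<bar>) ^ k"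
proof -
  have "norm (exp_coeff A i j k * s ^ k) = inverse (fact k) * (\<bar>matrix_power A k $ i $ j\<bar> * \<bar>s\<bar> ^ k)"
    by (simp add: exp_coeff_def abs_mult power_abs divide_simps)
  also have "\<dots> \<le> inverse (fact k) * (entry_sum A ^ k * \<bar>s\<bar> ^ k)"
    by (intro mult_left_mono mult_right_mono matrix_power_entry_le) auto
  finally show ?thesis by (simp add: power_mult_distrib)
qed

lemma exp_coeff_summable_norm: "summable (\<lambda>k. norm (exp_coeff A i j k * s ^ k))"
  by (rule summable_comparison_test'[OF summable_exp[of "entry_sum A * \<bar>s\<bar>"], of 0])
    (use exp_coeff_bound in auto)

lemma exp_coeff_summable: "summable (\<lambda>k. exp_coeff A i j k * s ^ k)"
  using exp_coeff_summable_norm by (rule summable_norm_cancel)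

lemma matrix_sums_iff:
  fixes f :: "nat \<Rightarrow> real ^ 'd ^ 'd"
  shows "f sums B \<longleftrightarrow> (\<forall>i j. (\<lambda>k. f k $ i $ j) sums (B $ i $ j))"
proof
  assume "f sums B"
  then show "\<forall>i j. (\<lambda>k. f k $ i $ j) sums (B $ i $ j)"
    unfolding sums_def using tendsto_vec_nth[OF tendsto_vec_nth] by fastforce
next
  assume "\<forall>i j. (\<lambda>k. f k $ i $ j) sums (B $ i $ j)"
  then show "f sums B"
    unfolding sums_def by (intro vec_tendstoI) simp
qed

lemma matrix_exp_sums: "(\<lambda>k. (1 / fact k) *\<^sub>R matrix_power A k) sums matrix_exp A"
proof -
  have "(\<lambda>k. (1 / fact k) *\<^sub>R matrix_power A k) sums
      (\<chi> i j. \<Sum>k. matrix_power A k $ i $ j / fact k)"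
  proof -
    have "(\<lambda>k. matrix_power A k $ i $ j / fact k) sums (\<Sum>k. matrix_power A k $ i $ j / fact k)" for i j
      using summable_sums[OF exp_coeff_summable[of A i j 1]] by (simp add: exp_coeff_def)
    then show ?thesis
      unfolding matrix_sums_iff by simp
  qed
  then show ?thesis
    unfolding matrix_exp_def using summable_sums sums_summable by blast
qed

lemma matrix_exp_entry: "matrix_exp (s *\<^sub>R A) $ i $ j = (\<Sum>k. exp_coeff A i j k * s ^ k)"
proof -
  have "(\<lambda>k. ((1 / fact k) *\<^sub>R matrix_power (s *\<^sub>R A) k) $ i $ j) sums (matrix_exp (s *\<^sub>R A) $ i $ j)"
    using matrix_exp_sums[of "s *\<^sub>R A"] unfolding matrix_sums_iff by blast
  then show ?thesis
    by (simp add: matrix_power_scaleR exp_coeff_def sums_iff mult.commute)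
qed

lemma matrix_exp_entry_le: "\<bar>matrix_exp (s *\<^sub>R A) $ i $ j\<bar> \<le> exp (entry_sum A * \<bar>s\<bar>)"
proof -
  have "\<bar>matrix_exp (s *\<^sub>R A) $ i $ j\<bar> \<le> (\<Sum>k. norm (exp_coeff A i j k * s ^ k))"
    unfolding matrix_exp_entry using summable_norm[OF exp_coeff_summable_norm] by simp
  also have "\<dots> \<le> (\<Sum>k. inverse (fact k) * (entry_sum A * \<bar>s\<bar>) ^ k)"
    by (intro suminf_le exp_coeff_bound exp_coeff_summable_norm summable_exp)
  also have "\<dots> = exp (entry_sum A * \<bar>s\<bar>)"
    by (simp add: exp_def inverse_eq_divide)
  finally show ?thesis .
qed

lemma matrix_exp_zero: "matrix_exp 0 = (mat 1 :: real ^ 'd ^ 'd)"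
proof -
  have "matrix_exp (0 *\<^sub>R 0) $ i $ j = (mat 1 :: real ^ 'd ^ 'd) $ i $ j" for i j
    unfolding matrix_exp_entry powser_zero by (simp add: exp_coeff_def)
  then show ?thesis by (simp add: vec_eq_iff)
qed

text \<open>Each product of two entries is a Cauchy product of series; summing over the inner index
  collects \<open>A^m A^(k-m) = A^k\<close>, and the binomial theorem does the rest.\<close>

lemma matrix_exp_add_scaleR:
  "matrix_exp ((s + t) *\<^sub>R A) = matrix_exp (s *\<^sub>R A) ** matrix_exp (t *\<^sub>R A)"
proof -
  have "matrix_exp ((s + t) *\<^sub>R A) $ i $ j = (matrix_exp (s *\<^sub>R A) ** matrix_exp (t *\<^sub>R A)) $ i $ j" for i j
  proof -
    have "(\<lambda>k. \<Sum>m\<le>k. (exp_coeff A i l m * s ^ m) * (exp_coeff A l j (k - m) * t ^ (k - m))) sums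
        (matrix_exp (s *\<^sub>R A) $ i $ l * matrix_exp (t *\<^sub>R A) $ l $ j)" for l
      unfolding matrix_exp_entry by (intro Cauchy_product_sums exp_coeff_summable_norm)
    then have "(\<lambda>k. \<Sum>l\<in>UNIV. \<Sum>m\<le>k. (exp_coeff A i l m * s ^ m) * (exp_coeff A l j (k - m) * t ^ (k - m)))
        sums (matrix_exp (s *\<^sub>R A) ** matrix_exp (t *\<^sub>R A)) $ i $ j"
      unfolding matrix_matrix_mult_def by (simp add: sums_sum)
    moreover have "(\<Sum>l\<in>UNIV. \<Sum>m\<le>k. (exp_coeff A i l m * s ^ m) * (exp_coeff A l j (k - m) * t ^ (k - m)))
        = exp_coeff A i j k * (s + t) ^ k" for k
    proof -
      have "(\<Sum>l\<in>UNIV. \<Sum>m\<le>k. (exp_coeff A i l m * s ^ m) * (exp_coeff A l j (k - m) * t ^ (k - m)))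
          = (\<Sum>m\<le>k. (\<Sum>l\<in>UNIV. matrix_power A m $ i $ l * matrix_power A (k - m) $ l $ j)
              * (s ^ m * t ^ (k - m) / (fact m * fact (k - m))))"
        by (subst sum.swap) (simp add: exp_coeff_def sum_distrib_right sum_distrib_left mult_ac)
      also have "\<dots> = (\<Sum>m\<le>k. matrix_power A k $ i $ j * (s ^ m * t ^ (k - m) / (fact m * fact (k - m))))"
      proof (rule sum.cong[OF refl])
        fix m assume "m \<in> {..k}"
        then have "matrix_power A k = matrix_power A m ** matrix_power A (k - m)"
          by (metis atMost_iff le_add_diff_inverse matrix_power_add)
        then show "(\<Sum>l\<in>UNIV. matrix_power A m $ i $ l * matrix_power A (k - m) $ l $ j)
              * (s ^ m * t ^ (k - m) / (fact m * fact (k - m)))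
            = matrix_power A k $ i $ j * (s ^ m * t ^ (k - m) / (fact m * fact (k - m)))"
          by (simp add: matrix_matrix_mult_def)
      qed
      also have "\<dots> = exp_coeff A i j k * (\<Sum>m\<le>k. of_nat (k choose m) * s ^ m * t ^ (k - m))"
        by (simp add: exp_coeff_def sum_distrib_left binomial_fact mult_ac)
      finally show ?thesis by (simp add: binomial_ring)
    qed
    ultimately show ?thesis
      unfolding matrix_exp_entry by (simp add: sums_iff)
  qed
  then show ?thesis by (simp add: vec_eq_iff)
qed

lemma transpose_matrix_power: "transpose (matrix_power A k) = matrix_power (transpose A) k"
proof (induction k)
  case 0
  then show ?case by (simp add: transpose_mat)
next
  case (Suc k)
  have "matrix_power (transpose A) (Suc k) = matrix_power (transpose A) (k + 1)" by simp
  also have "\<dots> = matrix_power (transpose A) k ** matrix_power (transpose A) (Suc 0)"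
    by (subst matrix_power_add) simp
  finally show ?case by (simp add: matrix_transpose_mul Suc)
qed

lemma transpose_matrix_exp: "transpose (matrix_exp A) = matrix_exp (transpose A)"
proof -
  have e: "exp_coeff (transpose A) i j k = exp_coeff A j i k" for i j k
    unfolding exp_coeff_def transpose_matrix_power[symmetric] by (simp add: transpose_def)
  have "matrix_exp (1 *\<^sub>R A) $ j $ i = matrix_exp (1 *\<^sub>R transpose A) $ i $ j" for i j
    unfolding matrix_exp_entry e ..
  then show ?thesis
    by (simp add: transpose_def vec_eq_iff)
qed

lemma matrix_exp_entry_has_derivative_0:
  "((\<lambda>s. matrix_exp (s *\<^sub>R A) $ i $ j) has_real_derivative A $ i $ j) (at 0)"
proof -
  have "((\<lambda>s. \<Sum>k. exp_coeff A i j k * s ^ k) has_real_derivative (\<Sum>k. diffs (exp_coeff A i j) k * 0 ^ k)) (at 0)"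
    by (intro termdiffs_strong_converges_everywhere exp_coeff_summable)
  then show ?thesis
    unfolding matrix_exp_entry powser_zero by (simp add: diffs_def exp_coeff_def)
qed

lemma continuous_matrix_exp_entry: "continuous_on UNIV (\<lambda>s. matrix_exp (s *\<^sub>R A) $ i $ j)"
proof -
  have "((\<lambda>s. \<Sum>k. exp_coeff A i j k * s ^ k) has_real_derivative (\<Sum>k. diffs (exp_coeff A i j) k * x ^ k)) (at x)" for x
    by (intro termdiffs_strong_converges_everywhere exp_coeff_summable)
  then show ?thesis
    unfolding matrix_exp_entry by (meson DERIV_isCont continuous_at_imp_continuous_on)
qed

text \<open>At \<open>s = 0\<close> the matrix is the identity. In the Leibniz formula the derivative of the product
  belonging to a permutation keeps all factors but one at their values \<open>0\<close> or \<open>1\<close>, and a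
  permutation other than the identity moves at least two indices, so that one factor \<open>0\<close>
  always survives. The identity contributes the trace.\<close>

lemma det_matrix_exp_has_derivative_0:
  fixes A :: "real ^ 'd ^ 'd"
  shows "((\<lambda>s. det (matrix_exp (s *\<^sub>R A))) has_real_derivative trace A) (at 0)"
proof -
  let ?X = "\<lambda>s. matrix_exp (s *\<^sub>R A)"
  have *: "((\<lambda>s. \<Prod>i\<in>UNIV. ?X s $ i $ p i) has_real_derivative
      (if p = id then trace A else 0)) (at 0)" if "p permutes (UNIV :: 'd set)" for p
  proof -
    have deriv: "((\<lambda>s. \<Prod>i\<in>UNIV. ?X s $ i $ p i) has_real_derivative
        (\<Sum>i\<in>UNIV. A $ i $ p i * (\<Prod>j\<in>UNIV - {i}. ?X 0 $ j $ p j))) (at 0)"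
      by (rule has_field_derivative_prod) (rule matrix_exp_entry_has_derivative_0)
    have "A $ i $ p i * (\<Prod>j\<in>UNIV - {i}. ?X 0 $ j $ p j) = (if p = id then A $ i $ i else 0)" for i
    proof (cases "p = id")
      case True
      then show ?thesis by (simp add: matrix_exp_zero mat_def)
    next
      case False
      have "\<exists>j. j \<noteq> i \<and> p j \<noteq> j"
      proof (rule ccontr)
        assume a: "\<not> ?thesis"
        then have "p i = i"
          using that by (metis permutes_def)
        with a have "p = id" by force
        with False show False by simp
      qed
      then show ?thesis using False
        by (auto simp: matrix_exp_zero mat_def prod_zero_iff)
    qed
    then have "(\<Sum>i\<in>UNIV. A $ i $ p i * (\<Prod>j\<in>UNIV - {i}. ?X 0 $ j $ p j)) = (if p = id then trace A else 0)"
      by (simp only:) (simp add: trace_def)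
    with deriv show ?thesis
      by (simp only:)
  qed
  have "((\<lambda>s. \<Sum>p\<in>{p. p permutes (UNIV :: 'd set)}. of_int (sign p) * (\<Prod>i\<in>UNIV. ?X s $ i $ p i))
     has_real_derivative (\<Sum>p\<in>{p. p permutes (UNIV :: 'd set)}. of_int (sign p) * (if p = id then trace A else 0))) (at 0)"
    by (intro DERIV_sum DERIV_cmult *) auto
  moreover have "(\<Sum>p\<in>{p. p permutes (UNIV :: 'd set)}. of_int (sign p) * (if p = id then trace A else 0))
      = (\<Sum>p\<in>{p. p permutes (UNIV :: 'd set)}. if p = id then trace A else 0)"
    by (rule sum.cong) (auto simp: sign_id)
  moreover have "\<dots> = trace A"
    by (simp add: finite_permutations permutes_id)
  ultimately show ?thesis
    unfolding det_def by simp
qed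

text \<open>By multiplicativity the derivative at \<open>0\<close> yields the differential equation
  \<open>f' = trace A * f\<close> for the determinant along the whole one-parameter group.\<close>

lemma det_matrix_exp: "det (matrix_exp (s *\<^sub>R A)) = exp (s * trace A)"
proof -
  let ?f = "\<lambda>s. det (matrix_exp (s *\<^sub>R A))"
  have d: "(?f has_real_derivative trace A * ?f s) (at s)" for s
  proof -
    have "((\<lambda>h. ?f (s + h)) has_real_derivative ?f s * trace A) (at 0)"
      unfolding matrix_exp_add_scaleR det_mul
      by (intro DERIV_cmult det_matrix_exp_has_derivative_0)
    then show ?thesis
      using DERIV_at_within_shift[of ?f "?f s * trace A" s 0 UNIV] by (simp add: mult.commute)
  qed
  have "((\<lambda>s. ?f s * exp (- s * trace A)) has_real_derivative 0) (at s)" for s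
    by (auto intro!: derivative_eq_intros d)
  then have "?f s * exp (- s * trace A) = ?f 0 * exp (- 0 * trace A)"
    using DERIV_isconst_all by blast
  then show ?thesis
    by (simp add: matrix_exp_zero exp_minus field_simps)
qed

lemma matrix_powr_1: "matrix_powr 1 E = mat 1"
  by (simp add: matrix_powr_def matrix_exp_zero)

lemma matrix_powr_mult:
  "s > 0 \<Longrightarrow> t > 0 \<Longrightarrow> matrix_powr (s * t) E = matrix_powr s E ** matrix_powr t E"
  by (simp add: matrix_powr_def ln_mult matrix_exp_add_scaleR)

lemma matrix_powr_minus: "t > 0 \<Longrightarrow> matrix_powr t (- E) = matrix_powr (1 / t) E"
  by (simp add: matrix_powr_def ln_div)

lemma transpose_matrix_powr: "transpose (matrix_powr t E) = matrix_powr t (transpose E)"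
  unfolding matrix_powr_def transpose_matrix_exp by (simp add: transpose_scalar)

lemma matrix_powr_inverse:
  assumes "t > 0"
  shows "matrix_powr t E ** matrix_powr (1 / t) E = mat 1"
    and "matrix_powr (1 / t) E ** matrix_powr t E = mat 1"
  using matrix_powr_mult[of t "1 / t" E] matrix_powr_mult[of "1 / t" t E] assms
  by (simp_all add: matrix_powr_1)

lemma det_matrix_powr: "t > 0 \<Longrightarrow> det (matrix_powr t E) = t powr trace E"
  by (simp add: matrix_powr_def det_matrix_exp powr_def mult.commute)

lemma norm_matrix_vector_le_entry_bound:
  assumes "\<And>i j. \<bar>A $ i $ j\<bar> \<le> B"
  shows "norm ((A :: real ^ 'd ^ 'd) *v v) \<le> real CARD('d) ^ 2 * B * norm v"
proof -
  have "norm (A *v v) \<le> (\<Sum>i\<in>UNIV. \<bar>(A *v v) $ i\<bar>)"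
    by (rule norm_le_l1_cart)
  also have "\<dots> \<le> (\<Sum>i\<in>(UNIV::'d set). \<Sum>j\<in>(UNIV::'d set). B * norm v)"
  proof (rule sum_mono)
    fix i
    have "\<bar>(A *v v) $ i\<bar> \<le> (\<Sum>j\<in>UNIV. \<bar>A $ i $ j * v $ j\<bar>)"
      by (simp add: matrix_vector_mult_def)
    also have "\<dots> \<le> (\<Sum>j\<in>(UNIV::'d set). B * norm v)"
      using order_trans[OF abs_ge_zero assms]
      by (intro sum_mono) (auto simp: abs_mult intro!: mult_mono assms component_le_norm_cart)
    finally show "\<bar>(A *v v) $ i\<bar> \<le> (\<Sum>j\<in>(UNIV::'d set). B * norm v)" .
  qed
  also have "\<dots> = real CARD('d) ^ 2 * B * norm v"
    by (simp add: power2_eq_square)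
  finally show ?thesis .
qed

lemma norm_matrix_powr_le:
  assumes "t \<ge> 1"
  shows "norm (matrix_powr t E *v (v :: real ^ 'd)) \<le> real CARD('d) ^ 2 * t powr entry_sum E * norm v"
proof (rule norm_matrix_vector_le_entry_bound)
  show "\<bar>matrix_powr t E $ i $ j\<bar> \<le> t powr entry_sum E" for i j
    using matrix_exp_entry_le[of "ln t" E i j] assms
    by (simp add: matrix_powr_def powr_def)
qed

lemma continuous_on_matrix_powr:
  "continuous_on {0<..} (\<lambda>t. matrix_powr t E *v v)"
proof -
  have *: "continuous_on {0<..} (\<lambda>t. matrix_exp (ln t *\<^sub>R E) $ i $ j)" for i j
    by (rule continuous_on_compose2[OF continuous_matrix_exp_entry[of E i j]])
      (auto intro!: continuous_intros)
  show ?thesis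
    unfolding matrix_powr_def matrix_vector_mult_def
    by (intro continuous_on_vec_lambda continuous_on_sum continuous_on_mult_right *)
qed

section \<open>Volume distortion of the one-parameter group\<close>

text \<open>The volume factor of a linear map comes from elementary row operations, which presuppose an
  order on the coordinates. A finite index type carries no order of its own; renaming the
  coordinates by a copy of the type, ordered through an injection into the natural numbers,
  provides one.\<close>

typedef 'a well_ordered_copy = "UNIV :: 'a set"
  morphisms uncopy copy by simp

instance well_ordered_copy :: (finite) finite
proof
  have "finite (copy ` (UNIV :: 'a set))"
    by simp
  then show "finite (UNIV :: 'a well_ordered_copy set)"
    unfolding type_definition.Abs_image[OF type_definition_well_ordered_copy] .
qed

instantiation well_ordered_copy :: (finite) wellorder
begin

definition rank_copy :: "'a well_ordered_copy \<Rightarrow> nat" where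
  "rank_copy = (SOME f. inj f)"

definition less_eq_well_ordered_copy :: "'a well_ordered_copy \<Rightarrow> 'a well_ordered_copy \<Rightarrow> bool" where
  "x \<le> y \<longleftrightarrow> rank_copy x \<le> rank_copy y"

definition less_well_ordered_copy :: "'a well_ordered_copy \<Rightarrow> 'a well_ordered_copy \<Rightarrow> bool" where
  "x < y \<longleftrightarrow> rank_copy x < rank_copy y"

instance
proof
  have "\<exists>f :: 'a well_ordered_copy \<Rightarrow> nat. inj f"
    using finite_imp_inj_to_nat_seg[OF finite, of "UNIV :: 'a well_ordered_copy set"] by blast
  then have inj: "inj (rank_copy :: 'a well_ordered_copy \<Rightarrow> nat)"
    unfolding rank_copy_def by (rule someI_ex)
  fix x y z :: "'a well_ordered_copy"
  show "x < y \<longleftrightarrow> x \<le> y \<and> \<not> y \<le> x"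
    unfolding less_eq_well_ordered_copy_def less_well_ordered_copy_def by linarith
  show "x \<le> x"
    unfolding less_eq_well_ordered_copy_def by simp
  show "x \<le> y \<Longrightarrow> y \<le> z \<Longrightarrow> x \<le> z"
    unfolding less_eq_well_ordered_copy_def by linarith
  show "x \<le> y \<or> y \<le> x"
    unfolding less_eq_well_ordered_copy_def by linarith
  show "x \<le> y \<Longrightarrow> y \<le> x \<Longrightarrow> x = y"
    using inj unfolding less_eq_well_ordered_copy_def by (simp add: inj_eq)
next
  fix P :: "'a well_ordered_copy \<Rightarrow> bool" and a
  assume step: "\<And>x. (\<And>y. y < x \<Longrightarrow> P y) \<Longrightarrow> P x"
  show "P a"
  proof (induction a rule: measure_induct_rule[of rank_copy])
    case (less x)
    show "P x"
      by (rule step, rule less) (simp only: less_well_ordered_copy_def)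
  qed
qed

end

lemma copy_uncopy_simps [simp]: "copy (uncopy i) = i" "uncopy (copy j) = j"
  by (simp_all add: uncopy_inverse copy_inverse)

definition vec_copy :: "real ^ 'd \<Rightarrow> real ^ 'd well_ordered_copy" where
  "vec_copy v = (\<chi> i. v $ uncopy i)"

definition vec_uncopy :: "real ^ 'd well_ordered_copy \<Rightarrow> real ^ 'd" where
  "vec_uncopy v = (\<chi> i. v $ copy i)"

definition mat_copy :: "real ^ 'd ^ 'd \<Rightarrow> real ^ 'd well_ordered_copy ^ 'd well_ordered_copy" where
  "mat_copy A = (\<chi> i j. A $ uncopy i $ uncopy j)"

lemma vec_copy_inverse [simp]: "vec_uncopy (vec_copy v) = v" "vec_copy (vec_uncopy w) = w"
  by (simp_all add: vec_copy_def vec_uncopy_def vec_eq_iff)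

lemma sum_copy: "(\<Sum>i\<in>UNIV. f (uncopy i)) = (\<Sum>i\<in>UNIV. f i)"
  by (rule sum.reindex_bij_witness[of _ copy uncopy]) auto

lemma mat_copy_mult: "mat_copy (A ** B) = mat_copy A ** mat_copy B"
proof -
  have "mat_copy (A ** B) $ i $ j = (mat_copy A ** mat_copy B) $ i $ j" for i j
    using sum_copy[of "\<lambda>k. A $ uncopy i $ k * B $ k $ uncopy j"]
    by (simp add: mat_copy_def matrix_matrix_mult_def)
  then show ?thesis by (simp add: vec_eq_iff)
qed

lemma mat_copy_vector: "vec_copy (A *v v) = mat_copy A *v vec_copy v"
proof -
  have "vec_copy (A *v v) $ i = (mat_copy A *v vec_copy v) $ i" for i
    using sum_copy[of "\<lambda>k. A $ uncopy i $ k * v $ k"]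
    by (simp add: mat_copy_def vec_copy_def matrix_vector_mult_def)
  then show ?thesis by (simp add: vec_eq_iff)
qed

lemma mat_copy_mat: "mat_copy (mat c) = mat c"
  by (auto simp: vec_eq_iff mat_copy_def mat_def uncopy_inject)

lemma trace_mat_copy: "trace (mat_copy A) = trace A"
  by (simp add: trace_def mat_copy_def sum_copy[where f = "\<lambda>i. A $ i $ i"])

lemma matrix_power_mat_copy: "matrix_power (mat_copy A) k = mat_copy (matrix_power A k)"
  by (induction k) (simp_all add: mat_copy_mat mat_copy_mult)

lemma matrix_exp_mat_copy: "matrix_exp (mat_copy A) = mat_copy (matrix_exp A)"
proof -
  have "matrix_exp (1 *\<^sub>R mat_copy A) $ i $ j = matrix_exp (1 *\<^sub>R A) $ uncopy i $ uncopy j" for i j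
    unfolding matrix_exp_entry exp_coeff_def matrix_power_mat_copy by (simp add: mat_copy_def)
  then show ?thesis by (simp add: vec_eq_iff mat_copy_def)
qed

lemma matrix_powr_mat_copy: "matrix_powr t (mat_copy E) = mat_copy (matrix_powr t E)"
proof -
  have "ln t *\<^sub>R mat_copy E = mat_copy (ln t *\<^sub>R E)"
    by (simp add: vec_eq_iff mat_copy_def)
  then show ?thesis by (simp add: matrix_powr_def matrix_exp_mat_copy)
qed

lemma vec_copy_measurable [measurable]: "vec_copy \<in> borel_measurable borel"
  unfolding vec_copy_def by (intro borel_measurable_continuous_onI continuous_intros continuous_on_vec_lambda)

lemma vec_uncopy_measurable [measurable]: "vec_uncopy \<in> borel_measurable borel"
  unfolding vec_uncopy_def by (intro borel_measurable_continuous_onI continuous_intros continuous_on_vec_lambda)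

lemma prod_Basis_cart: "(\<Prod>b\<in>(Basis :: (real ^ 'd) set). f b) = (\<Prod>i\<in>UNIV. f (axis i 1))"
proof -
  have inj: "inj_on (\<lambda>i. axis i (1::real)) (UNIV :: 'd set)"
    by (auto simp: inj_on_def axis_eq_axis)
  have "(Basis :: (real ^ 'd) set) = range (\<lambda>i. axis i 1)"
    by (auto simp: Basis_vec_def)
  then have "prod f (Basis :: (real ^ 'd) set) = prod f (range (\<lambda>i. axis i 1))"
    by (rule arg_cong)
  also have "\<dots> = (\<Prod>i\<in>UNIV. f (axis i 1))"
    by (simp add: prod.reindex[OF inj])
  finally show ?thesis .
qed

lemma lborel_vec_uncopy: "distr lborel borel vec_uncopy = (lborel :: (real ^ 'd) measure)"
proof (rule lborel_eqI[symmetric])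
  fix l u :: "real ^ 'd"
  assume le: "\<And>b. b \<in> Basis \<Longrightarrow> l \<bullet> b \<le> u \<bullet> b"
  have le': "l $ i \<le> u $ i" for i
    using le[of "axis i 1"] by (simp add: inner_axis axis_in_Basis_iff)
  have "vec_uncopy -` box l u = box (vec_copy l) (vec_copy u)"
    by (auto simp: mem_box_cart vec_copy_def vec_uncopy_def) (metis copy_uncopy_simps)+
  moreover have "emeasure lborel (box (vec_copy l) (vec_copy u)) = (\<Prod>b\<in>Basis. (vec_copy u - vec_copy l) \<bullet> b)"
    by (rule emeasure_lborel_box) (auto simp: Basis_vec_def inner_axis vec_copy_def le')
  moreover have "(\<Prod>b\<in>Basis. (vec_copy u - vec_copy l) \<bullet> b) = (\<Prod>b\<in>Basis. (u - l) \<bullet> b)"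
    unfolding prod_Basis_cart
    by (rule prod.reindex_bij_witness[of _ copy uncopy]) (auto simp: inner_axis vec_copy_def)
  ultimately show "emeasure (distr lborel borel vec_uncopy) (box l u) = (\<Prod>b\<in>Basis. (u - l) \<bullet> b)"
    by (simp add: emeasure_distr)
qed simp

lemma nn_integral_vec_uncopy:
  assumes [measurable]: "f \<in> borel_measurable borel"
  shows "(\<integral>\<^sup>+v. f (vec_uncopy v) \<partial>lborel) = (\<integral>\<^sup>+v. f v \<partial>lborel)"
  by (subst (2) lborel_vec_uncopy[symmetric]) (simp add: nn_integral_distr)

text \<open>Up to the constant factor the image of Lebesgue measure agrees with Lebesgue measure on boxes,
  hence everywhere.\<close>

lemma nn_integral_linear_wellorder:
  fixes L :: "real ^ 'n::{finite,wellorder} \<Rightarrow> real ^ 'n::_"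
  assumes "linear L" "linear M" and LM: "\<And>v. L (M v) = v" "\<And>v. M (L v) = v"
    and [measurable]: "f \<in> borel_measurable borel"
  shows "(\<integral>\<^sup>+v. f (L v) \<partial>lborel) = ennreal \<bar>det (matrix M)\<bar> * (\<integral>\<^sup>+v. f v \<partial>lborel)"
proof -
  have [measurable]: "L \<in> borel_measurable borel"
    using assms(1) by (intro borel_measurable_continuous_onI linear_continuous_on linear_conv_bounded_linear[THEN iffD1])
  have "det (matrix L) * det (matrix M) = 1"
    using assms by (simp add: det_mul[symmetric] matrix_compose[symmetric] o_def matrix_id[unfolded id_def])
  then have detM: "det (matrix M) \<noteq> 0" and detL: "\<bar>det (matrix L)\<bar> * \<bar>det (matrix M)\<bar> = 1"
    by (auto simp: abs_mult[symmetric])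
  have "lborel = density (distr lborel borel L) (\<lambda>_. ennreal \<bar>det (matrix L)\<bar>)"
  proof (rule lborel_eqI)
    fix l u :: "real ^ 'n::_"
    assume le: "\<And>b. b \<in> Basis \<Longrightarrow> l \<bullet> b \<le> u \<bullet> b"
    have pre: "L -` box l u = M ` box l u"
      using LM by (auto simp: image_def) (metis)
    have [measurable]: "M ` box l u \<in> sets borel"
      unfolding pre[symmetric] using measurable_sets[of L borel borel "box l u"] by simp
    have m: "M ` box l u \<in> lmeasurable"
      using assms(2) by (intro measurable_linear_image) auto
    have "emeasure lborel (M ` box l u) = emeasure lebesgue (M ` box l u)"
      by simp
    also have "\<dots> = ennreal (measure lebesgue (M ` box l u))"
      using m by (simp add: emeasure_eq_measure2 fmeasurableD2)
    also have "\<dots> = ennreal (\<bar>det (matrix M)\<bar> * measure lebesgue (box l u))"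
      using assms(2) by (subst measure_linear_image) auto
    also have "\<dots> = ennreal \<bar>det (matrix M)\<bar> * (\<Prod>b\<in>Basis. (u - l) \<bullet> b)"
      using le by (simp add: ennreal_mult prod_nonneg inner_diff_left)
    finally have "emeasure lborel (M ` box l u) = ennreal \<bar>det (matrix M)\<bar> * (\<Prod>b\<in>Basis. (u - l) \<bullet> b)" .
    then have "emeasure (density (distr lborel borel L) (\<lambda>_. ennreal \<bar>det (matrix L)\<bar>)) (box l u)
        = ennreal \<bar>det (matrix L)\<bar> * (ennreal \<bar>det (matrix M)\<bar> * (\<Prod>b\<in>Basis. (u - l) \<bullet> b))"
      by (simp add: emeasure_density emeasure_distr nn_integral_distr nn_integral_cmult_indicator pre)
    also have "\<dots> = (\<Prod>b\<in>Basis. (u - l) \<bullet> b)"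
      by (simp add: mult.assoc[symmetric] ennreal_mult[symmetric] detL)
    finally show "emeasure (density (distr lborel borel L) (\<lambda>_. ennreal \<bar>det (matrix L)\<bar>)) (box l u)
       = (\<Prod>b\<in>Basis. (u - l) \<bullet> b)" .
  qed simp
  then have "(\<integral>\<^sup>+v. f v \<partial>lborel) = (\<integral>\<^sup>+v. f v \<partial>density (distr lborel borel L) (\<lambda>_. ennreal \<bar>det (matrix L)\<bar>))"
    by simp
  also have "\<dots> = ennreal \<bar>det (matrix L)\<bar> * (\<integral>\<^sup>+v. f (L v) \<partial>lborel)"
    by (simp add: nn_integral_density nn_integral_cmult nn_integral_distr)
  finally have "ennreal \<bar>det (matrix M)\<bar> * (\<integral>\<^sup>+v. f v \<partial>lborel) =
      (ennreal \<bar>det (matrix M)\<bar> * ennreal \<bar>det (matrix L)\<bar>) * (\<integral>\<^sup>+v. f (L v) \<partial>lborel)"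
    by (simp add: mult.assoc)
  also have "ennreal \<bar>det (matrix M)\<bar> * ennreal \<bar>det (matrix L)\<bar> = 1"
    using detL by (simp add: ennreal_mult[symmetric] mult.commute)
  finally show ?thesis by simp
qed

text \<open>The renaming of coordinates commutes with \<open>t^E\<close> and preserves the trace, so the formula \<open>det (t^E) = t^(trace E)\<close> is applied to the
  renamed exponent.\<close>

lemma nn_integral_matrix_powr:
  fixes E :: "real ^ 'd ^ 'd"
  assumes t: "t > 0" and [measurable]: "f \<in> borel_measurable borel"
  shows "(\<integral>\<^sup>+v. f (matrix_powr t E *v v) \<partial>lborel) = ennreal (t powr (- trace E)) * (\<integral>\<^sup>+v. f v \<partial>lborel)"
proof -
  let ?E = "mat_copy E"
  have [measurable]: "(\<lambda>v. matrix_powr t E *v v) \<in> borel_measurable borel"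
    by (intro borel_measurable_continuous_onI matrix_vector_mult_linear_continuous_on)
  have comm: "matrix_powr t E *v vec_uncopy v = vec_uncopy (matrix_powr t ?E *v v)" for v
  proof -
    have "vec_copy (matrix_powr t E *v vec_uncopy v) = matrix_powr t ?E *v v"
      by (simp add: mat_copy_vector matrix_powr_mat_copy)
    then have "vec_uncopy (vec_copy (matrix_powr t E *v vec_uncopy v)) = vec_uncopy (matrix_powr t ?E *v v)"
      by (rule arg_cong)
    then show ?thesis by simp
  qed
  have "(\<integral>\<^sup>+v. f (matrix_powr t E *v v) \<partial>lborel)
      = (\<integral>\<^sup>+v. f (matrix_powr t E *v vec_uncopy v) \<partial>lborel)"
    by (subst nn_integral_vec_uncopy[of "\<lambda>v. f (matrix_powr t E *v v)"]) simp_all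
  also have "\<dots> = (\<integral>\<^sup>+v. f (vec_uncopy (matrix_powr t ?E *v v)) \<partial>lborel)"
    by (simp add: comm)
  also have "\<dots> = ennreal \<bar>det (matrix (\<lambda>v. matrix_powr (1 / t) ?E *v v))\<bar> * (\<integral>\<^sup>+v. f (vec_uncopy v) \<partial>lborel)"
    using matrix_powr_inverse[OF t, of ?E]
    by (intro nn_integral_linear_wellorder[where f = "\<lambda>v. f (vec_uncopy v)"])
      (auto simp: matrix_vector_mul_assoc)
  also have "\<bar>det (matrix (\<lambda>v. matrix_powr (1 / t) ?E *v v))\<bar> = t powr (- trace E)"
    using t by (simp add: det_matrix_powr trace_mat_copy powr_divide powr_minus inverse_eq_divide)
  finally show ?thesis by (simp add: nn_integral_vec_uncopy)
qed

text \<open>Since \<open>(1 + norm v)\<^sup>2\<close> dominates \<open>1 + (v \<bullet> b)\<^sup>2\<close> for every coordinate direction \<open>b\<close>, the integrand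
  is below a product of integrable functions of one variable each.\<close>

lemma nn_integral_decay_finite:
  "(\<integral>\<^sup>+v. ennreal (1 / (1 + norm (v :: real ^ 'd)) ^ (2 * CARD('d))) \<partial>lborel) < \<infinity>"
proof -
  have one: "(\<integral>\<^sup>+x. ennreal (1 / (1 + x\<^sup>2)) \<partial>lborel) < \<infinity>"
  proof -
    have half: "(\<integral>\<^sup>+x. ennreal (1 / (1 + x\<^sup>2)) * indicator {0..} x \<partial>lborel) = ennreal (pi / 2 - arctan 0)"
    proof (rule nn_integral_FTC_atLeast)
      show "(arctan has_real_derivative 1 / (1 + x\<^sup>2)) (at x)" for x
        using DERIV_arctan[of x] by (simp only: inverse_eq_divide)
    qed (auto intro: tendsto_arctan_at_top)
    have "(\<integral>\<^sup>+x. ennreal (1 / (1 + x\<^sup>2)) * indicator {..0} x \<partial>lborel)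
        = ennreal \<bar>-1\<bar> * (\<integral>\<^sup>+x. ennreal (1 / (1 + (0 + (-1) * x)\<^sup>2)) * indicator {..0} (0 + (-1) * x) \<partial>lborel)"
      by (rule nn_integral_real_affine) auto
    also have "\<dots> = (\<integral>\<^sup>+x. ennreal (1 / (1 + x\<^sup>2)) * indicator {0..} x \<partial>lborel)"
      by (auto intro!: nn_integral_cong simp: indicator_def)
    finally have half': "(\<integral>\<^sup>+x. ennreal (1 / (1 + x\<^sup>2)) * indicator {..0} x \<partial>lborel) = ennreal (pi / 2)"
      by (simp add: half)
    have "(\<integral>\<^sup>+x. ennreal (1 / (1 + x\<^sup>2)) \<partial>lborel)
        \<le> (\<integral>\<^sup>+x. ennreal (1 / (1 + x\<^sup>2)) * indicator {0..} x + ennreal (1 / (1 + x\<^sup>2)) * indicator {..0} x \<partial>lborel)"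
      by (intro nn_integral_mono) (auto simp: indicator_def)
    also have "\<dots> = ennreal (pi / 2) + ennreal (pi / 2)"
      by (subst nn_integral_add) (simp_all add: half half')
    also have "\<dots> < \<infinity>" by simp
    finally show ?thesis .
  qed
  have "ennreal (1 / (1 + norm v) ^ (2 * CARD('d))) \<le> (\<Prod>b\<in>Basis. ennreal (1 / (1 + (v \<bullet> b)\<^sup>2)))" for v :: "real ^ 'd"
  proof -
    have "(\<Prod>b\<in>(Basis :: (real ^ 'd) set). 1 / (1 + norm v)\<^sup>2) \<le> (\<Prod>b\<in>Basis. 1 / (1 + (v \<bullet> b)\<^sup>2))"
    proof (rule prod_mono, intro conjI)
      fix b :: "real ^ 'd" assume "b \<in> Basis"
      then have "(v \<bullet> b)\<^sup>2 \<le> (norm v)\<^sup>2"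
        using Basis_le_norm[of b v] by (simp add: abs_le_square_iff[symmetric])
      moreover have "(1 + norm v)\<^sup>2 = 1 + (norm v)\<^sup>2 + 2 * norm v"
        by (simp add: power2_sum)
      ultimately have "1 + (v \<bullet> b)\<^sup>2 \<le> (1 + norm v)\<^sup>2"
        using norm_ge_zero[of v] by linarith
      then show "1 / (1 + norm v)\<^sup>2 \<le> 1 / (1 + (v \<bullet> b)\<^sup>2)"
        by (intro frac_le) (auto intro: add_pos_nonneg)
    qed auto
    then show ?thesis
      by (simp add: prod_ennreal power_one_over power_mult ennreal_leI)
  qed
  then have "(\<integral>\<^sup>+v. ennreal (1 / (1 + norm (v :: real ^ 'd)) ^ (2 * CARD('d))) \<partial>lborel)
      \<le> (\<integral>\<^sup>+v. (\<Prod>b\<in>(Basis :: (real ^ 'd) set). ennreal (1 / (1 + (v \<bullet> b)\<^sup>2))) \<partial>lborel)"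
    by (intro nn_integral_mono) auto
  also have "\<dots> = (\<Prod>b\<in>(Basis :: (real ^ 'd) set). \<integral>\<^sup>+x. ennreal (1 / (1 + x\<^sup>2)) \<partial>lborel)"
    by (rule nn_integral_lborel_prod) auto
  also have "\<dots> < \<infinity>"
    using one by (simp add: ennreal_prod_eq_top less_top power_less_top_ennreal)
  finally show ?thesis .
qed

section \<open>Homogeneous polynomials with positive definite real part\<close>

lemma power_div_fact_le_exp:
  fixes y :: real
  assumes "0 \<le> y"
  shows "y ^ k / fact k \<le> exp y"
proof -
  have "(\<Sum>i\<in>{k}. inverse (fact i) * y ^ i) \<le> (\<Sum>i. inverse (fact i) * y ^ i)"
    using assms by (intro sum_le_suminf summable_exp) auto
  then show ?thesis
    by (simp add: exp_def divide_inverse mult.commute)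
qed

locale homogeneous_polynomial =
  fixes P :: "real ^ 'd \<Rightarrow> complex" and E :: "real ^ 'd ^ 'd"
  assumes poly: "polynomial_function P"
    and pos: "positive_definite_fun (\<lambda>\<xi>. Re (P \<xi>))"
    and E: "E \<in> Exp_set P"
begin

abbreviation R where "R \<equiv> \<lambda>\<xi>. Re (P \<xi>)"

lemma R_nonneg: "0 \<le> R \<xi>"
  using pos by (simp add: positive_definite_fun_def)

lemma R_pos: "\<xi> \<noteq> 0 \<Longrightarrow> 0 < R \<xi>"
  using pos by (auto simp: positive_definite_fun_def order_less_le)

lemma R_continuous: "continuous_on S R"
  using continuous_on_polymonial_function[OF poly] by (intro continuous_intros)

lemma P_scale: "F \<in> Exp_set P \<Longrightarrow> t > 0 \<Longrightarrow> P (matrix_powr t F *v \<xi>) = of_real t * P \<xi>"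
  by (simp add: Exp_set_def)

lemma R_scale: "F \<in> Exp_set P \<Longrightarrow> t > 0 \<Longrightarrow> R (matrix_powr t F *v \<xi>) = t * R \<xi>"
  by (simp add: P_scale)

lemma P_zero: "P 0 = 0"
  using P_scale[OF E, of 2 0] by simp

lemma sphere_lower_bound:
  obtains m where "m > 0" "\<And>\<xi>. norm \<xi> = 1 \<Longrightarrow> m \<le> R \<xi>"
proof -
  have ne: "sphere (0 :: real ^ 'd) 1 \<noteq> {}" by simp
  obtain a where a: "a \<in> sphere 0 1" "\<And>\<xi>. \<xi> \<in> sphere 0 1 \<Longrightarrow> R a \<le> R \<xi>"
    using continuous_attains_inf[OF compact_sphere ne R_continuous] by blast
  then have "R a > 0" by (intro R_pos) auto
  with a that show ?thesis by auto
qed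

lemma ball_upper_bound:
  obtains M where "M > 0" "\<And>\<xi>. norm \<xi> \<le> r \<Longrightarrow> R \<xi> \<le> M"
proof -
  have "bounded (R ` cball 0 r)"
    by (intro compact_imp_bounded compact_continuous_image R_continuous compact_cball)
  then obtain M where M: "M > 0" "\<forall>y\<in>R ` cball 0 r. norm y \<le> M"
    by (auto simp: bounded_pos)
  have "R \<xi> \<le> M" if "norm \<xi> \<le> r" for \<xi>
  proof -
    have "R \<xi> \<in> R ` cball 0 r" using that by simp
    with M(2) have "norm (R \<xi>) \<le> M" by blast
    then show ?thesis by simp
  qed
  with M(1) show ?thesis by (rule that)
qed

text \<open>If \<open>t^(-E) \<xi>\<close> left the open unit ball, then by linearity a suitable multiple of \<open>\<xi>\<close> of norm at most
  \<open>r\<close> would be mapped onto the unit sphere. There \<open>R\<close> is at least \<open>m\<close>, whereas the map has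
  divided it by \<open>t\<close>.\<close>

lemma contraction_of_small_level:
  assumes m: "m > 0" "\<And>\<xi>. norm \<xi> = 1 \<Longrightarrow> m \<le> R \<xi>"
    and M: "\<And>\<xi>. norm \<xi> \<le> r \<Longrightarrow> R \<xi> \<le> M"
    and t: "t > 0" "M / m < t" and \<xi>: "norm \<xi> \<le> r"
  shows "norm (matrix_powr (1 / t) E *v \<xi>) < 1"
proof (rule ccontr)
  let ?v = "matrix_powr (1 / t) E *v \<xi>"
  assume "\<not> norm ?v < 1"
  then have n: "norm ?v \<ge> 1" by simp
  define c where "c = 1 / norm ?v"
  have l: "0 < c" "c \<le> 1" "norm (c *\<^sub>R ?v) = 1"
    using n by (auto simp: c_def divide_simps)
  have "norm (c *\<^sub>R \<xi>) \<le> r"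
  proof -
    have "c * norm \<xi> \<le> 1 * norm \<xi>"
      using l by (intro mult_right_mono) auto
    then show ?thesis using l \<xi> by simp
  qed
  then have "R (matrix_powr (1 / t) E *v (c *\<^sub>R \<xi>)) \<le> M / t"
    using M t(1) by (simp add: R_scale[OF E] divide_right_mono)
  moreover have "m \<le> R (matrix_powr (1 / t) E *v (c *\<^sub>R \<xi>))"
    using l(3) by (intro m(2)) (simp add: matrix_vector_mult_scaleR)
  ultimately have "m \<le> M / t" by linarith
  with t m(1) show False by (simp add: field_simps)
qed

text \<open>Applied to the ball of radius 2, the previous lemma provides an \<open>s\<close> for which \<open>s^(-E)\<close> halves all
  norms. Iteration turns this into a power rate.\<close>

lemma contraction_rate:
  obtains K a where "K > 0" "a > 0"
    "\<And>t \<xi>. t \<ge> 1 \<Longrightarrow> norm (matrix_powr (1 / t) E *v \<xi>) \<le> K * t powr (- a) * norm \<xi>"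
proof -
  obtain m where m: "m > 0" "\<And>\<xi>. norm \<xi> = 1 \<Longrightarrow> m \<le> R \<xi>"
    using sphere_lower_bound by blast
  obtain M where M: "M > 0" "\<And>\<xi>. norm \<xi> \<le> 2 \<Longrightarrow> R \<xi> \<le> M"
    using ball_upper_bound by blast
  \<comment> \<open>With \<open>M\<close> taken on the ball of radius 2, images of norm below 1 mean that norms are
    halved.\<close>
  define s where "s = M / m + 2"
  have s: "s > 1" "M / m < s" using m M by (auto simp: s_def divide_simps add_pos_pos)
  have half: "norm (matrix_powr (1 / s) E *v \<xi>) \<le> norm \<xi> / 2" for \<xi>
  proof (cases "\<xi> = 0")
    case False
    have "norm (matrix_powr (1 / s) E *v ((2 / norm \<xi>) *\<^sub>R \<xi>)) < 1"
      using s False by (intro contraction_of_small_level[OF m M(2)]) auto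
    then show ?thesis
      using False by (simp add: matrix_vector_mult_scaleR divide_simps)
  qed simp
  have iter: "norm (matrix_powr (1 / s ^ k) E *v \<xi>) \<le> (1 / 2) ^ k * norm \<xi>" for k \<xi>
  proof (induction k)
    case (Suc k)
    have "matrix_powr (1 / s ^ Suc k) E *v \<xi> = matrix_powr (1 / s) E *v (matrix_powr (1 / s ^ k) E *v \<xi>)"
      using matrix_powr_mult[of "1 / s" "1 / s ^ k" E] s(1) by (simp add: matrix_vector_mul_assoc)
    then show ?case
      using half[of "matrix_powr (1 / s ^ k) E *v \<xi>"] Suc by simp
  qed (simp add: matrix_powr_1)
  \<comment> \<open>A bound for \<open>t^(-E)\<close> on the fundamental range \<open>1 \<le> t \<le> s\<close>; every
    \<open>t \<ge> 1\<close> is \<open>r * s ^ k\<close> with \<open>r\<close> in this range.\<close>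
  define D where "D = real CARD('d) ^ 2 * s powr entry_sum (- E)"
  have D: "D > 0" using s(1) by (simp add: D_def)
  have small: "norm (matrix_powr (1 / t) E *v \<xi>) \<le> D * norm \<xi>" if "1 \<le> t" "t \<le> s" for t \<xi>
  proof -
    have "norm (matrix_powr (1 / t) E *v \<xi>) \<le> real CARD('d) ^ 2 * t powr entry_sum (- E) * norm \<xi>"
      using norm_matrix_powr_le[of t "- E" \<xi>] that by (simp add: matrix_powr_minus)
    also have "\<dots> \<le> D * norm \<xi>"
      unfolding D_def using that by (intro mult_right_mono mult_left_mono powr_mono2) (auto simp: entry_sum_nonneg)
    finally show ?thesis .
  qed
  define a where "a = log s 2"
  have a: "a > 0" using s by (simp add: a_def)
  have "norm (matrix_powr (1 / t) E *v \<xi>) \<le> 2 * D * t powr (- a) * norm \<xi>" if t: "t \<ge> 1" for t \<xi>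
  proof -
    define k where "k = nat \<lfloor>log s t\<rfloor>"
    have lg: "log s t \<ge> 0" using t s by simp
    then have k: "real k \<le> log s t" "log s t < real k + 1"
      by (auto simp: k_def of_nat_nat)
    define r where "r = t / s ^ k"
    have "s ^ k \<le> t"
      using k(1) s t by (simp add: powr_realpow[symmetric] le_log_iff)
    moreover have "t \<le> s ^ k * s"
      using k(2) s t by (simp add: powr_realpow[symmetric] less_eq_real_def log_less_iff powr_add)
    ultimately have r: "1 \<le> r" "r \<le> s"
      using s by (simp_all add: r_def divide_simps mult.commute)
    have "matrix_powr (1 / t) E *v \<xi> = matrix_powr (1 / r) E *v (matrix_powr (1 / s ^ k) E *v \<xi>)"
    proof -
      have "1 / t = (1 / r) * (1 / s ^ k)" using s t by (simp add: r_def)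
      then show ?thesis
        using r s by (simp only: matrix_vector_mul_assoc) (subst matrix_powr_mult[symmetric]; simp)
    qed
    then have "norm (matrix_powr (1 / t) E *v \<xi>) \<le> D * ((1 / 2) ^ k * norm \<xi>)"
      using small[OF r, of "matrix_powr (1 / s ^ k) E *v \<xi>"] iter[of k \<xi>] D
      by (smt (verit) mult_left_mono)
    also have "(1 / 2 :: real) ^ k \<le> 2 * t powr (- a)"
    proof -
      have "t powr a = 2 powr (log s t)"
        using s t by (simp add: a_def powr_def log_def)
      also have "\<dots> \<le> 2 powr (real k + 1)"
        using k(2) by (intro powr_mono) auto
      also have "\<dots> = 2 * 2 ^ k"
        by (simp add: powr_add powr_realpow)
      finally have "t powr a \<le> 2 * 2 ^ k" .
      then show ?thesis
        using t by (simp add: powr_minus power_one_over divide_simps mult.commute)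
    qed
    finally show ?thesis using D by (simp add: mult_ac mult_left_mono mult_right_mono)
  qed
  then show ?thesis using that[of "2 * D" a] D a by auto
qed

text \<open>The orbit of \<open>\<xi>\<close> under \<open>t^(-E)\<close> tends to \<open>0\<close> and so crosses the unit sphere. This allows the values of
  \<open>P\<close> far out to be compared with those on the sphere.\<close>

lemma orbit_meets_sphere:
  assumes \<xi>: "norm \<xi> \<ge> 1"
  obtains t where "t \<ge> 1" "norm (matrix_powr (1 / t) E *v \<xi>) = 1"
    "matrix_powr t E *v (matrix_powr (1 / t) E *v \<xi>) = \<xi>"
proof -
  obtain K a where K: "K > 0" "a > 0"
    "\<And>t \<xi>. t \<ge> 1 \<Longrightarrow> norm (matrix_powr (1 / t) E *v \<xi>) \<le> K * t powr (- a) * norm \<xi>"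
    using contraction_rate by blast
  let ?f = "\<lambda>t. norm (matrix_powr (1 / t) E *v \<xi>)"
  have "((\<lambda>t. K * t powr (- a) * norm \<xi>) \<longlongrightarrow> K * 0 * norm \<xi>) at_top"
    using K by (intro tendsto_intros tendsto_neg_powr filterlim_ident) auto
  then have "eventually (\<lambda>t. K * t powr (- a) * norm \<xi> < 1) at_top"
    by (rule order_tendstoD) simp
  then obtain T where T: "T \<ge> 1" "K * T powr (- a) * norm \<xi> < 1"
    by (metis (no_types, lifting) eventually_at_top_linorder nle_le)
  have "?f T \<le> 1" using K(3)[of T \<xi>] T by linarith
  moreover have "?f 1 \<ge> 1" using \<xi> by (simp add: matrix_powr_1)
  moreover have "continuous_on {1..T} ?f"
    by (intro continuous_on_norm continuous_on_compose2[OF continuous_on_matrix_powr])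
      (auto intro!: continuous_intros)
  ultimately obtain t where t: "1 \<le> t" "?f t = 1"
    using IVT2'[of ?f T 1 1] T by auto
  moreover have "matrix_powr t E *v (matrix_powr (1 / t) E *v \<xi>) = \<xi>"
    using matrix_powr_inverse(1)[of t E] t by (simp add: matrix_vector_mul_assoc)
  ultimately show ?thesis by (rule that)
qed

text \<open>At the crossing time \<open>t\<close> the value \<open>R \<xi> / t\<close> is attained on the unit sphere. As \<open>t^E\<close> grows at most
  polynomially in \<open>t\<close>, this \<open>t\<close> is at least a power of \<open>norm \<xi>\<close>.\<close>

lemma coercive:
  obtains m b where "m > 0" "b > 0" "\<And>\<xi>. norm \<xi> \<ge> 1 \<Longrightarrow> m * norm \<xi> powr b \<le> R \<xi>"
proof -
  obtain m where m: "m > 0" "\<And>\<xi>. norm \<xi> = 1 \<Longrightarrow> m \<le> R \<xi>"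
    using sphere_lower_bound by blast
  \<comment> \<open>The summand 1 keeps the exponent \<open>1 / L\<close> meaningful.\<close>
  define L where "L = entry_sum E + 1"
  define D where "D = real CARD('d) ^ 2"
  have L: "L > 0" and D: "D > 0" using entry_sum_nonneg[of E] by (auto simp: L_def D_def)
  have "m * (1 / D) powr (1 / L) * norm \<xi> powr (1 / L) \<le> R \<xi>" if \<xi>: "norm \<xi> \<ge> 1" for \<xi>
  proof -
    obtain t where t: "1 \<le> t" "norm (matrix_powr (1 / t) E *v \<xi>) = 1"
      and \<xi>v: "matrix_powr t E *v (matrix_powr (1 / t) E *v \<xi>) = \<xi>"
      by (rule orbit_meets_sphere[OF \<xi>])
    let ?v = "matrix_powr (1 / t) E *v \<xi>"
    have "R \<xi> = t * R ?v" using R_scale[OF E, of t ?v] t \<xi>v by simp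
    then have Rt: "m * t \<le> R \<xi>"
      using m(2)[OF t(2)] t by (simp add: mult.commute)
    have "norm \<xi> \<le> D * t powr entry_sum E"
      using norm_matrix_powr_le[of t E ?v] t \<xi>v by (simp add: D_def)
    also have "\<dots> \<le> D * t powr L"
      using t D by (intro mult_left_mono powr_mono) (auto simp: L_def)
    finally have "(1 / D) * norm \<xi> \<le> t powr L"
      using D by (simp add: field_simps)
    then have "((1 / D) * norm \<xi>) powr (1 / L) \<le> (t powr L) powr (1 / L)"
      using D L by (intro powr_mono2) auto
    also have "\<dots> = t" using t L by (simp add: powr_powr)
    finally have "(1 / D) powr (1 / L) * norm \<xi> powr (1 / L) \<le> t"
      using D by (subst powr_mult[symmetric]) auto
    then have "m * ((1 / D) powr (1 / L) * norm \<xi> powr (1 / L)) \<le> m * t"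
      using m by simp
    with Rt show ?thesis by (simp add: mult.assoc)
  qed
  then show ?thesis
    using that[of "m * (1 / D) powr (1 / L)" "1 / L"] m D L by simp
qed

text \<open>For two exponents \<open>E\<close> and \<open>F\<close> the matrix \<open>t^E t^(-F)\<close> leaves \<open>R\<close> invariant. By coercivity such
  matrices are bounded, uniformly in \<open>t\<close> and \<open>F\<close>; this makes the final constant independent of
  the choice of exponents.\<close>

lemma exponents_comparable:
  obtains C where "C \<ge> 1"
    "\<And>F t v. F \<in> Exp_set P \<Longrightarrow> t > 0 \<Longrightarrow>
       norm (matrix_powr t (- transpose F) *v v) \<le> C * norm (matrix_powr t (- transpose E) *v v)"
proof -
  obtain m b where mb: "m > 0" "b > 0" "\<And>\<xi>. norm \<xi> \<ge> 1 \<Longrightarrow> m * norm \<xi> powr b \<le> R \<xi>"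
    using coercive by blast
  obtain M where M: "M > 0" "\<And>\<xi>. norm \<xi> \<le> 1 \<Longrightarrow> R \<xi> \<le> M"
    using ball_upper_bound by blast
  define B where "B = 1 + (M / m) powr (1 / b)"
  have B: "norm \<xi> \<le> B" if "R \<xi> \<le> M" for \<xi>
  proof (cases "norm \<xi> \<ge> 1")
    case True
    have "norm \<xi> powr b \<le> M / m"
      using mb(3)[OF True] that mb(1) by (simp add: field_simps)
    then have "(norm \<xi> powr b) powr (1 / b) \<le> (M / m) powr (1 / b)"
      using mb by (intro powr_mono2) auto
    then show ?thesis using mb(2) by (simp add: powr_powr B_def)
  next
    case False
    then show ?thesis by (simp add: B_def add_increasing2)
  qed
  define C where "C = real CARD('d) ^ 2 * B"
  have B1: "B \<ge> 1" by (simp add: B_def)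
  have "norm (matrix_powr t (- transpose F) *v v) \<le> C * norm (matrix_powr t (- transpose E) *v v)"
    if F: "F \<in> Exp_set P" and t: "t > 0" for F t v
  proof -
    define S where "S = matrix_powr t E ** matrix_powr (1 / t) F"
    have RS: "R (S *v \<xi>) = R \<xi>" for \<xi>
      using R_scale[OF E, of t "matrix_powr (1 / t) F *v \<xi>"] R_scale[OF F, of "1 / t" \<xi>] t
      by (simp add: S_def matrix_vector_mul_assoc)
    have entries: "\<bar>S $ i $ j\<bar> \<le> B" for i j
    proof -
      have "\<bar>(S *v axis j 1) $ i\<bar> \<le> norm (S *v axis j 1)"
        by (rule component_le_norm_cart)
      also have "\<dots> \<le> B"
        by (intro B) (simp add: RS M norm_axis_1)
      finally show ?thesis
        by (simp add: matrix_vector_mul_component inner_axis)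
    qed
    have "matrix_powr t (- transpose F) *v v = transpose S *v (matrix_powr t (- transpose E) *v v)"
    proof -
      have "transpose S ** transpose (matrix_powr (1 / t) E) = transpose (matrix_powr (1 / t) F)"
        using matrix_powr_inverse(2)[OF t, of E]
        by (simp add: S_def matrix_transpose_mul[symmetric] matrix_mul_assoc)
      then show ?thesis
        using t by (simp add: matrix_powr_minus transpose_matrix_powr matrix_vector_mul_assoc)
    qed
    then show ?thesis
      unfolding C_def using norm_matrix_vector_le_entry_bound[of "transpose S" B] entries
      by (simp add: transpose_def)
  qed
  moreover have "C \<ge> 1"
  proof -
    have "real CARD('d) ^ 2 \<ge> 1" by (simp add: Suc_leI)
    then have "1 * 1 \<le> real CARD('d) ^ 2 * B" using B1 by (intro mult_mono) auto
    then show ?thesis by (simp add: C_def)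
  qed
  ultimately show ?thesis using that by blast
qed

text \<open>Conversely the contraction rate bounds the crossing time by a power of \<open>norm \<xi>\<close>.\<close>

lemma polynomial_growth:
  obtains C m where "C > 0" "\<And>\<xi>. cmod (P \<xi>) \<le> C * (1 + norm \<xi>) ^ m"
proof -
  obtain K a where K: "K > 0" "a > 0"
    "\<And>t \<xi>. t \<ge> 1 \<Longrightarrow> norm (matrix_powr (1 / t) E *v \<xi>) \<le> K * t powr (- a) * norm \<xi>"
    using contraction_rate by blast
  have "bounded (P ` cball 0 1)"
    by (intro compact_imp_bounded compact_continuous_image compact_cball continuous_on_polymonial_function[OF poly])
  then obtain M where M: "M > 0" "\<forall>y\<in>P ` cball 0 1. norm y \<le> M"
    by (auto simp: bounded_pos)
  have M': "cmod (P \<xi>) \<le> M" if "norm \<xi> \<le> 1" for \<xi>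
    using M(2) that by simp
  obtain m :: nat where m: "1 / a \<le> real m"
    using real_arch_simple by blast
  have K1: "(K + 1) ^ m \<ge> 1" using K(1) by (intro one_le_power) simp
  have "cmod (P \<xi>) \<le> M * (K + 1) ^ m * (1 + norm \<xi>) ^ m" for \<xi>
  proof (cases "norm \<xi> \<ge> 1")
    case True
    obtain t where t: "1 \<le> t" "norm (matrix_powr (1 / t) E *v \<xi>) = 1"
      and \<xi>v: "matrix_powr t E *v (matrix_powr (1 / t) E *v \<xi>) = \<xi>"
      by (rule orbit_meets_sphere[OF True])
    have "t powr a \<le> K * norm \<xi>"
      using K(3)[OF t(1), of \<xi>] t by (simp add: powr_minus field_simps)
    then have "(t powr a) powr (1 / a) \<le> (K * norm \<xi>) powr (1 / a)"
      using K(2) by (intro powr_mono2) auto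
    then have "t \<le> (K * norm \<xi>) powr (1 / a)"
      using t K(2) by (simp add: powr_powr)
    also have "\<dots> \<le> ((K + 1) * (1 + norm \<xi>)) powr (1 / a)"
      using K by (intro powr_mono2 mult_mono) auto
    also have "\<dots> \<le> ((K + 1) * (1 + norm \<xi>)) powr real m"
      using K(1) m mult_mono[of 1 "K + 1" 1 "1 + norm \<xi>"] by (intro powr_mono) auto
    also have "\<dots> = ((K + 1) * (1 + norm \<xi>)) ^ m"
      using K(1) by (intro powr_realpow mult_pos_pos add_pos_nonneg) auto
    finally have "t * M \<le> ((K + 1) * (1 + norm \<xi>)) ^ m * M"
      using M(1) by (intro mult_right_mono) auto
    moreover have "cmod (P \<xi>) \<le> t * M"
      using P_scale[OF E, of t "matrix_powr (1 / t) E *v \<xi>"] M'[of "matrix_powr (1 / t) E *v \<xi>"] t \<xi>v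
      by (simp add: norm_mult)
    ultimately show ?thesis by (simp add: power_mult_distrib mult_ac)
  next
    case False
    have "1 \<le> (K + 1) ^ m * (1 + norm \<xi>) ^ m"
      using K1 mult_mono[of 1 "(K + 1) ^ m" 1 "(1 + norm \<xi>) ^ m"] by (simp add: one_le_power)
    then have "M * 1 \<le> M * ((K + 1) ^ m * (1 + norm \<xi>) ^ m)"
      using M(1) by (intro mult_left_mono) auto
    with M'[of \<xi>] False show ?thesis by (simp add: mult.assoc)
  qed
  moreover have "M * (K + 1) ^ m > 0" using M(1) K(1) by simp
  ultimately show ?thesis using that by blast
qed

end

text \<open>By coercivity the exponential beats every power.\<close>

lemma (in homogeneous_polynomial) exp_decay:
  obtains C where "C > 0" "\<And>\<xi>. (1 + norm \<xi>) ^ L * exp (- R \<xi> / 2) \<le> C"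
proof -
  obtain m b where mb: "m > 0" "b > 0" "\<And>\<xi>. norm \<xi> \<ge> 1 \<Longrightarrow> m * norm \<xi> powr b \<le> R \<xi>"
    using coercive by blast
  obtain k :: nat where k: "real L \<le> b * real k"
    using reals_Archimedean3[OF mb(2), rule_format, of "real L"] by (auto simp: mult.commute intro: less_imp_le)
  define C where "C = 2 ^ L + 2 ^ L * (fact k * (2 / m) ^ k)"
  have pos: "0 \<le> (2::real) ^ L * (fact k * (2 / m) ^ k)" using mb by auto
  have "(1 + norm \<xi>) ^ L * exp (- R \<xi> / 2) \<le> C" for \<xi>
  proof (cases "norm \<xi> \<ge> 1")
    case False
    have "(1 + norm \<xi>) ^ L * exp (- R \<xi> / 2) \<le> 2 ^ L * 1"
      using False R_nonneg[of \<xi>] by (intro mult_mono power_mono) auto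
    then show ?thesis using pos by (simp add: C_def)
  next
    case True
    define y where "y = m * norm \<xi> powr b / 2"
    have "norm \<xi> powr b > 0" using True by (subst powr_gt_zero) auto
    then have y: "y > 0" using mb(1) by (simp add: y_def)
    have "y ^ k / fact k \<le> exp y"
      using y by (intro power_div_fact_le_exp) simp
    then have ey: "exp (- y) * y ^ k \<le> fact k"
      by (simp add: exp_minus divide_simps mult.commute)
    have "norm \<xi> ^ L = norm \<xi> powr real L"
      using True by (subst powr_realpow) auto
    also have "\<dots> \<le> norm \<xi> powr (b * real k)"
      using True k by (intro powr_mono) auto
    also have "\<dots> = (norm \<xi> powr b) ^ k"
      using \<open>norm \<xi> powr b > 0\<close> by (simp add: powr_powr[symmetric] powr_realpow[symmetric])
    also have "\<dots> = (2 / m) ^ k * y ^ k"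
      using mb by (simp add: y_def power_mult_distrib[symmetric])
    finally have nL: "norm \<xi> ^ L \<le> (2 / m) ^ k * y ^ k" .
    have "(1 + norm \<xi>) ^ L * exp (- R \<xi> / 2) \<le> (2 * norm \<xi>) ^ L * exp (- y)"
      using True mb(3)[OF True] by (intro mult_mono power_mono) (auto simp: y_def)
    also have "\<dots> = 2 ^ L * (norm \<xi> ^ L * exp (- y))"
      by (simp add: power_mult_distrib)
    also have "\<dots> \<le> 2 ^ L * ((2 / m) ^ k * y ^ k * exp (- y))"
      using nL by (intro mult_left_mono mult_right_mono) auto
    also have "\<dots> = 2 ^ L * ((2 / m) ^ k * (exp (- y) * y ^ k))" by (simp add: mult_ac)
    also have "\<dots> \<le> 2 ^ L * ((2 / m) ^ k * fact k)"
      using ey mb by (intro mult_left_mono) auto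
    also have "\<dots> \<le> C" by (simp add: C_def mult_ac)
    finally show ?thesis .
  qed
  moreover have "C > 0" using pos by (simp add: C_def add_pos_nonneg)
  ultimately show ?thesis using that by blast
qed

section \<open>Polynomials, the exponential and differences in one complex variable\<close>

text \<open>Induction on the degree: in the combination \<open>p t - 2^(M+1) p (t/2)\<close> the term of degree \<open>M + 1\<close>
  cancels, while every other coefficient of \<open>p\<close> is multiplied by a number of modulus at least 1.\<close>

lemma coeff_bound_unit_interval:
  "\<exists>K\<ge>0. \<forall>(a :: nat \<Rightarrow> complex) B.
     (\<forall>t. 0 \<le> t \<and> t \<le> 1 \<longrightarrow> cmod (\<Sum>j\<le>M. a j * of_real t ^ j) \<le> B) \<longrightarrow> (\<forall>j\<le>M. cmod (a j) \<le> K * B)"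
proof (induction M)
  case 0
  show ?case by (rule exI[of _ 1]) auto
next
  case (Suc M)
  then obtain K where K: "K \<ge> 0" "\<And>(a :: nat \<Rightarrow> complex) B j.
     (\<forall>t. 0 \<le> t \<and> t \<le> 1 \<longrightarrow> cmod (\<Sum>j\<le>M. a j * of_real t ^ j) \<le> B) \<Longrightarrow> j \<le> M \<Longrightarrow> cmod (a j) \<le> K * B"
    by blast
  define K1 where "K1 = K * (1 + 2 ^ Suc M)"
  define K' where "K' = K1 + 1 + real (Suc M) * K1"
  have K1: "K1 \<ge> 0" using K by (simp add: K1_def)
  have "cmod (a j) \<le> K' * B" if a: "\<And>t. 0 \<le> t \<Longrightarrow> t \<le> 1 \<Longrightarrow> cmod (\<Sum>j\<le>Suc M. a j * of_real t ^ j) \<le> B"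
    and j: "j \<le> Suc M" for a :: "nat \<Rightarrow> complex" and B j
  proof -
    define p where "p = (\<lambda>t. \<Sum>j\<le>Suc M. a j * (of_real t :: complex) ^ j)"
    have B: "B \<ge> 0" using order_trans[OF norm_ge_zero a[of 0]] by simp
    define a' where "a' = (\<lambda>j. a j * (1 - 2 ^ Suc M / 2 ^ j))"
    have p': "(\<Sum>j\<le>M. a' j * of_real t ^ j) = p t - 2 ^ Suc M * p (t / 2)" for t
    proof -
      have "(\<Sum>j\<le>M. a' j * of_real t ^ j) = (\<Sum>j\<le>Suc M. a' j * of_real t ^ j)"
        by (simp add: a'_def)
      also have "\<dots> = (\<Sum>j\<le>Suc M. a j * of_real t ^ j - 2 ^ Suc M * (a j * of_real (t / 2) ^ j))"
        by (rule sum.cong) (auto simp: a'_def power_divide algebra_simps)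
      also have "\<dots> = p t - 2 ^ Suc M * p (t / 2)"
        unfolding p_def sum_subtractf sum_distrib_left ..
      finally show ?thesis .
    qed
    have le_M: "cmod (a j) \<le> K1 * B" if j: "j \<le> M" for j
    proof -
      have "cmod (\<Sum>j\<le>M. a' j * of_real t ^ j) \<le> (1 + 2 ^ Suc M) * B" if t: "0 \<le> t" "t \<le> 1" for t
      proof -
        have "cmod (p t - 2 ^ Suc M * p (t / 2)) \<le> cmod (p t) + 2 ^ Suc M * cmod (p (t / 2))"
          using norm_triangle_ineq4[of "p t" "2 ^ Suc M * p (t / 2)"] by (simp add: norm_mult norm_power)
        also have "\<dots> \<le> B + 2 ^ Suc M * B"
          unfolding p_def using t by (intro add_mono mult_left_mono a) auto
        finally show ?thesis unfolding p' by (simp add: algebra_simps)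
      qed
      then have "cmod (a' j) \<le> K * ((1 + 2 ^ Suc M) * B)"
        using j by (intro K(2)) auto
      moreover have "cmod (a j) \<le> cmod (a' j)"
      proof -
        have "(2 :: real) ^ Suc j \<le> 2 ^ Suc M" using j by (intro power_increasing) auto
        then have ge: "(2 :: real) ^ Suc M / 2 ^ j \<ge> 2"
          by (simp add: divide_simps)
        have "cmod (1 - 2 ^ Suc M / 2 ^ j) = \<bar>1 - 2 ^ Suc M / 2 ^ j\<bar>"
        proof -
          have "(1 - 2 ^ Suc M / 2 ^ j :: complex) = of_real (1 - 2 ^ Suc M / 2 ^ j)" by simp
          then show ?thesis by (simp only: norm_of_real)
        qed
        then have "cmod (1 - 2 ^ Suc M / 2 ^ j) \<ge> 1" using ge by linarith
        then have "cmod (a j) * 1 \<le> cmod (a j) * cmod (1 - 2 ^ Suc M / 2 ^ j)"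
          by (intro mult_left_mono) auto
        then show ?thesis by (simp add: a'_def norm_mult)
      qed
      ultimately show ?thesis by (simp add: K1_def mult.assoc)
    qed
    have K1K': "K1 * B \<le> K' * B"
      using K1 B by (intro mult_right_mono) (auto simp: K'_def)
    show ?thesis
    proof (cases "j = Suc M")
      case True
      have "a (Suc M) = p 1 - (\<Sum>j\<le>M. a j)" by (simp add: p_def)
      then have "cmod (a (Suc M)) \<le> cmod (p 1) + (\<Sum>j\<le>M. cmod (a j))"
        using norm_triangle_ineq4[of "p 1" "\<Sum>j\<le>M. a j"] norm_sum[of a "{..M}"] by simp
      also have "\<dots> \<le> B + (\<Sum>j\<le>M. K1 * B)"
        using a[of 1] le_M unfolding p_def by (intro add_mono sum_mono) auto
      also have "\<dots> = (1 + real (Suc M) * K1) * B" by (simp add: algebra_simps)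
      also have "\<dots> \<le> K' * B" using K1 B by (intro mult_right_mono) (auto simp: K'_def)
      finally show ?thesis using True by simp
    next
      case False
      with j le_M[of j] K1K' show ?thesis by simp
    qed
  qed
  moreover have "K' \<ge> 0" using K1 by (simp add: K'_def)
  ultimately show ?case by blast
qed

text \<open>Information on a real interval is converted into information on the complex unit disc, as
  Cauchy's inequality will require.\<close>

lemma poly_variation_bound:
  "\<exists>K\<ge>0. \<forall>(Q :: complex poly) B w. degree Q \<le> M \<longrightarrow>
     (\<forall>t. 0 \<le> t \<and> t \<le> 1 \<longrightarrow> cmod (poly Q (of_real t)) \<le> B) \<longrightarrow> cmod w \<le> 1 \<longrightarrow>
     cmod (poly Q w - poly Q 0) \<le> K * B * cmod w"
proof -
  obtain K where K: "K \<ge> 0" "\<And>(a :: nat \<Rightarrow> complex) B j.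
     (\<forall>t. 0 \<le> t \<and> t \<le> 1 \<longrightarrow> cmod (\<Sum>j\<le>M. a j * of_real t ^ j) \<le> B) \<Longrightarrow> j \<le> M \<Longrightarrow> cmod (a j) \<le> K * B"
    using coeff_bound_unit_interval[of M] by blast
  have "cmod (poly Q w - poly Q 0) \<le> (real (Suc M) * K) * B * cmod w"
    if Q: "degree Q \<le> M" "\<And>t. 0 \<le> t \<Longrightarrow> t \<le> 1 \<Longrightarrow> cmod (poly Q (of_real t)) \<le> B" and w: "cmod w \<le> 1"
    for Q :: "complex poly" and B w
  proof -
    have poly: "poly Q z = (\<Sum>j\<le>M. coeff Q j * z ^ j)" for z
      unfolding poly_altdef using Q(1) by (intro sum.mono_neutral_left) (auto simp: coeff_eq_0)
    have B: "B \<ge> 0" using order_trans[OF norm_ge_zero Q(2)[of 0]] by simp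
    have c: "cmod (coeff Q j) \<le> K * B" if "j \<le> M" for j
      using Q(2) that by (intro K(2)) (auto simp: poly)
    have "poly Q w - poly Q 0 = (\<Sum>j\<le>M. coeff Q j * (w ^ j - 0 ^ j))"
      by (simp add: poly sum_subtractf right_diff_distrib)
    also have "cmod \<dots> \<le> (\<Sum>j\<le>M. (K * B) * cmod w)"
    proof (rule sum_norm_le)
      fix j assume "j \<in> {..M}"
      moreover have "cmod (w ^ j - 0 ^ j) \<le> cmod w"
      proof (cases j)
        case (Suc i)
        have "cmod w ^ i \<le> 1" using w by (simp add: power_le_one)
        then have "cmod w * cmod w ^ i \<le> cmod w * 1" by (intro mult_left_mono) auto
        then show ?thesis by (simp add: Suc norm_mult norm_power)
      qed simp
      ultimately show "cmod (coeff Q j * (w ^ j - 0 ^ j)) \<le> (K * B) * cmod w"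
        using c K(1) B by (auto simp: norm_mult intro!: mult_mono)
    qed
    finally show ?thesis by (simp add: mult_ac)
  qed
  moreover have "real (Suc M) * K \<ge> 0" using K by simp
  ultimately show ?thesis by blast
qed

definition exp_remainder :: "nat \<Rightarrow> complex \<Rightarrow> complex" where
  "exp_remainder M z = exp z - (\<Sum>j\<le>M. z ^ j / fact j)"

lemma exp_remainder_bound:
  assumes "cmod z \<le> X"
  shows "cmod (exp_remainder M z) \<le> exp X * X ^ Suc M"
proof -
  have "cmod (exp_remainder M z) \<le> exp (cmod z) * cmod z ^ Suc M / fact M"
    unfolding exp_remainder_def by (rule Taylor_exp_field)
  also have "\<dots> \<le> exp (cmod z) * cmod z ^ Suc M / 1"
    by (intro divide_left_mono) auto
  also have "\<dots> \<le> exp X * X ^ Suc M"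
    using assms order_trans[OF norm_ge_zero assms] by (auto intro!: mult_mono power_mono simp del: power_Suc)
  finally show ?thesis .
qed

lemma exp_remainder_lipschitz:
  assumes "cmod x \<le> X" "cmod y \<le> X"
  shows "cmod (exp_remainder (Suc M) x - exp_remainder (Suc M) y) \<le> exp X * X ^ Suc M * cmod (x - y)"
proof (rule field_differentiable_bound[where S = "cball 0 X" and f' = "exp_remainder M"])
  fix z :: complex
  have "(\<Sum>j\<le>Suc M. of_nat j * z ^ (j - 1) / fact j) = (\<Sum>j\<le>M. z ^ j / fact j)"
  proof -
    have "(\<Sum>j\<le>Suc M. of_nat j * z ^ (j - 1) / fact j) = (\<Sum>j\<le>M. of_nat (Suc j) * z ^ j / fact (Suc j))"
      by (subst sum.atMost_Suc_shift) simp
    also have "\<dots> = (\<Sum>j\<le>M. z ^ j / fact j)"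
      by (rule sum.cong) (simp_all add: fact_Suc del: of_nat_Suc)
    finally show ?thesis .
  qed
  moreover have "((\<lambda>z. exp z - (\<Sum>j\<le>Suc M. z ^ j / fact j)) has_field_derivative
      exp z - (\<Sum>j\<le>Suc M. of_nat j * z ^ (j - 1) / fact j)) (at z within cball 0 X)"
    by (intro DERIV_diff DERIV_sum DERIV_cdivide DERIV_exp[THEN DERIV_subset])
      (auto intro!: derivative_eq_intros)
  ultimately show "(exp_remainder (Suc M) has_field_derivative exp_remainder M z) (at z within cball 0 X)"
    unfolding exp_remainder_def[abs_def] by (simp only:)
qed (use assms exp_remainder_bound in auto)

definition fdiff :: "real \<Rightarrow> (complex \<Rightarrow> complex) \<Rightarrow> complex \<Rightarrow> complex" where
  "fdiff \<tau> G = (\<lambda>z. G (z + of_real \<tau>) - G z)"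

lemma entire_shift: "G holomorphic_on UNIV \<Longrightarrow> (\<lambda>z. G (z + c)) holomorphic_on UNIV"
  by (rule holomorphic_on_compose[of "\<lambda>z. z + c" UNIV G, unfolded o_def])
    (auto intro: holomorphic_intros holomorphic_on_subset)

lemma entire_fdiff_funpow: "G holomorphic_on UNIV \<Longrightarrow> (fdiff \<tau> ^^ N) G holomorphic_on UNIV"
proof (induction N)
  case (Suc N)
  then show ?case by (auto simp: fdiff_def intro!: holomorphic_intros entire_shift)
qed simp

lemma deriv_fdiff_funpow:
  "G holomorphic_on UNIV \<Longrightarrow> deriv ((fdiff \<tau> ^^ N) G) = (fdiff \<tau> ^^ N) (deriv G)"
proof (induction N)
  case (Suc N)
  let ?F = "(fdiff \<tau> ^^ N) G"
  have F: "?F holomorphic_on UNIV" using Suc.prems by (rule entire_fdiff_funpow)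
  have d: "(?F has_field_derivative deriv ?F z) (at z)" for z
    using F by (simp add: holomorphic_derivI)
  have "((\<lambda>z. ?F (z + of_real \<tau>) - ?F z) has_field_derivative deriv ?F (z + of_real \<tau>) - deriv ?F z) (at z)" for z
    using d[of "z + of_real \<tau>"] by (intro DERIV_diff d) (simp add: DERIV_shift)
  then have "deriv (fdiff \<tau> ?F) z = fdiff \<tau> (deriv ?F) z" for z
    unfolding fdiff_def by (rule DERIV_imp_deriv)
  then have "deriv (fdiff \<tau> ?F) = fdiff \<tau> (deriv ?F)" by blast
  then show ?case using Suc by simp
qed simp

text \<open>Differences commute with the derivative, so the mean value inequality can be applied once for
  each order.\<close>

lemma fdiff_funpow_bound:
  assumes "G holomorphic_on UNIV" "\<tau> \<ge> 0"
    and "\<And>s. 0 \<le> s \<Longrightarrow> s \<le> real N * \<tau> \<Longrightarrow> cmod ((deriv ^^ N) G (z + of_real s)) \<le> B"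
  shows "cmod ((fdiff \<tau> ^^ N) G z) \<le> \<tau> ^ N * B"
  using assms
proof (induction N arbitrary: G z)
  case 0
  from "0.prems"(3)[of 0] show ?case by simp
next
  case (Suc N)
  let ?F = "(fdiff \<tau> ^^ N) G"
  let ?S = "closed_segment z (z + of_real \<tau>)"
  have F: "?F holomorphic_on UNIV" using Suc.prems(1) by (rule entire_fdiff_funpow)
  have "cmod (?F (z + of_real \<tau>) - ?F z) \<le> (\<tau> ^ N * B) * cmod (z + of_real \<tau> - z)"
  proof (rule field_differentiable_bound[where S = ?S])
    show "(?F has_field_derivative deriv ?F w) (at w within ?S)" for w
      using F by (simp add: holomorphic_derivI)
    fix w assume "w \<in> ?S"
    then obtain u where u: "0 \<le> u" "u \<le> 1" "w = z + of_real (u * \<tau>)"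
      by (auto simp: in_segment scaleR_conv_of_real algebra_simps)
    have "cmod ((fdiff \<tau> ^^ N) (deriv G) w) \<le> \<tau> ^ N * B"
    proof (rule Suc.IH)
      show "deriv G holomorphic_on UNIV" using Suc.prems(1) by (rule holomorphic_deriv) simp
      fix s assume s: "0 \<le> s" "s \<le> real N * \<tau>"
      have "u * \<tau> \<le> 1 * \<tau>" using u Suc.prems(2) by (intro mult_right_mono)
      then have "cmod ((deriv ^^ Suc N) G (z + of_real (u * \<tau> + s))) \<le> B"
        using s u Suc.prems(2) by (intro Suc.prems(3)) (auto simp: algebra_simps)
      then show "cmod ((deriv ^^ N) (deriv G) (w + of_real s)) \<le> B"
        by (simp add: u(3) add.assoc funpow_swap1 del: funpow.simps) (simp add: funpow_swap1)
    qed fact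
    then show "cmod (deriv ?F w) \<le> \<tau> ^ N * B"
      using Suc.prems(1) by (simp add: deriv_fdiff_funpow)
  qed auto
  then show ?case
    using Suc.prems(2) by (simp add: fdiff_def[of \<tau> ?F] mult_ac)
qed

section \<open>Uniform smoothness of powers near a point of modulus one\<close>

text \<open>The function \<open>W\<close> models the symbol near a point where its modulus is 1, with the drift divided
  out and the value at the point normalized to 1. Only its size on real vectors is assumed;
  that it is a finite exponential sum provides the analytic continuation.\<close>

locale local_expansion = homogeneous_polynomial P E
  for P :: "real ^ 'd \<Rightarrow> complex" and E :: "real ^ 'd ^ 'd" +
  fixes S :: "'k set" and c :: "'k \<Rightarrow> complex" and \<beta> :: "'k \<Rightarrow> real ^ 'd" and \<delta> :: real
    and W :: "real ^ 'd \<Rightarrow> complex"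
  assumes S: "finite S"
    and W: "\<And>\<xi>. W \<xi> = (\<Sum>k\<in>S. c k * exp (\<i> * of_real (\<beta> k \<bullet> \<xi>)))"
    and \<delta>: "\<delta> > 0"
    and W_decay: "\<And>\<xi>. norm \<xi> \<le> \<delta> \<Longrightarrow> cmod (W \<xi>) \<le> exp (- R \<xi> / 2)"
    and W_near_1: "\<And>\<xi>. norm \<xi> \<le> \<delta> \<Longrightarrow> cmod (W \<xi> - 1) \<le> 4 * cmod (P \<xi>)"
    and P_small: "\<And>\<xi>. norm \<xi> \<le> \<delta> \<Longrightarrow> cmod (P \<xi>) \<le> 1"
begin

abbreviation A :: "nat \<Rightarrow> real ^ 'd \<Rightarrow> real ^ 'd" where
  "A n \<eta> \<equiv> matrix_powr (1 / real n) E *v \<eta>"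

text \<open>The entire extension to complex \<open>w\<close> of \<open>W\<close> at the rescaled point \<open>n^(-E) (\<eta> + w u)\<close>.\<close>

definition line :: "nat \<Rightarrow> real ^ 'd \<Rightarrow> real ^ 'd \<Rightarrow> complex \<Rightarrow> complex" where
  "line n \<eta> u w = (\<Sum>k\<in>S. c k * exp (\<i> * of_real (\<beta> k \<bullet> A n \<eta>) + w * (\<i> * of_real (\<beta> k \<bullet> A n u))))"

lemma A_add: "A n (\<eta> + s *\<^sub>R u) = A n \<eta> + s *\<^sub>R A n u"
  by (simp add: matrix_vector_right_distrib matrix_vector_mult_scaleR)

lemma line_of_real: "line n \<eta> u (of_real s) = W (A n (\<eta> + s *\<^sub>R u))"
  by (simp add: line_def W A_add inner_add_right algebra_simps)

lemma line_shift: "line n \<eta> u (of_real s + w) = line n (\<eta> + s *\<^sub>R u) u w"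
  by (simp add: line_def A_add inner_add_right algebra_simps)

lemma line_entire: "line n \<eta> u holomorphic_on UNIV"
  unfolding line_def[abs_def] by (intro holomorphic_intros)

lemma A_small:
  assumes "e > 0"
  obtains n0 where "n0 \<ge> 1" "\<And>n u. n \<ge> n0 \<Longrightarrow> norm (A n u) \<le> e * norm u"
proof -
  obtain K a where K: "K > 0" "a > 0"
    "\<And>t \<xi>. t \<ge> 1 \<Longrightarrow> norm (matrix_powr (1 / t) E *v \<xi>) \<le> K * t powr (- a) * norm \<xi>"
    using contraction_rate by blast
  have "((\<lambda>n. K * real n powr (- a)) \<longlongrightarrow> K * 0) sequentially"
    using K by (intro tendsto_intros tendsto_neg_powr filterlim_real_sequentially) auto
  then have "eventually (\<lambda>n. K * real n powr (- a) < e) sequentially"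
    using assms by (intro order_tendstoD) auto
  then obtain n1 where n1: "\<And>n. n \<ge> n1 \<Longrightarrow> K * real n powr (- a) < e"
    by (auto simp: eventually_sequentially)
  have "norm (A n u) \<le> e * norm u" if "n \<ge> max 1 n1" for n u
  proof -
    have "norm (A n u) \<le> K * real n powr (- a) * norm u" using that by (intro K(3)) auto
    also have "\<dots> \<le> e * norm u" using n1[of n] that by (intro mult_right_mono) auto
    finally show ?thesis .
  qed
  then show ?thesis using that[of "max 1 n1"] by simp
qed

text \<open>This is the key estimate. With the rescaling \<open>n^(-E)\<close>, the quantity \<open>n (W - 1)\<close> has a complex
  Lipschitz constant that grows only polynomially in \<open>\<eta>\<close>, uniformly in \<open>n\<close>. Write \<open>W\<close> as its Taylor
  polynomial of degree \<open>M\<close> plus a remainder. Because \<open>n^(-E)\<close> contracts like \<open>n^(-a)\<close>, the remainder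
  is \<open>O(1/n)\<close> as soon as \<open>a (M + 1) \<ge> 1\<close>, also at complex points. The Taylor part is a polynomial of
  degree at most \<open>M\<close> on the line; at real points \<open>n (W - 1)\<close> is at most \<open>4 n |P|\<close>, which by homogeneity
  is \<open>4 |P|\<close> at the unscaled point, so the polynomial is controlled on a real interval and
  therefore on the complex disc.\<close>

lemma line_variation:
  obtains C m n0 where "C > 0" "n0 \<ge> 1"
    "\<And>n \<eta> u w. n \<ge> n0 \<Longrightarrow> norm u = 1 \<Longrightarrow> norm (A n \<eta>) \<le> 3 * \<delta> / 4 \<Longrightarrow> cmod w \<le> 1 \<Longrightarrow>
       real n * cmod (line n \<eta> u w - line n \<eta> u 0) \<le> C * (1 + norm \<eta>) ^ m * cmod w"
proof -
  obtain K a where K: "K > 0" "a > 0"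
    "\<And>t \<xi>. t \<ge> 1 \<Longrightarrow> norm (matrix_powr (1 / t) E *v \<xi>) \<le> K * t powr (- a) * norm \<xi>"
    using contraction_rate by blast
  obtain Cp mp where Cp: "Cp > 0" "\<And>\<xi>. cmod (P \<xi>) \<le> Cp * (1 + norm \<xi>) ^ mp"
    using polynomial_growth by blast
  obtain M' :: nat where M': "1 \<le> a * real M'"
    using reals_Archimedean3[OF K(2), rule_format, of 1] by (auto simp: mult.commute intro: less_imp_le)
  \<comment> \<open>The degree of the Taylor polynomial: \<open>n * n powr (- a * (M + 1))\<close> must stay
    bounded.\<close>
  define M where "M = Suc M'"
  have aM: "1 \<le> a * real (Suc M)" using M' K(2) by (simp add: M_def algebra_simps)
  define b where "b = (\<Sum>k\<in>S. norm (\<beta> k)) + 1"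
  have b: "norm (\<beta> k) \<le> b" if "k \<in> S" for k
    using member_le_sum[of k S "\<lambda>k. norm (\<beta> k)"] S that by (simp add: b_def)
  have b1: "b \<ge> 1" by (simp add: b_def sum_nonneg)
  define cs where "cs = (\<Sum>k\<in>S. cmod (c k))"
  have cs: "cs \<ge> 0" by (simp add: cs_def sum_nonneg)
  \<comment> \<open>\<open>X0\<close> bounds the exponents of all summands of \<open>W\<close>; their actual size
    \<open>X\<close>, which decays in \<open>n\<close>, enters through the order of the remainder.\<close>
  define X0 where "X0 = b * (3 * \<delta> / 4 + 1)"
  define C1 where "C1 = cs * exp X0 * (b * K) ^ Suc M"
  have C1: "C1 \<ge> 0" using cs b1 K by (simp add: C1_def)
  \<comment> \<open>A common exponent for the remainder and for the growth of \<open>P\<close>.\<close>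
  define m where "m = Suc M + mp"
  define Bd where "Bd = 4 * Cp * 2 ^ mp + C1"
  have Bd: "Bd \<ge> 0" using Cp C1 by (simp add: Bd_def)
  obtain K0 where K0: "K0 \<ge> 0" "\<And>(Q :: complex poly) B w. degree Q \<le> M \<Longrightarrow>
     (\<And>t. 0 \<le> t \<Longrightarrow> t \<le> 1 \<Longrightarrow> cmod (poly Q (of_real t)) \<le> B) \<Longrightarrow> cmod w \<le> 1 \<Longrightarrow>
     cmod (poly Q w - poly Q 0) \<le> K0 * B * cmod w"
    using poly_variation_bound[of M] by blast
  obtain n0 where n0: "n0 \<ge> 1" "\<And>n u. n \<ge> n0 \<Longrightarrow> norm (A n u) \<le> min 1 (\<delta> / 4) * norm u"
    using A_small[of "min 1 (\<delta> / 4)"] \<delta> by auto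
  have main: "real n * cmod (line n \<eta> u w - line n \<eta> u 0) \<le> (C1 + K0 * Bd) * (1 + norm \<eta>) ^ m * cmod w"
    if n: "n \<ge> n0" and u: "norm u = 1" and \<eta>: "norm (A n \<eta>) \<le> 3 * \<delta> / 4" and w: "cmod w \<le> 1" for n \<eta> u w
  proof -
    have n1: "real n \<ge> 1" using n n0 by simp
    have Au: "norm (A n u) \<le> 1" "norm (A n u) \<le> \<delta> / 4" using n0(2)[OF n, of u] u by auto
    define x where "x = (\<lambda>k. \<i> * complex_of_real (\<beta> k \<bullet> A n \<eta>))"
    define y where "y = (\<lambda>k. \<i> * complex_of_real (\<beta> k \<bullet> A n u))"
    define X where "X = b * (norm (A n \<eta>) + norm (A n u))"
    define H where "H = 1 + norm \<eta>"
    have H1: "H \<ge> 1" by (simp add: H_def)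
    have X: "0 \<le> X" "X \<le> X0" using b1 \<eta> Au by (auto simp: X_def X0_def intro!: mult_left_mono)
    have X2: "X \<le> b * K * real n powr (- a) * H"
    proof -
      have "norm (A n \<eta>) + norm (A n u) \<le> K * real n powr (- a) * norm \<eta> + K * real n powr (- a) * norm u"
        using n1 by (intro add_mono K(3)) auto
      then have "norm (A n \<eta>) + norm (A n u) \<le> K * real n powr (- a) * H"
        using u by (simp add: H_def algebra_simps)
      then have "b * (norm (A n \<eta>) + norm (A n u)) \<le> b * (K * real n powr (- a) * H)"
        using b1 by (intro mult_left_mono) auto
      then show ?thesis by (simp add: X_def mult.assoc)
    qed
    have nX: "real n * X ^ Suc M \<le> (b * K) ^ Suc M * H ^ Suc M"
    proof -
      have "X ^ Suc M \<le> (b * K * real n powr (- a) * H) ^ Suc M"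
        using X X2 by (intro power_mono)
      also have "\<dots> = (b * K) ^ Suc M * H ^ Suc M * (real n powr (- a)) ^ Suc M"
        by (simp only: power_mult_distrib mult_ac)
      also have "(real n powr (- a)) ^ Suc M = real n powr (- (a * real (Suc M)))"
        using n1 by (simp add: powr_realpow[symmetric] powr_powr del: power_Suc)
      also have "\<dots> \<le> real n powr (- 1)"
        using n1 aM by (intro powr_mono) auto
      also have "\<dots> = 1 / real n" using n1 by (simp add: powr_minus_divide)
      finally have "X ^ Suc M \<le> (b * K) ^ Suc M * H ^ Suc M * (1 / real n)"
        using b1 K H1 by (auto simp: mult_left_mono)
      then show ?thesis using n1 by (simp add: field_simps del: power_Suc)
    qed
    have xX: "cmod (x k) \<le> b * norm (A n \<eta>)" and yX: "cmod (y k) \<le> b * norm (A n u)" if "k \<in> S" for k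
      using order_trans[OF Cauchy_Schwarz_ineq2 mult_right_mono[OF b[OF that] norm_ge_zero]]
      by (simp_all add: x_def y_def norm_mult)
    have y_le_X: "cmod (y k) \<le> X" if "k \<in> S" for k
      using yX[OF that] b1 by (auto simp: X_def distrib_left intro: add_increasing)
    have xyX: "cmod (x k + z * y k) \<le> X" if "k \<in> S" "cmod z \<le> 1" for k z
    proof -
      have "cmod (z * y k) \<le> 1 * cmod (y k)"
        unfolding norm_mult using that by (intro mult_right_mono) auto
      then show ?thesis
        using norm_triangle_ineq[of "x k" "z * y k"] xX[OF that(1)] yX[OF that(1)]
        by (simp add: X_def distrib_left)
    qed
    define Rem where "Rem = (\<lambda>z. \<Sum>k\<in>S. c k * exp_remainder M (x k + z * y k))"
    define Q where "Q = (\<Sum>k\<in>S. smult (c k) (\<Sum>j\<le>M. smult (1 / fact j) ([:x k, y k:] ^ j)))"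
    have split: "line n \<eta> u z = poly Q z + Rem z" for z
      by (simp add: line_def Q_def Rem_def exp_remainder_def x_def y_def
          poly_sum sum.distrib[symmetric] right_diff_distrib)
    have degQ: "degree Q \<le> M"
      unfolding Q_def
    proof (intro degree_sum_le S order_trans[OF degree_smult_le] finite_atMost)
      fix k j assume "j \<in> {..M}"
      have "degree ([:x k, y k:] ^ j) \<le> degree [:x k, y k:] * j" by (rule degree_power_le)
      also have "\<dots> \<le> 1 * j" by (intro mult_right_mono) auto
      finally show "degree ([:x k, y k:] ^ j) \<le> M" using \<open>j \<in> _\<close> by simp
    qed
    have C1H: "real n * (cs * (exp X * X ^ Suc M)) \<le> C1 * H ^ Suc M"
    proof -
      have "real n * (cs * (exp X * X ^ Suc M)) = cs * exp X * (real n * X ^ Suc M)" by (simp add: mult_ac)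
      also have "\<dots> \<le> cs * exp X0 * ((b * K) ^ Suc M * H ^ Suc M)"
      proof (rule mult_mono[OF _ nX])
        show "cs * exp X \<le> cs * exp X0" using X cs by (intro mult_left_mono) auto
        show "0 \<le> cs * exp X0" using cs by simp
        show "0 \<le> real n * X ^ Suc M" using X by (intro mult_nonneg_nonneg zero_le_power) auto
      qed
      finally show ?thesis by (simp add: C1_def mult_ac)
    qed
    have rem: "real n * cmod (Rem z) \<le> C1 * H ^ Suc M" if "cmod z \<le> 1" for z
    proof -
      have "cmod (Rem z) \<le> (\<Sum>k\<in>S. cmod (c k) * (exp X * X ^ Suc M))"
        unfolding Rem_def using that xyX
        by (intro sum_norm_le) (auto simp: norm_mult simp del: power_Suc intro!: mult_left_mono exp_remainder_bound)
      also have "\<dots> = cs * (exp X * X ^ Suc M)" by (simp add: cs_def sum_distrib_right)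
      finally have "real n * cmod (Rem z) \<le> real n * (cs * (exp X * X ^ Suc M))"
        by (intro mult_left_mono) auto
      then show ?thesis using C1H by linarith
    qed
    have rem_var: "real n * cmod (Rem w - Rem 0) \<le> C1 * H ^ Suc M * cmod w"
    proof -
      have "cmod (Rem w - Rem 0) \<le> (\<Sum>k\<in>S. cmod (c k) * ((exp X * X ^ Suc M) * cmod w))"
        unfolding Rem_def sum_subtractf[symmetric] right_diff_distrib[symmetric]
      proof (intro sum_norm_le)
        fix k assume k: "k \<in> S"
        have "cmod (exp_remainder M (x k + w * y k) - exp_remainder M (x k + 0 * y k))
            \<le> exp X * X ^ M * cmod ((x k + w * y k) - (x k + 0 * y k))"
          unfolding M_def using xyX[OF k w] xyX[OF k, of 0] by (intro exp_remainder_lipschitz) auto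
        also have "\<dots> \<le> exp X * X ^ M * (X * cmod w)"
        proof (rule mult_left_mono)
          show "cmod ((x k + w * y k) - (x k + 0 * y k)) \<le> X * cmod w"
            using mult_left_mono[OF y_le_X[OF k] norm_ge_zero[of w]] by (simp add: norm_mult mult.commute)
        qed (use X in auto)
        finally show "cmod (c k * (exp_remainder M (x k + w * y k) - exp_remainder M (x k + 0 * y k)))
            \<le> cmod (c k) * ((exp X * X ^ Suc M) * cmod w)"
          unfolding norm_mult by (intro mult_left_mono) (simp_all add: mult_ac)
      qed
      also have "\<dots> = cs * (exp X * X ^ Suc M) * cmod w"
        by (simp add: cs_def sum_distrib_right mult.assoc)
      finally have "real n * cmod (Rem w - Rem 0) \<le> real n * (cs * (exp X * X ^ Suc M) * cmod w)"
        by (intro mult_left_mono) auto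
      also have "\<dots> = real n * (cs * (exp X * X ^ Suc M)) * cmod w" by simp
      also have "\<dots> \<le> C1 * H ^ Suc M * cmod w" using C1H by (intro mult_right_mono) auto
      finally show ?thesis .
    qed
    have Hm: "H ^ Suc M \<le> H ^ m" "H ^ mp \<le> H ^ m"
      using H1 by (auto simp: m_def simp del: power_Suc intro!: power_increasing)
    have Qt: "cmod (poly (Q - 1) (of_real t)) \<le> Bd * H ^ m / real n" if t: "0 \<le> t" "t \<le> 1" for t
    proof -
      let ?v = "\<eta> + t *\<^sub>R u"
      have "norm (A n ?v) \<le> norm (A n \<eta>) + t * norm (A n u)"
        unfolding A_add using norm_triangle_ineq[of "A n \<eta>" "t *\<^sub>R A n u"] t by simp
      also have "\<dots> \<le> 3 * \<delta> / 4 + 1 * (\<delta> / 4)"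
        using \<eta> t Au by (intro add_mono mult_mono) auto
      finally have v\<delta>: "norm (A n ?v) \<le> \<delta>" by simp
      have nP: "real n * cmod (P (A n ?v)) = cmod (P ?v)"
        using P_scale[OF E, of "1 / real n" ?v] n1 by (simp add: norm_mult norm_divide)
      have "norm ?v \<le> norm \<eta> + t * norm u"
        using norm_triangle_ineq[of \<eta> "t *\<^sub>R u"] t by simp
      also have "t * norm u \<le> 1" using t u by simp
      finally have "norm ?v \<le> norm \<eta> + 1" by simp
      then have "1 + norm ?v \<le> 1 + (norm \<eta> + 1)" by (rule add_left_mono)
      also have "\<dots> \<le> 2 * H" by (simp add: H_def)
      finally have "1 + norm ?v \<le> 2 * H" .
      then have "(1 + norm ?v) ^ mp \<le> (2 * H) ^ mp" by (intro power_mono) auto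
      then have "cmod (P ?v) \<le> Cp * (2 * H) ^ mp"
        using Cp(1) by (intro order_trans[OF Cp(2)] mult_left_mono) auto
      then have Pv: "4 * cmod (P ?v) \<le> 4 * Cp * 2 ^ mp * H ^ m"
      proof -
        have "4 * (Cp * 2 ^ mp * H ^ mp) \<le> 4 * (Cp * 2 ^ mp * H ^ m)"
          using Hm(2) Cp(1) by (intro mult_left_mono) auto
        moreover have "cmod (P ?v) \<le> Cp * 2 ^ mp * H ^ mp"
          using \<open>cmod (P ?v) \<le> Cp * (2 * H) ^ mp\<close> by (simp add: power_mult_distrib mult.assoc)
        ultimately show ?thesis by (simp add: mult.assoc)
      qed
      have "poly (Q - 1) (of_real t) = (W (A n ?v) - 1) - Rem (of_real t)"
        using split[of "of_real t"] by (simp add: line_of_real)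
      then have "cmod (poly (Q - 1) (of_real t)) \<le> cmod (W (A n ?v) - 1) + cmod (Rem (of_real t))"
        by (simp only: norm_triangle_ineq4)
      then have "real n * cmod (poly (Q - 1) (of_real t)) \<le> real n * cmod (W (A n ?v) - 1) + real n * cmod (Rem (of_real t))"
        using n1 by (simp add: distrib_left[symmetric] mult_left_mono)
      also have "real n * cmod (W (A n ?v) - 1) \<le> real n * (4 * cmod (P (A n ?v)))"
        using W_near_1[OF v\<delta>] by (intro mult_left_mono) auto
      also have "\<dots> = 4 * cmod (P ?v)" using nP by simp
      also have "real n * cmod (Rem (of_real t)) \<le> C1 * H ^ Suc M"
        using t by (intro rem) auto
      also have "\<dots> \<le> C1 * H ^ m" using Hm C1 by (intro mult_left_mono)
      finally have "real n * cmod (poly (Q - 1) (of_real t)) \<le> Bd * H ^ m"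
        using Pv by (simp add: Bd_def distrib_right)
      then show ?thesis using n1 by (simp add: field_simps)
    qed
    have "cmod (poly (Q - 1) w - poly (Q - 1) 0) \<le> K0 * (Bd * H ^ m / real n) * cmod w"
      using degQ w Qt by (intro K0(2)) (auto intro!: degree_diff_le)
    then have "real n * cmod (poly Q w - poly Q 0) \<le> real n * (K0 * (Bd * H ^ m / real n) * cmod w)"
      by (intro mult_left_mono) auto
    then have poly_var: "real n * cmod (poly Q w - poly Q 0) \<le> K0 * Bd * H ^ m * cmod w"
      using n1 by (simp add: mult_ac)
    have "line n \<eta> u w - line n \<eta> u 0 = (poly Q w - poly Q 0) + (Rem w - Rem 0)"
      by (simp add: split)
    then have "cmod (line n \<eta> u w - line n \<eta> u 0) \<le> cmod (poly Q w - poly Q 0) + cmod (Rem w - Rem 0)"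
      by (simp only: norm_triangle_ineq)
    then have "real n * cmod (line n \<eta> u w - line n \<eta> u 0)
        \<le> real n * cmod (poly Q w - poly Q 0) + real n * cmod (Rem w - Rem 0)"
      using n1 by (simp add: distrib_left[symmetric] mult_left_mono)
    also have "\<dots> \<le> K0 * Bd * H ^ m * cmod w + C1 * H ^ m * cmod w"
    proof (intro add_mono poly_var)
      have "C1 * H ^ Suc M * cmod w \<le> C1 * H ^ m * cmod w"
        using Hm C1 by (intro mult_right_mono mult_left_mono) auto
      with rem_var show "real n * cmod (Rem w - Rem 0) \<le> C1 * H ^ m * cmod w" by linarith
    qed
    finally show ?thesis by (simp add: H_def algebra_simps)
  qed
  show ?thesis
  proof (rule that[of "C1 + K0 * Bd + 1" n0 m])
    show "C1 + K0 * Bd + 1 > 0" using C1 K0 Bd by (simp add: add_nonneg_pos)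
    show "n0 \<ge> 1" by fact
    fix n :: nat and \<eta> u :: "real ^ 'd" and w :: complex
    assume a: "n \<ge> n0" "norm u = 1" "norm (A n \<eta>) \<le> 3 * \<delta> / 4" "cmod w \<le> 1"
    have "(C1 + K0 * Bd) * (1 + norm \<eta>) ^ m * cmod w \<le> (C1 + K0 * Bd + 1) * (1 + norm \<eta>) ^ m * cmod w"
      by (intro mult_right_mono) auto
    with main[OF a] show "real n * cmod (line n \<eta> u w - line n \<eta> u 0) \<le> (C1 + K0 * Bd + 1) * (1 + norm \<eta>) ^ m * cmod w"
      by linarith
  qed
qed

text \<open>By the previous lemma \<open>W\<close> changes by at most \<open>1/n\<close> on a circle whose radius is an inverse power of
  \<open>1 + norm \<eta>\<close>. Hence on it the \<open>n\<close>-th power of the modulus is at most a constant times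
  \<open>exp (- R \<eta> / 2)\<close>, and Cauchy's inequality costs a power of \<open>1 + norm \<eta>\<close> which this exponential
  absorbs.\<close>

lemma line_power_derivative_bound:
  obtains C n0 where "C > 0" "n0 \<ge> 1"
    "\<And>n \<eta> u s. n \<ge> n0 \<Longrightarrow> norm u = 1 \<Longrightarrow> norm (A n (\<eta> + s *\<^sub>R u)) \<le> 3 * \<delta> / 4 \<Longrightarrow>
       cmod ((deriv ^^ N) (\<lambda>w. line n \<eta> u w ^ n) (of_real s)) \<le> C / (1 + norm (\<eta> + s *\<^sub>R u)) ^ p"
proof -
  obtain C m n0 where C: "C > 0" "n0 \<ge> 1"
    "\<And>n \<eta> u w. n \<ge> n0 \<Longrightarrow> norm u = 1 \<Longrightarrow> norm (A n \<eta>) \<le> 3 * \<delta> / 4 \<Longrightarrow> cmod w \<le> 1 \<Longrightarrow>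
       real n * cmod (line n \<eta> u w - line n \<eta> u 0) \<le> C * (1 + norm \<eta>) ^ m * cmod w"
    by (rule line_variation) blast
  obtain D where D: "D > 0" "\<And>\<xi>. (1 + norm \<xi>) ^ (m * N + p) * exp (- R \<xi> / 2) \<le> D"
    by (rule exp_decay[where L = "m * N + p"]) blast
  define C' where "C' = C + 1"
  have C': "C' \<ge> 1" "C \<le> C'" using C by (auto simp: C'_def)
  have main: "cmod ((deriv ^^ N) (\<lambda>w. line n \<eta> u w ^ n) (of_real s))
      \<le> (fact N * C' ^ N * exp (exp 1) * D) / (1 + norm (\<eta> + s *\<^sub>R u)) ^ p"
    if n: "n \<ge> n0" and u: "norm u = 1" and v: "norm (A n (\<eta> + s *\<^sub>R u)) \<le> 3 * \<delta> / 4" for n \<eta> u s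
  proof -
    let ?v = "\<eta> + s *\<^sub>R u"
    define H where "H = 1 + norm ?v"
    have H: "H \<ge> 1" by (simp add: H_def)
    have n1: "real n \<ge> 1" using n C by simp
    \<comment> \<open>The radius for which the variation of \<open>n W\<close> is at most 1.\<close>
    define r where "r = 1 / (C' * H ^ m)"
    have CH: "1 \<le> C' * H ^ m" using mult_mono[of 1 C' 1 "H ^ m"] C' H by simp
    then have r: "0 < r" "r \<le> 1" by (auto simp: r_def divide_simps)
    define \<rho> where "\<rho> = R (A n ?v)"
    have v\<delta>: "norm (A n ?v) \<le> \<delta>" using v \<delta> by simp
    have \<rho>: "0 \<le> \<rho>" "\<rho> \<le> 1"
      using R_nonneg P_small[OF v\<delta>] complex_Re_le_cmod[of "P (A n ?v)"] by (auto simp: \<rho>_def)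
    have n\<rho>: "real n * \<rho> = R ?v"
      using R_scale[OF E, of "1 / real n" ?v] n1 by (simp add: \<rho>_def)
    have circle: "cmod (line n \<eta> u (of_real s + w) ^ n) \<le> exp (exp 1) * exp (- R ?v / 2)" if w: "cmod w = r" for w
    proof -
      have "real n * cmod (line n ?v u w - line n ?v u 0) \<le> C * H ^ m * r"
        using C(3)[OF n u v, of w] w r by (simp add: H_def)
      also have "\<dots> \<le> C' * H ^ m * r" using C' H r by (intro mult_right_mono) auto
      also have "\<dots> = 1" using C' H by (simp add: r_def)
      finally have "cmod (line n ?v u w - line n ?v u 0) \<le> 1 / real n"
        using n1 by (simp add: field_simps)
      moreover have "cmod (line n ?v u 0) \<le> exp (- \<rho> / 2)"
        using W_decay[OF v\<delta>] line_of_real[of n ?v u 0] by (simp add: \<rho>_def)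
      ultimately have "cmod (line n ?v u w) \<le> exp (- \<rho> / 2) + 1 / real n"
        using norm_triangle_sub[of "line n ?v u w" "line n ?v u 0"] by linarith
      also have "\<dots> = exp (- \<rho> / 2) * (1 + exp (\<rho> / 2) / real n)"
        by (simp add: distrib_left exp_add[symmetric] mult_exp_exp)
      finally have "cmod (line n ?v u w) ^ n \<le> (exp (- \<rho> / 2) * (1 + exp (\<rho> / 2) / real n)) ^ n"
        by (intro power_mono) auto
      also have "\<dots> = exp (- \<rho> / 2) ^ n * (1 + exp (\<rho> / 2) / real n) ^ n"
        by (rule power_mult_distrib)
      also have "\<dots> \<le> exp (- \<rho> / 2) ^ n * exp (exp (\<rho> / 2))"
      proof (intro mult_left_mono exp_ge_one_plus_x_over_n_power_n)
        show "- real n \<le> exp (\<rho> / 2)" by (rule order_trans[of _ 0]) auto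
      qed (use n1 in auto)
      also have "exp (- \<rho> / 2) ^ n = exp (- R ?v / 2)"
        unfolding n\<rho>[symmetric] by (simp add: exp_of_nat_mult[symmetric])
      also have "exp (- R ?v / 2) * exp (exp (\<rho> / 2)) \<le> exp (- R ?v / 2) * exp (exp 1)"
        using \<rho> by (intro mult_left_mono) auto
      finally show ?thesis by (simp add: line_shift norm_power mult.commute)
    qed
    have "cmod ((deriv ^^ N) (\<lambda>w. line n \<eta> u w ^ n) (of_real s))
        \<le> fact N * (exp (exp 1) * exp (- R ?v / 2)) / r ^ N"
    proof (rule Cauchy_inequality)
      have hol: "(\<lambda>w. line n \<eta> u w ^ n) holomorphic_on T" for T
        using holomorphic_on_subset[OF line_entire] by (intro holomorphic_intros) auto
      show "(\<lambda>w. line n \<eta> u w ^ n) holomorphic_on ball (of_real s) r" by (rule hol)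
      show "continuous_on (cball (of_real s) r) (\<lambda>w. line n \<eta> u w ^ n)"
        by (intro holomorphic_on_imp_continuous_on hol)
      fix x assume "cmod (complex_of_real s - x) = r"
      then show "cmod (line n \<eta> u x ^ n) \<le> exp (exp 1) * exp (- R ?v / 2)"
        using circle[of "x - of_real s"] by (simp add: norm_minus_commute)
    qed (use r in auto)
    also have "\<dots> = fact N * C' ^ N * exp (exp 1) * (H ^ (m * N) * exp (- R ?v / 2))"
    proof -
      have "r ^ N = 1 / (C' ^ N * H ^ (m * N))"
        by (simp add: r_def power_one_over power_mult_distrib power_mult)
      then show ?thesis by (simp add: mult_ac)
    qed
    also have "\<dots> \<le> fact N * C' ^ N * exp (exp 1) * (D / H ^ p)"
    proof (intro mult_left_mono)
      have "H ^ (m * N) * exp (- R ?v / 2) * H ^ p \<le> D"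
        using D(2)[of ?v] by (simp add: H_def power_add mult_ac)
      then show "H ^ (m * N) * exp (- R ?v / 2) \<le> D / H ^ p"
        using H by (simp add: pos_le_divide_eq)
    qed (use C' in auto)
    finally show ?thesis by (simp add: H_def)
  qed
  show ?thesis
    by (rule that[OF _ C(2) main]) (use C' D in auto)
qed

lemma line_power_fdiff_bound:
  obtains C n0 where "C > 0" "n0 \<ge> 1"
    "\<And>n \<eta> u \<tau>. n \<ge> n0 \<Longrightarrow> norm u = 1 \<Longrightarrow> norm (A n \<eta>) \<le> \<delta> / 2 \<Longrightarrow> 0 \<le> \<tau> \<Longrightarrow> \<tau> \<le> pi \<Longrightarrow>
       cmod ((fdiff \<tau> ^^ N) (\<lambda>w. line n \<eta> u w ^ n) 0) \<le> C * \<tau> ^ N / (1 + norm \<eta>) ^ p"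
proof -
  obtain C n1 where C: "C > 0" "n1 \<ge> 1"
    "\<And>n \<eta> u s. n \<ge> n1 \<Longrightarrow> norm u = 1 \<Longrightarrow> norm (A n (\<eta> + s *\<^sub>R u)) \<le> 3 * \<delta> / 4 \<Longrightarrow>
       cmod ((deriv ^^ N) (\<lambda>w. line n \<eta> u w ^ n) (of_real s)) \<le> C / (1 + norm (\<eta> + s *\<^sub>R u)) ^ p"
    by (rule line_power_derivative_bound[where N = N and p = p]) blast
  \<comment> \<open>Differences of order \<open>N\<close> with step at most \<open>pi\<close> reach points up to
    distance \<open>N * pi\<close>.\<close>
  define T where "T = real N * pi + 1"
  have T: "T \<ge> 1" by (simp add: T_def)
  obtain n2 where n2: "n2 \<ge> 1" "\<And>n u. n \<ge> n2 \<Longrightarrow> norm (A n u) \<le> \<delta> / (4 * T) * norm u"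
    using A_small[of "\<delta> / (4 * T)"] \<delta> T by auto
  have main: "cmod ((fdiff \<tau> ^^ N) (\<lambda>w. line n \<eta> u w ^ n) 0) \<le> (C * (1 + T) ^ p) * \<tau> ^ N / (1 + norm \<eta>) ^ p"
    if n: "n \<ge> max n1 n2" and u: "norm u = 1" and \<eta>: "norm (A n \<eta>) \<le> \<delta> / 2" and \<tau>: "0 \<le> \<tau>" "\<tau> \<le> pi" for n \<eta> u \<tau>
  proof -
    have "cmod ((fdiff \<tau> ^^ N) (\<lambda>w. line n \<eta> u w ^ n) 0) \<le> \<tau> ^ N * (C * (1 + T) ^ p / (1 + norm \<eta>) ^ p)"
    proof (rule fdiff_funpow_bound)
      show "(\<lambda>w. line n \<eta> u w ^ n) holomorphic_on UNIV"
        using line_entire by (intro holomorphic_intros)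
      fix s assume s: "0 \<le> s" "s \<le> real N * \<tau>"
      have "real N * \<tau> \<le> real N * pi" using \<tau> by (intro mult_left_mono) auto
      then have sT: "s \<le> T" using s by (simp add: T_def)
      let ?v = "\<eta> + s *\<^sub>R u"
      have "norm (A n ?v) \<le> norm (A n \<eta>) + s * norm (A n u)"
        unfolding A_add using norm_triangle_ineq[of "A n \<eta>" "s *\<^sub>R A n u"] s by simp
      also have "\<dots> \<le> \<delta> / 2 + T * (\<delta> / (4 * T))"
        using \<eta> s sT n2(2)[of n u] n u T by (intro add_mono mult_mono) auto
      also have "\<dots> = 3 * \<delta> / 4" using T by (simp add: field_simps)
      finally have "norm (A n ?v) \<le> 3 * \<delta> / 4" .
      then have "cmod ((deriv ^^ N) (\<lambda>w. line n \<eta> u w ^ n) (of_real s)) \<le> C / (1 + norm ?v) ^ p"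
        using n u by (intro C(3)) auto
      also have "\<dots> \<le> C * (1 + T) ^ p / (1 + norm \<eta>) ^ p"
      proof -
        have "norm \<eta> \<le> norm ?v + s"
          using norm_triangle_ineq4[of ?v "s *\<^sub>R u"] s u by simp
        also have "\<dots> \<le> norm ?v + T * (1 + norm ?v)"
          using sT T by (simp add: distrib_left add_increasing2)
        finally have "1 + norm \<eta> \<le> (1 + T) * (1 + norm ?v)" by (simp add: algebra_simps)
        then have "(1 + norm \<eta>) ^ p \<le> ((1 + T) * (1 + norm ?v)) ^ p" by (intro power_mono) auto
        then have "(1 + norm \<eta>) ^ p \<le> (1 + T) ^ p * (1 + norm ?v) ^ p"
          by (simp add: power_mult_distrib)
        moreover have "0 < (1 + norm \<eta>) ^ p" "0 < (1 + norm ?v) ^ p"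
          by (intro zero_less_power add_pos_nonneg; simp)+
        ultimately show ?thesis using C(1)
          by (simp add: divide_simps mult_left_mono mult_ac)
      qed
      finally show "cmod ((deriv ^^ N) (\<lambda>w. line n \<eta> u w ^ n) (0 + of_real s)) \<le> C * (1 + T) ^ p / (1 + norm \<eta>) ^ p"
        by simp
    qed fact
    then show ?thesis by (simp add: mult_ac)
  qed
  show ?thesis
    by (rule that[of "C * (1 + T) ^ p" "max n1 n2"]) (use C T n2 main in auto)
qed

end

section \<open>Fourier coefficients and twisted differences\<close>

abbreviation character :: "int ^ 'd \<Rightarrow> real ^ 'd \<Rightarrow> complex" where
  "character x \<xi> \<equiv> exp (\<i> * complex_of_real (real_vec x \<bullet> \<xi>))"

lemma real_vec_simps [simp]:
  "real_vec (x + y) = real_vec x + real_vec y" "real_vec (x - y) = real_vec x - real_vec y" "real_vec 0 = 0"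
  by (simp_all add: real_vec_def vec_eq_iff)

lemma fourier_finite:
  assumes "finite S" "\<And>x. x \<notin> S \<Longrightarrow> a x = 0"
  shows "fourier a \<xi> = (\<Sum>x\<in>S. a x * character x \<xi>)"
proof -
  have "fourier a \<xi> = (\<Sum>\<^sub>\<infinity>x\<in>S. a x * character x \<xi>)"
    unfolding fourier_def by (rule infsum_cong_neutral) (use assms in auto)
  with assms(1) show ?thesis by simp
qed

lemma fourier_continuous:
  assumes "finite S" "\<And>x. x \<notin> S \<Longrightarrow> a x = 0"
  shows "continuous_on T (fourier a)"
proof -
  have "continuous_on T (\<lambda>\<xi>. \<Sum>x\<in>S. a x * character x \<xi>)"
    by (intro continuous_intros)
  then show ?thesis using fourier_finite[OF assms] by simp
qed

lemma fourier_measurable: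
  assumes "finite S" "\<And>x. x \<notin> S \<Longrightarrow> a x = 0"
  shows "fourier a \<in> borel_measurable borel"
  by (intro borel_measurable_continuous_onI fourier_continuous[OF assms])

lemma norm_character [simp]: "cmod (character x \<xi>) = 1"
  by (simp add: norm_exp_i_times)

lemma character_add: "character (x + y) \<xi> = character x \<xi> * character y \<xi>"
  by (simp add: inner_add_left distrib_left exp_add)

lemma convolution_finite:
  assumes "finite S" "\<And>x. x \<notin> S \<Longrightarrow> b x = 0"
  shows "convolution a b x = (\<Sum>y\<in>S. a (x - y) * b y)"
proof -
  have "convolution a b x = (\<Sum>\<^sub>\<infinity>y\<in>S. a (x - y) * b y)"
    unfolding convolution_def by (rule infsum_cong_neutral) (use assms in auto)
  with assms(1) show ?thesis by simp
qed

lemma fourier_convolution: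
  assumes S: "finite S" "\<And>x. x \<notin> S \<Longrightarrow> b x = 0" and T: "finite T" "\<And>x. x \<notin> T \<Longrightarrow> a x = 0"
  shows "fourier (convolution a b) \<xi> = fourier a \<xi> * fourier b \<xi>"
proof -
  let ?U = "(\<lambda>(z, y). z + y) ` (T \<times> S)"
  have U: "finite ?U" using S T by simp
  have zero: "convolution a b x = 0" if "x \<notin> ?U" for x
  proof -
    have "a (x - y) * b y = 0" if "y \<in> S" for y
    proof -
      have "x - y \<notin> T"
      proof
        assume "x - y \<in> T"
        then have "(\<lambda>(z, y). z + y) (x - y, y) \<in> ?U" using \<open>y \<in> S\<close> by blast
        with \<open>x \<notin> ?U\<close> show False by simp
      qed
      with T show ?thesis by simp
    qed
    then have "(\<Sum>y\<in>S. a (x - y) * b y) = 0" by (intro sum.neutral ballI)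
    moreover have "convolution a b x = (\<Sum>y\<in>S. a (x - y) * b y)"
      by (rule convolution_finite[OF S])
    ultimately show ?thesis by (simp only:)
  qed
  have inner: "(\<Sum>x\<in>?U. a (x - y) * character (x - y) \<xi>) = (\<Sum>z\<in>T. a z * character z \<xi>)" if y: "y \<in> S" for y
  proof -
    have "(\<Sum>x\<in>?U. a (x - y) * character (x - y) \<xi>) = (\<Sum>x\<in>(\<lambda>z. z + y) ` T. a (x - y) * character (x - y) \<xi>)"
    proof (rule sum.mono_neutral_right[OF U])
      show "(\<lambda>z. z + y) ` T \<subseteq> ?U" using y by force
      show "\<forall>i\<in>?U - (\<lambda>z. z + y) ` T. a (i - y) * character (i - y) \<xi> = 0"
      proof
        fix i assume i: "i \<in> ?U - (\<lambda>z. z + y) ` T"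
        have "i - y \<notin> T"
        proof
          assume "i - y \<in> T"
          then have "(i - y) + y \<in> (\<lambda>z. z + y) ` T" by (rule imageI)
          with i show False by simp
        qed
        with T(2) show "a (i - y) * character (i - y) \<xi> = 0" by simp
      qed
    qed
    also have "\<dots> = (\<Sum>z\<in>T. a z * character z \<xi>)"
      by (subst sum.reindex) (auto simp: inj_on_def)
    finally show ?thesis .
  qed
  have "fourier (convolution a b) \<xi> = (\<Sum>x\<in>?U. (\<Sum>y\<in>S. a (x - y) * b y) * character x \<xi>)"
    by (simp add: fourier_finite[OF U zero] convolution_finite[OF S])
  also have "\<dots> = (\<Sum>x\<in>?U. \<Sum>y\<in>S. (a (x - y) * character (x - y) \<xi>) * (b y * character y \<xi>))"
  proof -
    have "character x \<xi> = character (x - y) \<xi> * character y \<xi>" for x y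
      using character_add[of "x - y" y \<xi>] by (simp only: diff_add_cancel)
    then show ?thesis
      unfolding sum_distrib_right by (intro sum.cong refl) (metis mult.assoc mult.left_commute)
  qed
  also have "\<dots> = (\<Sum>y\<in>S. (\<Sum>x\<in>?U. a (x - y) * character (x - y) \<xi>) * (b y * character y \<xi>))"
    by (subst sum.swap) (simp only: sum_distrib_right)
  also have "\<dots> = (\<Sum>y\<in>S. (\<Sum>z\<in>T. a z * character z \<xi>) * (b y * character y \<xi>))"
    by (intro sum.cong refl) (simp only: inner)
  also have "\<dots> = fourier a \<xi> * fourier b \<xi>"
  proof -
    have "fourier a \<xi> = (\<Sum>z\<in>T. a z * character z \<xi>)"
      by (rule fourier_finite[OF T])
    moreover have "fourier b \<xi> = (\<Sum>y\<in>S. b y * character y \<xi>)"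
      by (rule fourier_finite[OF S])
    ultimately show ?thesis by (simp only: sum_distrib_left[symmetric])
  qed
  finally show ?thesis .
qed

lemma convolution_power_1: "convolution_power \<phi> (Suc 0) = \<phi>"
  by (simp add: convolution_power_def)

lemma convolution_power_Suc:
  "n \<ge> 1 \<Longrightarrow> convolution_power \<phi> (Suc n) = convolution (convolution_power \<phi> n) \<phi>"
  by (cases n) (simp_all add: convolution_power_def)

lemma convolution_power_support:
  assumes fin: "finite S" and S: "\<And>x. x \<notin> S \<Longrightarrow> \<phi> x = 0" and K: "\<And>x. x \<in> S \<Longrightarrow> norm (real_vec x) \<le> K"
    and n: "n \<ge> 1"
  shows "finite {x. convolution_power \<phi> n x \<noteq> 0} \<and>
    (\<forall>x. convolution_power \<phi> n x \<noteq> 0 \<longrightarrow> norm (real_vec x) \<le> real n * K)"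
  using n
proof (induction n rule: dec_induct)
  case base
  have "{x. \<phi> x \<noteq> 0} \<subseteq> S" using S by auto
  then show ?case
    using K fin by (auto simp: convolution_power_1 intro: finite_subset)
next
  case (step n)
  let ?T = "{x. convolution_power \<phi> n x \<noteq> 0}"
  have *: "\<exists>y\<in>S. \<exists>z\<in>?T. x = z + y" if "convolution_power \<phi> (Suc n) x \<noteq> 0" for x
  proof -
    have "(\<Sum>y\<in>S. convolution_power \<phi> n (x - y) * \<phi> y) \<noteq> 0"
      using that step.hyps by (simp add: convolution_power_Suc convolution_finite[OF fin S])
    then obtain y where "y \<in> S" "convolution_power \<phi> n (x - y) * \<phi> y \<noteq> 0"
      by (meson sum.not_neutral_contains_not_neutral)
    then show ?thesis by (intro bexI[of _ y] bexI[of _ "x - y"]) auto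
  qed
  have "{x. convolution_power \<phi> (Suc n) x \<noteq> 0} \<subseteq> (\<lambda>(z, y). z + y) ` (?T \<times> S)"
    using * by force
  then have "finite {x. convolution_power \<phi> (Suc n) x \<noteq> 0}"
    by (rule finite_subset) (use step.IH fin in auto)
  moreover have "norm (real_vec x) \<le> real (Suc n) * K" if nz: "convolution_power \<phi> (Suc n) x \<noteq> 0" for x
  proof -
    obtain y z where yz: "y \<in> S" "z \<in> ?T" "x = z + y" using *[OF nz] by blast
    then have "norm (real_vec z) \<le> real n * K" "norm (real_vec y) \<le> K"
      using step.IH K by auto
    then show ?thesis
      using norm_triangle_ineq[of "real_vec z" "real_vec y"] yz by (simp add: algebra_simps)
  qed
  ultimately show ?case by blast
qed

lemma fourier_convolution_power:
  assumes fin: "finite S" and S: "\<And>x. x \<notin> S \<Longrightarrow> \<phi> x = 0" and n: "n \<ge> 1"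
  shows "fourier (convolution_power \<phi> n) \<xi> = fourier \<phi> \<xi> ^ n"
  using n
proof (induction n rule: dec_induct)
  case base
  then show ?case by (simp add: convolution_power_1)
next
  case (step n)
  have "finite {x. convolution_power \<phi> n x \<noteq> 0}"
    using convolution_power_support[OF fin S, where K = "\<Sum>x\<in>S. norm (real_vec x)" and n = n]
      step.hyps member_le_sum[of _ S "\<lambda>x. norm (real_vec x)"] fin by auto
  then have "fourier (convolution (convolution_power \<phi> n) \<phi>) \<xi> = fourier (convolution_power \<phi> n) \<xi> * fourier \<phi> \<xi>"
    by (intro fourier_convolution[OF fin S]) auto
  then show ?case using step by (simp add: convolution_power_Suc)
qed

definition cube :: "(real ^ 'd) set" where
  "cube = cbox (\<chi> i. - pi) (\<chi> i. pi)"

lemma mem_cube: "\<xi> \<in> cube \<longleftrightarrow> (\<forall>b\<in>Basis. - pi \<le> \<xi> \<bullet> b \<and> \<xi> \<bullet> b \<le> pi)"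
  by (auto simp: cube_def mem_box_cart Basis_vec_def inner_axis)

lemma integral_lborel_prod:
  fixes f :: "'a::euclidean_space \<Rightarrow> real \<Rightarrow> complex"
  assumes "\<And>b. b \<in> Basis \<Longrightarrow> integrable lborel (f b)"
  shows "(\<integral>x. (\<Prod>b\<in>Basis. f b (x \<bullet> b)) \<partial>lborel) = (\<Prod>b\<in>Basis. (\<integral>t. f b t \<partial>lborel))"
proof -
  interpret product_sigma_finite "\<lambda>b :: 'a. lborel :: real measure" ..
  have [measurable]: "f b \<in> borel_measurable borel" if "b \<in> Basis" for b
    using assms[OF that] by (simp add: borel_measurable_integrable)
  have "(\<integral>x. (\<Prod>b\<in>Basis. f b (x \<bullet> b)) \<partial>lborel)
      = (\<integral>g. (\<Prod>b\<in>Basis. f b (g b)) \<partial>(\<Pi>\<^sub>M b\<in>Basis. lborel))"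
    by (subst lborel_eq, subst integral_distr) auto
  also have "\<dots> = (\<Prod>b\<in>Basis. (\<integral>t. f b t \<partial>lborel))"
    using assms by (intro product_integral_prod) auto
  finally show ?thesis .
qed

lemma integral_character_interval:
  fixes m :: int
  shows "(\<integral>t. indicator {-pi..pi} t *\<^sub>R exp (\<i> * complex_of_real (real_of_int m * t)) \<partial>lborel)
     = (if m = 0 then complex_of_real (2 * pi) else 0)"
proof (cases "m = 0")
  case True
  have "(\<integral>t. indicator {-pi..pi} t *\<^sub>R (1 :: complex) \<partial>lborel) = of_real pi - of_real (- pi)"
    by (rule integral_FTC_Icc) (auto intro!: derivative_eq_intros continuous_intros)
  with True show ?thesis by simp
next
  case False
  let ?F = "\<lambda>t. exp (\<i> * complex_of_real (real_of_int m * t)) / (\<i> * of_int m)"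
  have "(\<integral>t. indicator {-pi..pi} t *\<^sub>R exp (\<i> * complex_of_real (real_of_int m * t)) \<partial>lborel) = ?F pi - ?F (- pi)"
  proof (rule integral_FTC_Icc)
    fix t :: real
    show "(?F has_vector_derivative exp (\<i> * complex_of_real (real_of_int m * t))) (at t within {-pi..pi})"
      using False
      by (auto intro!: derivative_eq_intros has_vector_derivative_real_field simp: field_simps)
  qed (auto intro!: continuous_intros)
  also have "?F pi - ?F (- pi) = 0"
  proof -
    have "exp (\<i> * complex_of_real (real_of_int m * pi)) = exp (\<i> * complex_of_real (real_of_int m * (- pi)))"
      unfolding exp_eq by (intro exI[of _ m]) (simp add: algebra_simps)
    then show ?thesis by simp
  qed
  finally show ?thesis using False by simp
qed

lemma integral_character_cube:
  "(\<integral>\<xi>. indicator cube \<xi> *\<^sub>R character x \<xi> \<partial>lborel) = (if x = 0 then complex_of_real ((2 * pi) ^ CARD('d)) else 0)"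
  for x :: "int ^ 'd"
proof -
  define f where "f = (\<lambda>(b :: real ^ 'd) t. indicator {-pi..pi} t *\<^sub>R exp (\<i> * complex_of_real ((real_vec x \<bullet> b) * t)))"
  have prod: "indicator cube \<xi> *\<^sub>R character x \<xi> = (\<Prod>b\<in>Basis. f b (\<xi> \<bullet> b))" for \<xi>
  proof -
    have "(\<Prod>b\<in>Basis. f b (\<xi> \<bullet> b)) = (\<Prod>b\<in>Basis. of_real (indicator {-pi..pi} (\<xi> \<bullet> b)))
        * (\<Prod>b\<in>Basis. exp (\<i> * complex_of_real ((real_vec x \<bullet> b) * (\<xi> \<bullet> b))))"
      by (simp add: f_def scaleR_conv_of_real prod.distrib)
    also have "(\<Prod>b\<in>Basis. exp (\<i> * complex_of_real ((real_vec x \<bullet> b) * (\<xi> \<bullet> b)))) = character x \<xi>"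
      unfolding euclidean_inner[of "real_vec x" \<xi>] by (simp add: exp_sum[symmetric] sum_distrib_left)
    also have "(\<Prod>b\<in>Basis. complex_of_real (indicator {-pi..pi} (\<xi> \<bullet> b))) = of_real (indicator cube \<xi>)"
      by (auto simp: mem_cube indicator_def)
    finally show ?thesis by (simp add: scaleR_conv_of_real)
  qed
  have f_int: "integrable lborel (f b)" for b
    unfolding f_def set_integrable_def[symmetric]
    by (intro borel_integrable_atLeastAtMost') (auto intro!: continuous_intros)
  have f_val: "(\<integral>t. f (axis i 1) t \<partial>lborel) = (if x $ i = 0 then complex_of_real (2 * pi) else 0)" for i
    unfolding f_def using integral_character_interval[of "x $ i"] by (simp add: inner_axis real_vec_def)
  have "(\<integral>\<xi>. indicator cube \<xi> *\<^sub>R character x \<xi> \<partial>lborel) = (\<Prod>b\<in>Basis. (\<integral>t. f b t \<partial>lborel))"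
    unfolding prod by (intro integral_lborel_prod f_int)
  also have "\<dots> = (\<Prod>i\<in>UNIV. (if x $ i = 0 then complex_of_real (2 * pi) else 0))"
    unfolding prod_Basis_cart f_val ..
  also have "\<dots> = (if x = 0 then complex_of_real ((2 * pi) ^ CARD('d)) else 0)"
    by (auto simp: vec_eq_iff prod_zero_iff)
  finally show ?thesis .
qed

text \<open>By orthogonality of the characters on a period, a coefficient is the mean of the transform against
  the conjugate character.\<close>

lemma coefficient_le_integral:
  fixes a :: "int ^ 'd \<Rightarrow> complex"
  assumes "finite S" "\<And>x. x \<notin> S \<Longrightarrow> a x = 0"
  shows "ennreal ((2 * pi) ^ CARD('d) * cmod (a x)) \<le> (\<integral>\<^sup>+\<xi>. ennreal (cmod (fourier a \<xi>)) * indicator cube \<xi> \<partial>lborel)"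
proof -
  let ?g = "\<lambda>\<xi>. indicator cube \<xi> *\<^sub>R (fourier a \<xi> * character (- x) \<xi>)"
  have int: "integrable lborel (\<lambda>\<xi> :: real ^ 'd. indicator cube \<xi> *\<^sub>R character y \<xi>)" for y
    unfolding cube_def by (intro borel_integrable_compact) (auto intro!: continuous_intros)
  have g: "?g \<xi> = (\<Sum>y\<in>S. a y * (indicator cube \<xi> *\<^sub>R character (y - x) \<xi>))" for \<xi>
    using character_add[of _ "- x" \<xi>]
    by (simp add: fourier_finite[OF assms] sum_distrib_right scaleR_sum_right mult.assoc)
  have "(\<integral>\<xi>. ?g \<xi> \<partial>lborel) = (\<Sum>y\<in>S. a y * (\<integral>\<xi>. indicator cube \<xi> *\<^sub>R character (y - x) \<xi> \<partial>lborel))"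
    unfolding g by (simp only: Bochner_Integration.integral_sum integrable_mult_right int integral_mult_right_zero)
  also have "\<dots> = (\<Sum>y\<in>S. if y = x then a y * complex_of_real ((2 * pi) ^ CARD('d)) else 0)"
    unfolding integral_character_cube by (intro sum.cong) auto
  also have "\<dots> = a x * complex_of_real ((2 * pi) ^ CARD('d))"
    using assms by (auto simp: sum.delta)
  finally have "ennreal ((2 * pi) ^ CARD('d) * cmod (a x)) = ennreal (norm (\<integral>\<xi>. ?g \<xi> \<partial>lborel))"
    by (simp add: norm_mult norm_power mult.commute)
  also have "\<dots> \<le> (\<integral>\<^sup>+\<xi>. ennreal (norm (?g \<xi>)) \<partial>lborel)"
    unfolding g by (intro integral_norm_bound_ennreal Bochner_Integration.integrable_sum integrable_mult_right int)
  also have "\<dots> = (\<integral>\<^sup>+\<xi>. ennreal (cmod (fourier a \<xi>)) * indicator cube \<xi> \<partial>lborel)"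
    by (intro nn_integral_cong) (auto simp: norm_mult indicator_def)
  finally show ?thesis .
qed

text \<open>On the Fourier side the multiplier \<open>exp (i (k \<bullet> h - \<theta>)) - 1\<close> is a difference with step \<open>h\<close>, rotated
  by the phase \<open>\<theta>\<close>. With \<open>\<theta> = n (\<alpha> \<bullet> h)\<close> the drift \<open>\<alpha>\<close> is divided out. Since \<open>h\<close> is real, the multiplier
  has modulus at most 2, so a twist adapted to one point does no harm elsewhere.\<close>

definition twist :: "real ^ 'd \<Rightarrow> real \<Rightarrow> (int ^ 'd \<Rightarrow> complex) \<Rightarrow> int ^ 'd \<Rightarrow> complex" where
  "twist h \<theta> a = (\<lambda>k. (exp (\<i> * complex_of_real (real_vec k \<bullet> h - \<theta>)) - 1) * a k)"

lemma twist_support: "(\<And>x. x \<notin> S \<Longrightarrow> a x = 0) \<Longrightarrow> x \<notin> S \<Longrightarrow> twist h \<theta> a x = 0"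
  by (simp add: twist_def)

lemma fourier_twist:
  assumes "finite S" "\<And>x. x \<notin> S \<Longrightarrow> a x = 0"
  shows "fourier (twist h \<theta> a) \<xi> = exp (- \<i> * of_real \<theta>) * fourier a (\<xi> + h) - fourier a \<xi>"
proof -
  have "fourier (twist h \<theta> a) \<xi> = (\<Sum>x\<in>S. twist h \<theta> a x * character x \<xi>)"
    by (rule fourier_finite[OF assms(1) twist_support[OF assms(2)]])
  also have "\<dots> = (\<Sum>x\<in>S. exp (- \<i> * of_real \<theta>) * (a x * character x (\<xi> + h)) - a x * character x \<xi>)"
  proof (rule sum.cong[OF refl])
    fix x
    have "exp (\<i> * complex_of_real (real_vec x \<bullet> h - \<theta>)) * character x \<xi>
        = exp (- \<i> * of_real \<theta>) * character x (\<xi> + h)"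
      by (simp add: exp_add[symmetric] inner_add_right algebra_simps)
    then show "twist h \<theta> a x * character x \<xi> = exp (- \<i> * of_real \<theta>) * (a x * character x (\<xi> + h)) - a x * character x \<xi>"
      by (simp add: twist_def algebra_simps)
  qed
  also have "\<dots> = exp (- \<i> * of_real \<theta>) * fourier a (\<xi> + h) - fourier a \<xi>"
    by (simp add: fourier_finite[OF assms] sum_subtractf sum_distrib_left)
  finally show ?thesis .
qed

lemma twist_funpow: "(twist h \<theta> ^^ N) a = (\<lambda>k. (exp (\<i> * complex_of_real (real_vec k \<bullet> h - \<theta>)) - 1) ^ N * a k)"
  by (induction N) (auto simp: twist_def mult_ac)

lemma twist_funpow_support: "(\<And>x. x \<notin> S \<Longrightarrow> a x = 0) \<Longrightarrow> x \<notin> S \<Longrightarrow> (twist h \<theta> ^^ N) a x = 0"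
  by (simp add: twist_funpow)

text \<open>Along a line in the direction of the step, twisting by the matching phase is the plain difference
  of the function with its oscillation removed.\<close>

lemma fourier_twist_line:
  assumes a: "finite S" "\<And>x. x \<notin> S \<Longrightarrow> a x = 0"
    and G: "\<And>t. fourier a (z + t *\<^sub>R v) = \<kappa> * exp (\<i> * of_real (t * \<omega>)) * G (of_real t)"
  shows "fourier ((twist (\<tau> *\<^sub>R v) (\<tau> * \<omega>) ^^ N) a) (z + t *\<^sub>R v) =
    \<kappa> * exp (\<i> * of_real (t * \<omega>)) * (fdiff \<tau> ^^ N) G (of_real t)"
proof (induction N arbitrary: t)
  case 0
  then show ?case using G by simp
next
  case (Suc N)
  let ?b = "(twist (\<tau> *\<^sub>R v) (\<tau> * \<omega>) ^^ N) a" and ?F = "(fdiff \<tau> ^^ N) G"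
  have "fourier ((twist (\<tau> *\<^sub>R v) (\<tau> * \<omega>) ^^ Suc N) a) (z + t *\<^sub>R v)
      = exp (- \<i> * of_real (\<tau> * \<omega>)) * fourier ?b (z + (t + \<tau>) *\<^sub>R v) - fourier ?b (z + t *\<^sub>R v)"
  proof -
    have "?b x = 0" if "x \<notin> S" for x using a(2) that by (rule twist_funpow_support)
    then show ?thesis
      using fourier_twist[OF a(1), where a = ?b and h = "\<tau> *\<^sub>R v" and \<theta> = "\<tau> * \<omega>" and \<xi> = "z + t *\<^sub>R v"]
      by (simp add: scaleR_add_left add.assoc)
  qed
  also have "\<dots> = \<kappa> * ((exp (- \<i> * of_real (\<tau> * \<omega>)) * exp (\<i> * of_real ((t + \<tau>) * \<omega>))) * ?F (of_real (t + \<tau>))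
      - exp (\<i> * of_real (t * \<omega>)) * ?F (of_real t))"
    unfolding Suc by (simp add: algebra_simps)
  also have "exp (- \<i> * of_real (\<tau> * \<omega>)) * exp (\<i> * of_real ((t + \<tau>) * \<omega>)) = exp (\<i> * complex_of_real (t * \<omega>))"
    by (simp add: exp_add[symmetric] algebra_simps)
  finally show ?case
    by (simp add: fdiff_def[of \<tau> ?F] algebra_simps)
qed

definition ball_integral :: "(int ^ 'd \<Rightarrow> complex) \<Rightarrow> real ^ 'd \<Rightarrow> real \<Rightarrow> ennreal" where
  "ball_integral a z \<rho> = (\<integral>\<^sup>+\<xi>. ennreal (cmod (fourier a \<xi>)) * indicator (ball z \<rho>) \<xi> \<partial>lborel)"

text \<open>The difference involves the function itself and one translate of it; the translate is integrated
  over a shifted ball, whence the larger radius.\<close>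

lemma ball_integral_twist:
  assumes a: "finite S" "\<And>x. x \<notin> S \<Longrightarrow> a x = 0" and h: "norm h \<le> r"
  shows "ball_integral (twist h \<theta> a) z \<rho> \<le> 2 * ball_integral a z (\<rho> + r)"
proof -
  have r: "r \<ge> 0" using h norm_ge_zero order_trans by blast
  have [measurable]: "fourier a \<in> borel_measurable borel" by (rule fourier_measurable[OF a])
  let ?f = "\<lambda>\<xi>. ennreal (cmod (fourier a \<xi>)) * indicator (ball z (\<rho> + r)) \<xi>"
  have [measurable]: "ball z (\<rho> + r) \<in> sets borel" by simp
  have f [measurable]: "?f \<in> borel_measurable borel" by measurable
  have pointwise: "ennreal (cmod (fourier (twist h \<theta> a) \<xi>)) * indicator (ball z \<rho>) \<xi> \<le> ?f (h + \<xi>) + ?f \<xi>" for \<xi>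
  proof (cases "\<xi> \<in> ball z \<rho>")
    case True
    have "\<xi> \<in> ball z (\<rho> + r)" using True r by simp
    moreover have "h + \<xi> \<in> ball z (\<rho> + r)"
    proof -
      have "dist z (h + \<xi>) \<le> dist z \<xi> + norm h"
        using dist_triangle[of z "h + \<xi>" \<xi>] by (simp add: dist_norm norm_minus_commute)
      then show ?thesis using True h by simp
    qed
    moreover have "cmod (fourier (twist h \<theta> a) \<xi>) \<le> cmod (fourier a (h + \<xi>)) + cmod (fourier a \<xi>)"
    proof -
      have "fourier (twist h \<theta> a) \<xi> = exp (- \<i> * of_real \<theta>) * fourier a (\<xi> + h) - fourier a \<xi>"
        by (rule fourier_twist[OF a])
      then have "cmod (fourier (twist h \<theta> a) \<xi>) \<le> cmod (exp (- \<i> * of_real \<theta>) * fourier a (\<xi> + h)) + cmod (fourier a \<xi>)"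
        by (simp only: norm_triangle_ineq4)
      then show ?thesis by (simp add: norm_mult add.commute)
    qed
    ultimately show ?thesis using True
      by (simp add: ennreal_plus[symmetric] ennreal_leI del: ennreal_plus)
  qed simp
  have "ball_integral (twist h \<theta> a) z \<rho> \<le> (\<integral>\<^sup>+\<xi>. ?f (h + \<xi>) + ?f \<xi> \<partial>lborel)"
    unfolding ball_integral_def by (intro nn_integral_mono pointwise)
  also have "\<dots> = (\<integral>\<^sup>+\<xi>. ?f (h + \<xi>) \<partial>lborel) + ball_integral a z (\<rho> + r)"
    unfolding ball_integral_def by (subst nn_integral_add) auto
  also have "(\<integral>\<^sup>+\<xi>. ?f (h + \<xi>) \<partial>lborel) = (\<integral>\<^sup>+\<xi>. ?f \<xi> \<partial>distr lborel borel ((+) h))"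
    by (subst nn_integral_distr) auto
  also have "\<dots> = ball_integral a z (\<rho> + r)"
    unfolding lborel_distr_plus ball_integral_def ..
  finally show ?thesis by (simp add: mult_2)
qed

lemma ball_integral_twist_funpow:
  assumes a: "finite S" "\<And>x. x \<notin> S \<Longrightarrow> a x = 0" and h: "norm h \<le> r"
  shows "ball_integral ((twist h \<theta> ^^ N) a) z \<rho> \<le> 2 ^ N * ball_integral a z (\<rho> + real N * r)"
proof (induction N arbitrary: \<rho>)
  case (Suc N)
  have "ball_integral ((twist h \<theta> ^^ Suc N) a) z \<rho> \<le> 2 * ball_integral ((twist h \<theta> ^^ N) a) z (\<rho> + r)"
    using ball_integral_twist[OF a(1) twist_funpow_support[OF a(2)] h] by simp
  also have "\<dots> \<le> 2 * (2 ^ N * ball_integral a z (\<rho> + r + real N * r))"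
    by (intro mult_left_mono Suc) auto
  finally show ?case by (simp add: algebra_simps)
qed simp

lemma sup_bound_twist_funpow:
  assumes a: "finite S" "\<And>x. x \<notin> S \<Longrightarrow> a x = 0" and h: "norm h \<le> r"
    and B: "\<And>\<xi>'. dist \<xi> \<xi>' \<le> \<rho> + real N * r \<Longrightarrow> cmod (fourier a \<xi>') \<le> B"
    and \<xi>': "dist \<xi> \<xi>' \<le> \<rho>"
  shows "cmod (fourier ((twist h \<theta> ^^ N) a) \<xi>') \<le> 2 ^ N * B"
  using B \<xi>'
proof (induction N arbitrary: \<rho> \<xi>')
  case 0
  then show ?case by simp
next
  case (Suc N)
  have r: "r \<ge> 0" using h norm_ge_zero order_trans by blast
  let ?b = "(twist h \<theta> ^^ N) a"
  have IH: "cmod (fourier ?b \<xi>'') \<le> 2 ^ N * B" if "dist \<xi> \<xi>'' \<le> \<rho> + r" for \<xi>''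
    using that by (intro Suc.IH[of "\<rho> + r"] Suc.prems(1)) (auto simp: algebra_simps)
  have "dist \<xi> (\<xi>' + h) \<le> dist \<xi> \<xi>' + norm h"
    using dist_triangle[of \<xi> "\<xi>' + h" \<xi>'] by (simp add: dist_norm)
  then have d: "dist \<xi> (\<xi>' + h) \<le> \<rho> + r" "dist \<xi> \<xi>' \<le> \<rho> + r" using Suc.prems(2) h r by auto
  have "cmod (fourier (twist h \<theta> ?b) \<xi>') \<le> cmod (fourier ?b (\<xi>' + h)) + cmod (fourier ?b \<xi>')"
  proof -
    have "?b x = 0" if "x \<notin> S" for x using a(2) that by (rule twist_funpow_support)
    then have "fourier (twist h \<theta> ?b) \<xi>' = exp (- \<i> * of_real \<theta>) * fourier ?b (\<xi>' + h) - fourier ?b \<xi>'"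
      by (rule fourier_twist[OF a(1)])
    then have "cmod (fourier (twist h \<theta> ?b) \<xi>') \<le> cmod (exp (- \<i> * of_real \<theta>) * fourier ?b (\<xi>' + h)) + cmod (fourier ?b \<xi>')"
      by (simp only: norm_triangle_ineq4)
    then show ?thesis by (simp add: norm_mult)
  qed
  also have "\<dots> \<le> 2 ^ N * B + 2 ^ N * B" by (intro add_mono IH d)
  finally show ?case by (simp add: mult_ac)
qed

text \<open>Twists of order \<open>N\<close> for all members of \<open>Q\<close> at once. In product form they commute visibly, so any one
  of them can be performed first.\<close>

definition twists :: "('q \<Rightarrow> real ^ 'd) \<Rightarrow> ('q \<Rightarrow> real) \<Rightarrow> nat \<Rightarrow> 'q set \<Rightarrow> (int ^ 'd \<Rightarrow> complex) \<Rightarrow> int ^ 'd \<Rightarrow> complex" where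
  "twists h \<theta> N Q a = (\<lambda>k. (\<Prod>q\<in>Q. (exp (\<i> * complex_of_real (real_vec k \<bullet> h q - \<theta> q)) - 1) ^ N) * a k)"

lemma twists_empty [simp]: "twists h \<theta> N {} a = a"
  by (simp add: twists_def)

lemma twists_insert:
  "finite Q \<Longrightarrow> q \<notin> Q \<Longrightarrow> twists h \<theta> N (insert q Q) a = (twist (h q) (\<theta> q) ^^ N) (twists h \<theta> N Q a)"
  by (simp add: twists_def twist_funpow mult.assoc)

lemma twists_remove:
  "finite Q \<Longrightarrow> q \<in> Q \<Longrightarrow> twists h \<theta> N Q a = twists h \<theta> N (Q - {q}) ((twist (h q) (\<theta> q) ^^ N) a)"
  by (simp add: twists_def twist_funpow prod.remove[of Q q] mult_ac)

lemma twists_support: "(\<And>x. x \<notin> S \<Longrightarrow> a x = 0) \<Longrightarrow> x \<notin> S \<Longrightarrow> twists h \<theta> N Q a x = 0"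
  by (simp add: twists_def)

lemma ball_integral_twists:
  assumes a: "finite S" "\<And>x. x \<notin> S \<Longrightarrow> a x = 0" and "finite Q" and h: "\<And>q. q \<in> Q \<Longrightarrow> norm (h q) \<le> r"
  shows "ball_integral (twists h \<theta> N Q a) z \<rho> \<le> 2 ^ (N * card Q) * ball_integral a z (\<rho> + real (N * card Q) * r)"
  using assms(3,4)
proof (induction Q arbitrary: \<rho>)
  case (insert q Q)
  have "ball_integral (twists h \<theta> N (insert q Q) a) z \<rho>
      \<le> 2 ^ N * ball_integral (twists h \<theta> N Q a) z (\<rho> + real N * r)"
  proof -
    have "twists h \<theta> N Q a x = 0" if "x \<notin> S" for x using a(2) that by (rule twists_support)
    then show ?thesis
      unfolding twists_insert[OF insert.hyps]
      by (rule ball_integral_twist_funpow[OF a(1)]) (use insert.prems in auto)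
  qed
  also have "\<dots> \<le> 2 ^ N * (2 ^ (N * card Q) * ball_integral a z (\<rho> + real N * r + real (N * card Q) * r))"
    using insert.prems by (intro mult_left_mono insert.IH) auto
  finally show ?case
    using insert.hyps by (simp add: algebra_simps power_add)
qed simp

lemma sup_bound_twists:
  assumes a: "finite S" "\<And>x. x \<notin> S \<Longrightarrow> a x = 0" and "finite Q" and h: "\<And>q. q \<in> Q \<Longrightarrow> norm (h q) \<le> r"
    and B: "\<And>\<xi>'. dist \<xi> \<xi>' \<le> \<rho> + real (N * card Q) * r \<Longrightarrow> cmod (fourier a \<xi>') \<le> B"
    and "dist \<xi> \<xi>' \<le> \<rho>"
  shows "cmod (fourier (twists h \<theta> N Q a) \<xi>') \<le> 2 ^ (N * card Q) * B"
  using assms(3-)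
proof (induction Q arbitrary: \<rho> \<xi>')
  case empty
  then show ?case by simp
next
  case (insert q Q)
  have "cmod (fourier ((twist (h q) (\<theta> q) ^^ N) (twists h \<theta> N Q a)) \<xi>') \<le> 2 ^ N * (2 ^ (N * card Q) * B)"
  proof (rule sup_bound_twist_funpow[OF a(1) twists_support[OF a(2)], where r = r and \<rho> = \<rho>])
    fix \<xi>'' assume d: "dist \<xi> \<xi>'' \<le> \<rho> + real N * r"
    show "cmod (fourier (twists h \<theta> N Q a) \<xi>'') \<le> 2 ^ (N * card Q) * B"
    proof (rule insert.IH[OF _ _ d])
      fix \<xi>3 assume "dist \<xi> \<xi>3 \<le> \<rho> + real N * r + real (N * card Q) * r"
      then show "cmod (fourier a \<xi>3) \<le> B"
        using insert.hyps by (intro insert.prems(2)) (simp add: algebra_simps)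
    qed (use insert.prems in auto)
  qed (use insert.prems in auto)
  then show ?case
    using insert.hyps by (simp add: twists_insert power_add mult.assoc)
qed

section \<open>The local contribution to the integral\<close>

lemma torus_representative:
  fixes \<xi> :: "real ^ 'd"
  assumes S: "finite S" "\<And>x. x \<notin> S \<Longrightarrow> a x = 0"
  shows "\<exists>\<eta>\<in>torus. \<forall>\<zeta>. fourier a (\<xi> + \<zeta>) = fourier a (\<eta> + \<zeta>)"
proof -
  define k where "k = (\<chi> i. ceiling ((\<xi> $ i - pi) / (2 * pi)))"
  define \<eta> where "\<eta> = \<xi> - (2 * pi) *\<^sub>R real_vec k"
  have "\<eta> \<in> torus"
    unfolding torus_def
  proof (safe)
    fix i
    have "k $ i = ceiling ((\<xi> $ i - pi) / (2 * pi))" by (simp add: k_def)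
    then have "(\<xi> $ i - pi) / (2 * pi) \<le> real_of_int (k $ i)" "real_of_int (k $ i) < (\<xi> $ i - pi) / (2 * pi) + 1"
      using ceiling_correct[of "(\<xi> $ i - pi) / (2 * pi)"] by linarith+
    then show "- pi < \<eta> $ i" "\<eta> $ i \<le> pi"
      by (simp_all add: \<eta>_def real_vec_def field_simps)
  qed
  moreover have "character x (\<xi> + \<zeta>) = character x (\<eta> + \<zeta>)" for x \<zeta>
  proof -
    have int: "real_vec x \<bullet> real_vec k = real_of_int (\<Sum>i\<in>UNIV. x $ i * k $ i)"
      by (simp add: inner_vec_def real_vec_def)
    have "real_vec x \<bullet> (\<xi> + \<zeta>) = real_vec x \<bullet> (\<eta> + \<zeta>) + 2 * pi * (real_vec x \<bullet> real_vec k)"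
      by (simp add: \<eta>_def inner_add_right inner_diff_right)
    then show ?thesis
      unfolding exp_eq int by (intro exI[of _ "\<Sum>i\<in>UNIV. x $ i * k $ i"]) (simp add: algebra_simps)
  qed
  then have "fourier a (\<xi> + \<zeta>) = fourier a (\<eta> + \<zeta>)" for \<zeta>
    unfolding fourier_def by simp
  ultimately show ?thesis by blast
qed

text \<open>Exponentiating the expansion of \<open>Gamma_at\<close> gives \<open>W = exp (- P + \<Upsilon>)\<close>. Close to \<open>0\<close> the error \<open>\<Upsilon>\<close> is
  below half of \<open>Re P\<close>, which yields both bounds required of \<open>W\<close>.\<close>

lemma associated_local_expansion:
  fixes \<phi> :: "int ^ 'd \<Rightarrow> complex"
  assumes S: "finite S" "\<And>x. x \<notin> S \<Longrightarrow> \<phi> x = 0"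
    and \<xi>0: "cmod (fourier \<phi> \<xi>0) = 1" and assoc: "associated_to \<phi> \<xi>0 \<alpha> P" and E: "E \<in> Exp_set P"
  shows "\<exists>\<delta>>0. local_expansion P E S (\<lambda>k. \<phi> k * character k \<xi>0 / fourier \<phi> \<xi>0) (\<lambda>k. real_vec k - \<alpha>) \<delta>
      (\<lambda>\<xi>. exp (- \<i> * of_real (\<alpha> \<bullet> \<xi>)) * fourier \<phi> (\<xi>0 + \<xi>) / fourier \<phi> \<xi>0)"
proof -
  define W where "W = (\<lambda>\<xi>. exp (- \<i> * of_real (\<alpha> \<bullet> \<xi>)) * fourier \<phi> (\<xi>0 + \<xi>) / fourier \<phi> \<xi>0)"
  have nz: "fourier \<phi> \<xi>0 \<noteq> 0" using \<xi>0 by auto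
  obtain \<Upsilon> where php: "positive_homogeneous_polynomial P"
    and \<Upsilon>: "\<forall>\<^sub>F \<xi> in nhds 0. Gamma_at \<phi> \<xi>0 \<xi> = \<i> * complex_of_real (\<alpha> \<bullet> \<xi>) - P \<xi> + \<Upsilon> \<xi>"
    "\<Upsilon> \<in> o[at 0](\<lambda>\<xi>. complex_of_real (Re (P \<xi>)))"
    using assoc unfolding associated_to_def by blast
  interpret homogeneous_polynomial P E
    by unfold_locales (use php E in \<open>auto simp: positive_homogeneous_polynomial_def positive_homogeneous_def\<close>)
  have cont: "continuous_on UNIV (fourier \<phi>)" by (rule fourier_continuous[OF S])
  have ev1: "\<forall>\<^sub>F \<xi> in nhds 0. fourier \<phi> (\<xi> + \<xi>0) \<noteq> 0"
  proof -
    have "continuous_on UNIV (\<lambda>\<xi>. fourier \<phi> (\<xi> + \<xi>0))"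
      by (rule continuous_on_compose2[OF cont]) (auto intro!: continuous_intros)
    then have "open {\<xi>. fourier \<phi> (\<xi> + \<xi>0) \<noteq> 0}"
      by (rule open_Collect_neq) (rule continuous_on_const)
    then have "\<forall>\<^sub>F \<xi> in nhds 0. \<xi> \<in> {\<xi>. fourier \<phi> (\<xi> + \<xi>0) \<noteq> 0}"
      by (rule eventually_nhds_in_open) (simp add: nz)
    then show ?thesis by simp
  qed
  have ev2: "\<forall>\<^sub>F \<xi> in nhds 0. cmod (P \<xi>) < 1 / 4"
  proof -
    have "open {\<xi>. cmod (P \<xi>) < 1 / 4}"
      by (intro open_Collect_less continuous_on_norm continuous_on_polymonial_function[OF poly] continuous_on_const)
    then have "\<forall>\<^sub>F \<xi> in nhds 0. \<xi> \<in> {\<xi>. cmod (P \<xi>) < 1 / 4}"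
      by (rule eventually_nhds_in_open) (simp add: P_zero)
    then show ?thesis by simp
  qed
  have ev3: "\<forall>\<^sub>F \<xi> in nhds 0. \<xi> \<noteq> 0 \<longrightarrow> cmod (\<Upsilon> \<xi>) \<le> R \<xi> / 2"
  proof -
    have "\<forall>\<^sub>F \<xi> in at 0. cmod (\<Upsilon> \<xi>) \<le> 1 / 2 * cmod (complex_of_real (R \<xi>))"
      using \<Upsilon>(2) by (rule landau_o.smallD) simp
    then show ?thesis
      unfolding eventually_at_filter by (rule eventually_mono) (use R_nonneg in auto)
  qed
  have "\<forall>\<^sub>F \<xi> in nhds 0. cmod (W \<xi>) \<le> exp (- R \<xi> / 2) \<and> cmod (W \<xi> - 1) \<le> 4 * cmod (P \<xi>) \<and> cmod (P \<xi>) \<le> 1"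
    using ev1 ev2 ev3 \<Upsilon>(1)
  proof eventually_elim
    case (elim \<xi>)
    show ?case
    proof (cases "\<xi> = 0")
      case True
      then show ?thesis using nz by (simp add: W_def P_zero)
    next
      case False
      define w where "w = - P \<xi> + \<Upsilon> \<xi>"
      have "exp (Gamma_at \<phi> \<xi>0 \<xi>) = fourier \<phi> (\<xi>0 + \<xi>) / fourier \<phi> \<xi>0"
        using elim(1) nz by (simp add: Gamma_at_def add.commute)
      moreover have "exp (Gamma_at \<phi> \<xi>0 \<xi>) = exp (\<i> * complex_of_real (\<alpha> \<bullet> \<xi>)) * exp w"
        unfolding elim(4) by (simp add: w_def exp_add[symmetric] algebra_simps)
      ultimately have "W \<xi> = exp (- \<i> * of_real (\<alpha> \<bullet> \<xi>)) * (exp (\<i> * complex_of_real (\<alpha> \<bullet> \<xi>)) * exp w)"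
        by (simp add: W_def)
      also have "\<dots> = exp w" by (simp add: exp_add[symmetric])
      finally have W: "W \<xi> = exp w" .
      have Y: "cmod (\<Upsilon> \<xi>) \<le> R \<xi> / 2" using elim(3) False by simp
      have RP: "R \<xi> \<le> cmod (P \<xi>)" by (rule complex_Re_le_cmod)
      have "Re w \<le> - R \<xi> / 2"
        using Y complex_Re_le_cmod[of "\<Upsilon> \<xi>"] by (simp add: w_def)
      then have 1: "cmod (W \<xi>) \<le> exp (- R \<xi> / 2)" by (simp add: W)
      have w: "cmod w \<le> 3 / 2 * cmod (P \<xi>)"
        using norm_triangle_ineq[of "- P \<xi>" "\<Upsilon> \<xi>"] Y RP by (simp add: w_def)
      have "cmod (exp w - 1) \<le> exp (cmod w) * cmod w"
        using Taylor_exp_field[of w 0] by simp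
      also have "\<dots> \<le> 2 * (3 / 2 * cmod (P \<xi>))"
      proof (intro mult_mono w)
        have "exp (cmod w) \<le> exp (1 / 2)" using w elim(2) by simp
        then show "exp (cmod w) \<le> 2" using exp_half_le2 by linarith
      qed auto
      also have "\<dots> \<le> 4 * cmod (P \<xi>)" by simp
      finally have 2: "cmod (W \<xi> - 1) \<le> 4 * cmod (P \<xi>)" by (simp add: W)
      show ?thesis using 1 2 elim(2) by simp
    qed
  qed
  then obtain d where d: "d > 0" "\<And>\<xi>. dist \<xi> 0 < d \<Longrightarrow>
      cmod (W \<xi>) \<le> exp (- R \<xi> / 2) \<and> cmod (W \<xi> - 1) \<le> 4 * cmod (P \<xi>) \<and> cmod (P \<xi>) \<le> 1"
    unfolding eventually_nhds_metric by blast
  have W_sum: "W \<xi> = (\<Sum>k\<in>S. (\<phi> k * character k \<xi>0 / fourier \<phi> \<xi>0) * exp (\<i> * of_real ((real_vec k - \<alpha>) \<bullet> \<xi>)))" for \<xi>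
  proof -
    have "fourier \<phi> (\<xi>0 + \<xi>) = (\<Sum>k\<in>S. \<phi> k * character k (\<xi>0 + \<xi>))"
      by (rule fourier_finite[OF S])
    then have "W \<xi> = (\<Sum>k\<in>S. exp (- \<i> * of_real (\<alpha> \<bullet> \<xi>)) * (\<phi> k * character k (\<xi>0 + \<xi>)) / fourier \<phi> \<xi>0)"
      by (simp add: W_def sum_distrib_left sum_divide_distrib)
    also have "\<dots> = (\<Sum>k\<in>S. (\<phi> k * character k \<xi>0 / fourier \<phi> \<xi>0) * exp (\<i> * of_real ((real_vec k - \<alpha>) \<bullet> \<xi>)))"
    proof (rule sum.cong[OF refl])
      fix k
      have "exp (- \<i> * of_real (\<alpha> \<bullet> \<xi>)) * character k (\<xi>0 + \<xi>) = character k \<xi>0 * exp (\<i> * of_real ((real_vec k - \<alpha>) \<bullet> \<xi>))"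
        by (simp add: exp_add[symmetric] inner_add_right inner_diff_left algebra_simps)
      then show "exp (- \<i> * of_real (\<alpha> \<bullet> \<xi>)) * (\<phi> k * character k (\<xi>0 + \<xi>)) / fourier \<phi> \<xi>0
          = (\<phi> k * character k \<xi>0 / fourier \<phi> \<xi>0) * exp (\<i> * of_real ((real_vec k - \<alpha>) \<bullet> \<xi>))"
        by (simp add: mult.left_commute[of _ "\<phi> k"] mult.assoc)
    qed
    finally show ?thesis .
  qed
  have "local_expansion P E S (\<lambda>k. \<phi> k * character k \<xi>0 / fourier \<phi> \<xi>0) (\<lambda>k. real_vec k - \<alpha>) (d / 2) W"
    by unfold_locales (use S(1) d W_sum in auto)
  then show ?thesis
    unfolding W_def using d(1) by (intro exI[of _ "d / 2"]) simp
qed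

lemma nn_integral_decay_matrix_powr:
  fixes E :: "real ^ 'd ^ 'd"
  obtains J where "J > 0" "\<And>t z. t > 0 \<Longrightarrow>
    (\<integral>\<^sup>+\<xi>. ennreal (1 / (1 + norm (matrix_powr t E *v (\<xi> - z))) ^ (2 * CARD('d))) \<partial>lborel) \<le> ennreal (J * t powr (- trace E))"
proof -
  let ?f = "\<lambda>v :: real ^ 'd. ennreal (1 / (1 + norm v) ^ (2 * CARD('d)))"
  obtain j where j: "j \<ge> 0" "(\<integral>\<^sup>+v. ?f v \<partial>lborel) = ennreal j"
    using nn_integral_decay_finite[where 'd = 'd] by (cases "\<integral>\<^sup>+v. ?f v \<partial>lborel") auto
  have "(\<integral>\<^sup>+\<xi>. ?f (matrix_powr t E *v (\<xi> - z)) \<partial>lborel) \<le> ennreal ((j + 1) * t powr (- trace E))" if t: "t > 0" for t and z :: "real ^ 'd"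
  proof -
    have [measurable]: "(\<lambda>v. matrix_powr t E *v v) \<in> borel_measurable borel"
      by (intro borel_measurable_continuous_onI matrix_vector_mult_linear_continuous_on)
    have "(\<integral>\<^sup>+\<xi>. ?f (matrix_powr t E *v (\<xi> - z)) \<partial>lborel)
        = (\<integral>\<^sup>+\<xi>. ?f (matrix_powr t E *v \<xi>) \<partial>distr lborel borel ((+) (- z)))"
      by (subst nn_integral_distr) auto
    also have "\<dots> = (\<integral>\<^sup>+\<xi>. ?f (matrix_powr t E *v \<xi>) \<partial>lborel)"
      unfolding lborel_distr_plus ..
    also have "\<dots> = ennreal (t powr (- trace E)) * (\<integral>\<^sup>+v. ?f v \<partial>lborel)"
      using t by (rule nn_integral_matrix_powr) measurable
    also have "\<dots> = ennreal (j * t powr (- trace E))"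
      using j by (simp add: ennreal_mult[symmetric] mult.commute)
    also have "\<dots> \<le> ennreal ((j + 1) * t powr (- trace E))"
      by (intro ennreal_leI mult_right_mono) auto
    finally show ?thesis .
  qed
  then show ?thesis using that[of "j + 1"] j(1) by simp
qed

text \<open>Substituting \<open>\<xi> = z + n^(-E) \<eta>\<close>, the twist becomes a difference of \<open>W ^ n\<close> along a line with step \<open>\<tau>\<close>,
  which is \<open>O(\<tau>^N)\<close> and integrable in \<open>\<eta>\<close>; the volume element contributes \<open>n^(- trace E)\<close>.\<close>

lemma (in local_expansion) ball_integral_bound:
  obtains C n0 where "C > 0" "n0 \<ge> 1"
    "\<And>n u \<tau> a T z \<kappa> \<alpha>. n \<ge> n0 \<Longrightarrow> norm u = 1 \<Longrightarrow> 0 \<le> \<tau> \<Longrightarrow> \<tau> \<le> pi \<Longrightarrow> finite T \<Longrightarrow> (\<And>x. x \<notin> T \<Longrightarrow> a x = 0) \<Longrightarrow>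
      cmod \<kappa> = 1 \<Longrightarrow> (\<And>\<xi>. fourier a (z + \<xi>) = \<kappa> * exp (\<i> * of_real (real n * (\<alpha> \<bullet> \<xi>))) * W \<xi> ^ n) \<Longrightarrow>
      ball_integral ((twist (\<tau> *\<^sub>R A n u) (\<tau> * (real n * (\<alpha> \<bullet> A n u))) ^^ N) a) z (\<delta> / 2)
        \<le> ennreal (C * \<tau> ^ N * real n powr (- trace E))"
proof -
  obtain C n0 where C: "C > 0" "n0 \<ge> 1"
    "\<And>n \<eta> u \<tau>. n \<ge> n0 \<Longrightarrow> norm u = 1 \<Longrightarrow> norm (A n \<eta>) \<le> \<delta> / 2 \<Longrightarrow> 0 \<le> \<tau> \<Longrightarrow> \<tau> \<le> pi \<Longrightarrow>
       cmod ((fdiff \<tau> ^^ N) (\<lambda>w. line n \<eta> u w ^ n) 0) \<le> C * \<tau> ^ N / (1 + norm \<eta>) ^ (2 * CARD('d))"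
    by (rule line_power_fdiff_bound[where N = N and p = "2 * CARD('d)"]) blast
  obtain J where J: "J > 0" "\<And>t z. t > 0 \<Longrightarrow>
    (\<integral>\<^sup>+\<xi>. ennreal (1 / (1 + norm (matrix_powr t E *v (\<xi> - z))) ^ (2 * CARD('d))) \<partial>lborel) \<le> ennreal (J * t powr (- trace E))"
    by (rule nn_integral_decay_matrix_powr[of E]) blast
  have main: "ball_integral ((twist (\<tau> *\<^sub>R A n u) (\<tau> * (real n * (\<alpha> \<bullet> A n u))) ^^ N) a) z (\<delta> / 2)
        \<le> ennreal ((C * J) * \<tau> ^ N * real n powr (- trace E))"
    if n: "n \<ge> n0" and u: "norm u = 1" and \<tau>: "0 \<le> \<tau>" "\<tau> \<le> pi" and T: "finite T" "\<And>x. x \<notin> T \<Longrightarrow> a x = 0"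
      and \<kappa>: "cmod \<kappa> = 1" and a: "\<And>\<xi>. fourier a (z + \<xi>) = \<kappa> * exp (\<i> * of_real (real n * (\<alpha> \<bullet> \<xi>))) * W \<xi> ^ n"
    for n u \<tau> a T z \<kappa> \<alpha>
  proof -
    have n1: "real n > 0" using n C by simp
    let ?b = "(twist (\<tau> *\<^sub>R A n u) (\<tau> * (real n * (\<alpha> \<bullet> A n u))) ^^ N) a"
    let ?B = "matrix_powr (real n) E"
    let ?g = "\<lambda>\<xi>. ennreal (1 / (1 + norm (?B *v (\<xi> - z))) ^ (2 * CARD('d)))"
    have [measurable]: "(\<lambda>v. ?B *v v) \<in> borel_measurable borel"
      by (intro borel_measurable_continuous_onI matrix_vector_mult_linear_continuous_on)
    have pointwise: "ennreal (cmod (fourier ?b \<xi>)) * indicator (ball z (\<delta> / 2)) \<xi> \<le> ennreal (C * \<tau> ^ N) * ?g \<xi>" for \<xi>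
    proof (cases "\<xi> \<in> ball z (\<delta> / 2)")
      case True
      define \<eta> where "\<eta> = ?B *v (\<xi> - z)"
      have A\<eta>: "A n \<eta> = \<xi> - z"
        using matrix_powr_inverse(2)[OF n1, of E] by (simp add: \<eta>_def matrix_vector_mul_assoc)
      have "norm (A n \<eta>) \<le> \<delta> / 2"
        unfolding A\<eta> using True by (simp add: dist_norm norm_minus_commute)
      then have fd: "cmod ((fdiff \<tau> ^^ N) (\<lambda>w. line n \<eta> u w ^ n) 0) \<le> C * \<tau> ^ N / (1 + norm \<eta>) ^ (2 * CARD('d))"
        using C(3)[OF n u _ \<tau>] by blast
      define \<kappa>' where "\<kappa>' = \<kappa> * exp (\<i> * of_real (real n * (\<alpha> \<bullet> A n \<eta>)))"
      have line: "fourier a (\<xi> + t *\<^sub>R A n u) = \<kappa>' * exp (\<i> * of_real (t * (real n * (\<alpha> \<bullet> A n u)))) * line n \<eta> u (of_real t) ^ n" for t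
      proof -
        have e: "exp (\<i> * of_real (real n * (\<alpha> \<bullet> A n (\<eta> + t *\<^sub>R u))))
            = exp (\<i> * of_real (real n * (\<alpha> \<bullet> A n \<eta>))) * exp (\<i> * of_real (t * (real n * (\<alpha> \<bullet> A n u))))"
          by (simp add: A_add inner_add_right exp_add[symmetric] algebra_simps)
        have "\<xi> + t *\<^sub>R A n u = z + A n (\<eta> + t *\<^sub>R u)" by (simp add: A_add A\<eta>)
        then show ?thesis
          by (simp only: a e line_of_real \<kappa>'_def mult.assoc)
      qed
      have "fourier ?b (\<xi> + 0 *\<^sub>R A n u) =
          \<kappa>' * exp (\<i> * of_real (0 * (real n * (\<alpha> \<bullet> A n u)))) * (fdiff \<tau> ^^ N) (\<lambda>w. line n \<eta> u w ^ n) (of_real 0)"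
      proof (rule fourier_twist_line[where S = T and G = "\<lambda>w. line n \<eta> u w ^ n"])
        show "finite T" by (rule T(1))
        show "a x = 0" if "x \<notin> T" for x using that by (rule T(2))
      qed (rule line)
      then have "cmod (fourier ?b \<xi>) = cmod ((fdiff \<tau> ^^ N) (\<lambda>w. line n \<eta> u w ^ n) 0)"
        using \<kappa> by (simp add: norm_mult \<kappa>'_def norm_exp_i_times del: of_real_mult)
      then have "cmod (fourier ?b \<xi>) \<le> (C * \<tau> ^ N) * (1 / (1 + norm \<eta>) ^ (2 * CARD('d)))"
        using fd by simp
      then show ?thesis
        using True C(1) \<tau>(1) by (simp add: \<eta>_def ennreal_mult[symmetric] ennreal_leI del: times_divide_eq_right)
    qed simp
    have "ball_integral ?b z (\<delta> / 2) \<le> (\<integral>\<^sup>+\<xi>. ennreal (C * \<tau> ^ N) * ?g \<xi> \<partial>lborel)"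
      unfolding ball_integral_def by (intro nn_integral_mono pointwise)
    also have "\<dots> = ennreal (C * \<tau> ^ N) * (\<integral>\<^sup>+\<xi>. ?g \<xi> \<partial>lborel)"
      by (rule nn_integral_cmult) measurable
    also have "\<dots> \<le> ennreal (C * \<tau> ^ N) * ennreal (J * real n powr (- trace E))"
      using J(2)[OF n1] by (intro mult_left_mono) auto
    also have "\<dots> = ennreal ((C * J) * \<tau> ^ N * real n powr (- trace E))"
      using C(1) J(1) \<tau>(1) by (simp add: ennreal_mult[symmetric] mult_ac)
    finally show ?thesis .
  qed
  show ?thesis
    by (rule that[OF _ C(2) main]) (use C(1) J(1) in auto)
qed

section \<open>The points of modulus one\<close>

lemma power_times_geometric_bounded:
  fixes \<rho> :: real
  assumes "0 < \<rho>" "\<rho> < 1"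
  obtains C where "C > 0" "\<And>n. real n ^ k * \<rho> ^ n \<le> C"
proof -
  define s where "s = - ln \<rho>"
  have s: "s > 0" using assms by (simp add: s_def)
  have "real n ^ k * \<rho> ^ n \<le> fact k / s ^ k" for n
  proof -
    have "(s * real n) ^ k / fact k \<le> exp (s * real n)"
      using s by (intro power_div_fact_le_exp) simp
    moreover have "\<rho> ^ n = exp (- (s * real n))"
      using assms by (simp add: s_def exp_of_nat2_mult)
    then have "exp (s * real n) * \<rho> ^ n = 1" by (simp add: exp_minus)
    moreover have "0 \<le> \<rho> ^ n" using assms by simp
    ultimately have "(s * real n) ^ k / fact k * \<rho> ^ n \<le> 1"
      by (metis mult_right_mono)
    then show ?thesis
      using s by (simp add: field_simps power_mult_distrib)
  qed
  then show ?thesis using that[of "fact k / s ^ k"] s by simp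
qed

lemma emeasure_cube: "emeasure lborel (cube :: (real ^ 'd) set) = ennreal ((2 * pi) ^ CARD('d))"
proof -
  have "emeasure lborel (cube :: (real ^ 'd) set) = ennreal (\<Prod>b\<in>(Basis :: (real ^ 'd) set). ((\<chi> i. pi) - (\<chi> i. - pi)) \<bullet> b)"
    unfolding cube_def by (subst emeasure_lborel_cbox) (auto simp: Basis_vec_def inner_axis)
  also have "(\<Prod>b\<in>(Basis :: (real ^ 'd) set). ((\<chi> i. pi) - (\<chi> i. - pi)) \<bullet> b) = (2 * pi) ^ CARD('d)"
    unfolding prod_Basis_cart by (simp add: inner_axis)
  finally show ?thesis .
qed

locale normalized_symbol =
  fixes \<phi> :: "int ^ 'd \<Rightarrow> complex" and \<alpha> :: "real ^ 'd \<Rightarrow> real ^ 'd" and P :: "real ^ 'd \<Rightarrow> real ^ 'd \<Rightarrow> complex"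
  assumes fin: "finitely_supported \<phi>"
    and sup: "(SUP \<xi>\<in>torus. cmod (fourier \<phi> \<xi>)) = 1"
    and assoc: "\<And>q. q \<in> Omega \<phi> \<Longrightarrow> associated_to \<phi> q (\<alpha> q) (P q)"
begin

definition supp :: "(int ^ 'd) set" where "supp = {x. \<phi> x \<noteq> 0}"

lemma supp: "finite supp" "\<And>x. x \<notin> supp \<Longrightarrow> \<phi> x = 0"
  using fin by (auto simp: supp_def finitely_supported_def)

abbreviation \<Phi> where "\<Phi> \<equiv> fourier \<phi>"

lemma \<Phi>_continuous: "continuous_on T \<Phi>"
  by (rule fourier_continuous[where a = \<phi>, OF supp])

text \<open>A representative of \<open>\<xi>\<close> modulo \<open>2 pi\<close> times the integer lattice, characterized by the property that is
  used.\<close>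

definition rep :: "real ^ 'd \<Rightarrow> real ^ 'd" where
  "rep \<xi> = (SOME \<eta>. \<eta> \<in> torus \<and> (\<forall>\<zeta>. \<Phi> (\<xi> + \<zeta>) = \<Phi> (\<eta> + \<zeta>)))"

lemma rep: "rep \<xi> \<in> torus" "\<Phi> (\<xi> + \<zeta>) = \<Phi> (rep \<xi> + \<zeta>)"
proof -
  have "\<exists>\<eta>. \<eta> \<in> torus \<and> (\<forall>\<zeta>. \<Phi> (\<xi> + \<zeta>) = \<Phi> (\<eta> + \<zeta>))"
    using torus_representative[where a = \<phi>, OF supp] by blast
  then have "rep \<xi> \<in> torus \<and> (\<forall>\<zeta>. \<Phi> (\<xi> + \<zeta>) = \<Phi> (rep \<xi> + \<zeta>))"
    unfolding rep_def by (rule someI_ex)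
  then show "rep \<xi> \<in> torus" "\<Phi> (\<xi> + \<zeta>) = \<Phi> (rep \<xi> + \<zeta>)" by auto
qed

lemma \<Phi>_le_1: "cmod (\<Phi> \<xi>) \<le> 1"
proof -
  have "bdd_above ((\<lambda>\<xi>. cmod (\<Phi> \<xi>)) ` torus)"
  proof (rule bdd_aboveI2)
    fix \<xi>
    have "\<Phi> \<xi> = (\<Sum>x\<in>supp. \<phi> x * character x \<xi>)"
      by (rule fourier_finite[where a = \<phi>, OF supp])
    then show "cmod (\<Phi> \<xi>) \<le> (\<Sum>x\<in>supp. cmod (\<phi> x))"
      by (simp only:) (rule sum_norm_le, simp add: norm_mult)
  qed
  then have "cmod (\<Phi> (rep \<xi>)) \<le> 1"
    unfolding sup[symmetric] by (intro cSUP_upper rep)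
  then show ?thesis using rep(2)[of \<xi> 0] by simp
qed

lemma rep_in_Omega: "cmod (\<Phi> z) = 1 \<Longrightarrow> rep z \<in> Omega \<phi>"
  using rep(1)[of z] rep(2)[of z 0] by (simp add: Omega_def)

lemma torus_subset_cube: "torus \<subseteq> cube"
  by (auto simp: torus_def cube_def mem_box_cart less_imp_le)

lemma Omega_nonempty: "Omega \<phi> \<noteq> {}"
proof -
  have "(0 :: real ^ 'd) \<in> torus" by (simp add: torus_def)
  then have ne: "(torus :: (real ^ 'd) set) \<noteq> {}" by blast
  then have "(cube :: (real ^ 'd) set) \<noteq> {}" using torus_subset_cube by blast
  moreover have "compact (cube :: (real ^ 'd) set)" by (simp add: cube_def)
  ultimately obtain z where z: "z \<in> cube" "\<And>\<xi>. \<xi> \<in> cube \<Longrightarrow> cmod (\<Phi> \<xi>) \<le> cmod (\<Phi> z)"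
    using continuous_attains_sup[of cube "\<lambda>\<xi>. cmod (\<Phi> \<xi>)"] continuous_on_norm[OF \<Phi>_continuous] by blast
  have "(SUP \<xi>\<in>torus. cmod (\<Phi> \<xi>)) \<le> cmod (\<Phi> z)"
    by (rule cSUP_least[OF ne]) (use z(2) torus_subset_cube in blast)
  with \<Phi>_le_1[of z] have "cmod (\<Phi> z) = 1" unfolding sup by simp
  then show ?thesis using rep_in_Omega by blast
qed

text \<open>The choice made by \<open>mu\<close>, which is therefore the trace of this matrix.\<close>

definition expo :: "real ^ 'd \<Rightarrow> real ^ 'd ^ 'd" where
  "expo q = (SOME E. E \<in> Exp_set (P q))"

lemma expo: "q \<in> Omega \<phi> \<Longrightarrow> expo q \<in> Exp_set (P q)"
  using assoc[of q] unfolding expo_def associated_to_def positive_homogeneous_polynomial_def positive_homogeneous_def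
  by (meson someI_ex)

lemma mu_eq: "mu (P q) = trace (expo q)"
  by (simp add: mu_def expo_def)

lemma \<Phi>_Omega: "q \<in> Omega \<phi> \<Longrightarrow> cmod (\<Phi> q) = 1"
  by (simp add: Omega_def)

definition W :: "real ^ 'd \<Rightarrow> real ^ 'd \<Rightarrow> complex" where
  "W q = (\<lambda>\<xi>. exp (- \<i> * of_real (\<alpha> q \<bullet> \<xi>)) * \<Phi> (q + \<xi>) / \<Phi> q)"

definition expansion_at :: "real ^ 'd \<Rightarrow> real \<Rightarrow> bool" where
  "expansion_at q \<delta> \<longleftrightarrow>
    local_expansion (P q) (expo q) supp (\<lambda>k. \<phi> k * character k q / \<Phi> q) (\<lambda>k. real_vec k - \<alpha> q) \<delta> (W q)"

definition radius :: "real ^ 'd \<Rightarrow> real" where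
  "radius q = (SOME \<delta>. \<delta> > 0 \<and> expansion_at q \<delta>)"

lemma radius:
  assumes "q \<in> Omega \<phi>"
  shows "radius q > 0" "expansion_at q (radius q)"
proof -
  have "\<exists>\<delta>>0. expansion_at q \<delta>"
    unfolding expansion_at_def W_def
    by (rule associated_local_expansion[where \<phi> = \<phi>, OF supp \<Phi>_Omega[OF assms] assoc[OF assms] expo[OF assms]])
  then have "radius q > 0 \<and> expansion_at q (radius q)"
    unfolding radius_def by (rule someI_ex)
  then show "radius q > 0" "expansion_at q (radius q)" by auto
qed

text \<open>At another point of modulus 1 nearby, the bound \<open>exp (- R / 2)\<close> would force \<open>R\<close> to vanish away from \<open>0\<close>.\<close>

lemma isolated:
  assumes q: "q \<in> Omega \<phi>" and "norm \<xi> \<le> radius q" "cmod (\<Phi> (q + \<xi>)) = 1"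
  shows "\<xi> = 0"
proof -
  interpret local_expansion "P q" "expo q" supp "\<lambda>k. \<phi> k * character k q / \<Phi> q" "\<lambda>k. real_vec k - \<alpha> q" "radius q" "W q"
    using radius(2)[OF q] by (simp add: expansion_at_def)
  have "cmod (W q \<xi>) = 1"
    using assms \<Phi>_Omega[OF q] by (simp add: W_def norm_mult norm_divide)
  then have "1 \<le> exp (- Re (P q \<xi>) / 2)"
    using W_decay[of \<xi>] assms by simp
  then have "Re (P q \<xi>) \<le> 0" by simp
  then show ?thesis using R_pos[of \<xi>] by linarith
qed

text \<open>The closed cube may contain several translates of a point of \<open>Omega \<phi>\<close> on its boundary, and
  the integral over the cube sees each of them.\<close>

definition peaks :: "(real ^ 'd) set" where
  "peaks = {z \<in> cube. cmod (\<Phi> z) = 1}"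

lemma finite_peaks: "finite peaks"
proof -
  let ?Z = "{z. cmod (\<Phi> z) = 1}"
  have "finite (cube \<inter> ?Z)"
  proof (rule finite_not_islimpt_in_compact)
    show "compact (cube :: (real ^ 'd) set)" by (simp add: cube_def)
    fix z
    show "\<not> z islimpt ?Z"
    proof
      assume lim: "z islimpt ?Z"
      have "closed ?Z"
        by (intro closed_Collect_eq continuous_on_norm \<Phi>_continuous continuous_on_const)
      then have z: "cmod (\<Phi> z) = 1" using lim closed_limpt by blast
      have q: "rep z \<in> Omega \<phi>" using rep_in_Omega[OF z] .
      obtain w where w: "w \<in> ?Z" "w \<noteq> z" "dist w z < radius (rep z)"
        using lim radius(1)[OF q] unfolding islimpt_approachable by blast
      have "w - z = 0"
      proof (rule isolated[OF q])
        show "norm (w - z) \<le> radius (rep z)" using w(3) by (simp add: dist_norm)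
        show "cmod (\<Phi> (rep z + (w - z))) = 1" using w(1) rep(2)[of z "w - z"] by simp
      qed
      with w(2) show False by simp
    qed
  qed
  then show ?thesis by (simp add: peaks_def Int_def)
qed

lemma Omega_subset_peaks: "Omega \<phi> \<subseteq> peaks"
  using torus_subset_cube by (auto simp: Omega_def peaks_def)

lemma finite_Omega: "finite (Omega \<phi>)"
  using finite_peaks Omega_subset_peaks by (rule finite_subset[rotated])

text \<open>The vector \<open>n^(-E*) (x - n \<alpha>)\<close>, for the exponent that defines \<open>mu\<close>.\<close>

definition scaled :: "nat \<Rightarrow> int ^ 'd \<Rightarrow> real ^ 'd \<Rightarrow> real ^ 'd" where
  "scaled n x q = transpose (matrix_powr (1 / real n) (expo q)) *v (real_vec x - real n *\<^sub>R \<alpha> q)"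

definition profile :: "nat \<Rightarrow> nat \<Rightarrow> int ^ 'd \<Rightarrow> real ^ 'd \<Rightarrow> real" where
  "profile N n x q = real n powr (- mu (P q)) / (1 + norm (scaled n x q)) ^ N"

lemma profile_pos: "n \<ge> 1 \<Longrightarrow> profile N n x q > 0"
  by (simp add: profile_def add_pos_nonneg)

lemma finite_convolution_power: "n \<ge> 1 \<Longrightarrow> finite {x. convolution_power \<phi> n x \<noteq> 0}"
  using convolution_power_support[where \<phi> = \<phi>, OF supp, of "\<Sum>x\<in>supp. norm (real_vec x)" n]
    member_le_sum[of _ supp "\<lambda>x. norm (real_vec x)"] supp(1) by auto

lemma fourier_power: "n \<ge> 1 \<Longrightarrow> fourier (convolution_power \<phi> n) \<xi> = \<Phi> \<xi> ^ n"
  by (rule fourier_convolution_power[where \<phi> = \<phi>, OF supp])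

lemma coefficient_le_1:
  assumes n: "n \<ge> 1"
  shows "cmod (convolution_power \<phi> n x) \<le> 1"
proof -
  let ?a = "convolution_power \<phi> n"
  have a: "finite {x. ?a x \<noteq> 0}"
    by (rule finite_convolution_power[OF n])
  have "ennreal ((2 * pi) ^ CARD('d) * cmod (?a x)) \<le> (\<integral>\<^sup>+\<xi>. ennreal (cmod (fourier ?a \<xi>)) * indicator cube \<xi> \<partial>lborel)"
    by (rule coefficient_le_integral[OF a]) auto
  also have "\<dots> \<le> (\<integral>\<^sup>+\<xi>. indicator cube \<xi> \<partial>(lborel :: (real ^ 'd) measure))"
  proof (intro nn_integral_mono)
    fix \<xi> :: "real ^ 'd"
    have "cmod (fourier ?a \<xi>) \<le> 1" unfolding fourier_power[OF n] norm_power using \<Phi>_le_1 by (intro power_le_one) auto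
    then have "ennreal (cmod (fourier ?a \<xi>)) \<le> 1" by (metis ennreal_1 ennreal_leI)
    then show "ennreal (cmod (fourier ?a \<xi>)) * indicator cube \<xi> \<le> indicator cube \<xi>"
      by (auto simp: indicator_def)
  qed
  also have "\<dots> = emeasure lborel (cube :: (real ^ 'd) set)" by (simp add: cube_def)
  also have "\<dots> = ennreal ((2 * pi) ^ CARD('d))" by (rule emeasure_cube)
  finally have "(2 * pi) ^ CARD('d) * cmod (?a x) \<le> (2 * pi) ^ CARD('d) * 1" by (simp add: ennreal_le_iff)
  then show ?thesis by (subst (asm) mult_le_cancel_left_pos) auto
qed

text \<open>Where the convolution power does not vanish, \<open>norm x = O(n)\<close>, so that the profile is bounded below by a power
  of \<open>1/n\<close>. It therefore absorbs every exponentially small error.\<close>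

lemma profile_lower_bound:
  obtains c L where "c > 0" "\<And>n x. n \<ge> 1 \<Longrightarrow> convolution_power \<phi> n x \<noteq> 0 \<Longrightarrow>
     c \<le> real n ^ L * (\<Sum>q\<in>Omega \<phi>. profile N n x q)"
proof -
  obtain q where q: "q \<in> Omega \<phi>" using Omega_nonempty by blast
  interpret local_expansion "P q" "expo q" supp "\<lambda>k. \<phi> k * character k q / \<Phi> q" "\<lambda>k. real_vec k - \<alpha> q" "radius q" "W q"
    using radius(2)[OF q] by (simp add: expansion_at_def)
  obtain K a where K: "K > 0" "a > 0"
    "\<And>t \<xi>. t \<ge> 1 \<Longrightarrow> norm (matrix_powr (1 / t) (expo q) *v \<xi>) \<le> K * t powr (- a) * norm \<xi>"
    by (rule contraction_rate) blast
  define B where "B = (\<Sum>x\<in>supp. norm (real_vec x))"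
  have B: "norm (real_vec x) \<le> B" if "x \<in> supp" for x
    unfolding B_def using member_le_sum[of x supp "\<lambda>x. norm (real_vec x)"] that supp(1) by simp
  have B0: "B \<ge> 0" by (simp add: B_def sum_nonneg)
  define D where "D = real CARD('d) ^ 2 * K * (B + norm (\<alpha> q))"
  have D: "D \<ge> 0" using K B0 by (simp add: D_def)
  define M where "M = nat \<lceil>\<bar>mu (P q)\<bar>\<rceil>"
  have M: "\<bar>mu (P q)\<bar> \<le> real M" unfolding M_def by linarith
  have "1 / (1 + D) ^ N \<le> real n ^ (M + N) * (\<Sum>q\<in>Omega \<phi>. profile N n x q)"
    if n: "n \<ge> 1" and x: "convolution_power \<phi> n x \<noteq> 0" for n x
  proof -
    have n1: "real n \<ge> 1" using n by simp
    have xn: "norm (real_vec x) \<le> real n * B"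
      using convolution_power_support[where \<phi> = \<phi>, OF supp B n] x by blast
    have entries: "\<bar>transpose (matrix_powr (1 / real n) (expo q)) $ i $ j\<bar> \<le> K" for i j
    proof -
      have "\<bar>(A n (axis i 1)) $ j\<bar> \<le> norm (A n (axis i 1))" by (rule component_le_norm_cart)
      also have "\<dots> \<le> K * real n powr (- a) * norm (axis i (1 :: real) :: real ^ 'd)" by (rule K(3)[OF n1])
      also have "\<dots> \<le> K * 1 * 1"
        using K n1 by (intro mult_mono) (auto simp: norm_axis_1 powr_le_one_le powr_minus_divide ge_one_powr_ge_zero)
      finally show ?thesis
        by (simp add: matrix_vector_mul_component inner_axis transpose_def)
    qed
    have "norm (scaled n x q) \<le> real CARD('d) ^ 2 * K * norm (real_vec x - real n *\<^sub>R \<alpha> q)"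
      unfolding scaled_def by (rule norm_matrix_vector_le_entry_bound[OF entries])
    also have "\<dots> \<le> real CARD('d) ^ 2 * K * (real n * B + real n * norm (\<alpha> q))"
      using K xn norm_triangle_ineq4[of "real_vec x" "real n *\<^sub>R \<alpha> q"] by (intro mult_left_mono) auto
    also have "\<dots> = real n * D" by (simp add: D_def algebra_simps)
    finally have "1 + norm (scaled n x q) \<le> real n * (1 + D)"
      using n1 by (simp add: distrib_left)
    then have "(1 + norm (scaled n x q)) ^ N \<le> real n ^ N * (1 + D) ^ N"
      unfolding power_mult_distrib[symmetric] by (intro power_mono) auto
    moreover have mM: "1 \<le> real n ^ M * real n powr (- mu (P q))"
    proof -
      have "1 \<le> real n powr (real M - mu (P q))"
        using n1 M by (intro ge_one_powr_ge_zero) auto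
      then show ?thesis using n1 by (simp add: powr_diff powr_realpow powr_minus_divide)
    qed
    moreover have pos: "0 < (1 + norm (scaled n x q)) ^ N" by (intro zero_less_power add_pos_nonneg) auto
    ultimately have "(1 + norm (scaled n x q)) ^ N * 1 \<le> (real n ^ N * (1 + D) ^ N) * (real n ^ M * real n powr (- mu (P q)))"
      by (intro mult_mono) auto
    then have "1 / (1 + D) ^ N \<le> real n ^ (M + N) * profile N n x q"
      using pos D by (simp add: profile_def divide_simps power_add mult_ac)
    also have "\<dots> \<le> real n ^ (M + N) * (\<Sum>q\<in>Omega \<phi>. profile N n x q)"
      using q finite_Omega profile_pos[OF n] by (intro mult_left_mono member_le_sum) (auto simp: less_imp_le)
    finally show ?thesis .
  qed
  moreover have "1 / (1 + D) ^ N > 0" using D by simp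
  ultimately show ?thesis using that by blast
qed

end

section \<open>Simultaneous twists and the global estimate\<close>

lemma ball_integral_mono: "\<rho> \<le> \<rho>' \<Longrightarrow> ball_integral a z \<rho> \<le> ball_integral a z \<rho>'"
  unfolding ball_integral_def by (intro nn_integral_mono) (auto simp: indicator_def)

context normalized_symbol
begin

definition contract :: "nat \<Rightarrow> real ^ 'd \<Rightarrow> real ^ 'd \<Rightarrow> real ^ 'd" where
  "contract n q u = matrix_powr (1 / real n) (expo q) *v u"

lemma near_bound:
  assumes q: "q \<in> Omega \<phi>"
  shows "\<exists>C>0. \<exists>n0\<ge>1. \<forall>n\<ge>n0. \<forall>u \<tau> z. norm u = 1 \<longrightarrow> 0 \<le> \<tau> \<longrightarrow> \<tau> \<le> pi \<longrightarrow> (\<forall>\<zeta>. \<Phi> (z + \<zeta>) = \<Phi> (q + \<zeta>)) \<longrightarrow>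
     ball_integral ((twist (\<tau> *\<^sub>R contract n q u) (\<tau> * (real n * (\<alpha> q \<bullet> contract n q u))) ^^ N) (convolution_power \<phi> n))
       z (radius q / 2) \<le> ennreal (C * \<tau> ^ N * real n powr (- mu (P q)))"
proof -
  interpret local_expansion "P q" "expo q" supp "\<lambda>k. \<phi> k * character k q / \<Phi> q" "\<lambda>k. real_vec k - \<alpha> q" "radius q" "W q"
    using radius(2)[OF q] by (simp add: expansion_at_def)
  obtain C n0 where C: "C > 0" "n0 \<ge> 1"
    "\<And>n u \<tau> a T z \<kappa> \<alpha>. n \<ge> n0 \<Longrightarrow> norm u = 1 \<Longrightarrow> 0 \<le> \<tau> \<Longrightarrow> \<tau> \<le> pi \<Longrightarrow> finite T \<Longrightarrow> (\<And>x. x \<notin> T \<Longrightarrow> a x = 0) \<Longrightarrow>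
      cmod \<kappa> = 1 \<Longrightarrow> (\<And>\<xi>. fourier a (z + \<xi>) = \<kappa> * exp (\<i> * of_real (real n * (\<alpha> \<bullet> \<xi>))) * W q \<xi> ^ n) \<Longrightarrow>
      ball_integral ((twist (\<tau> *\<^sub>R A n u) (\<tau> * (real n * (\<alpha> \<bullet> A n u))) ^^ N) a) z (radius q / 2)
        \<le> ennreal (C * \<tau> ^ N * real n powr (- trace (expo q)))"
    by (rule ball_integral_bound[where N = N]) blast
  have "ball_integral ((twist (\<tau> *\<^sub>R contract n q u) (\<tau> * (real n * (\<alpha> q \<bullet> contract n q u))) ^^ N) (convolution_power \<phi> n))
       z (radius q / 2) \<le> ennreal (C * \<tau> ^ N * real n powr (- mu (P q)))"
    if n: "n \<ge> n0" and u: "norm u = 1" and \<tau>: "0 \<le> \<tau>" "\<tau> \<le> pi" and z: "\<And>\<zeta>. \<Phi> (z + \<zeta>) = \<Phi> (q + \<zeta>)" for n u \<tau> z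
    unfolding mu_eq contract_def
  proof (rule C(3)[where T = "{x. convolution_power \<phi> n x \<noteq> 0}" and \<kappa> = "\<Phi> q ^ n"])
    have n1: "n \<ge> 1" using n C by simp
    show "finite {x. convolution_power \<phi> n x \<noteq> 0}"
      by (rule finite_convolution_power[OF n1])
    show "cmod (\<Phi> q ^ n) = 1" by (simp add: norm_power \<Phi>_Omega[OF q])
    fix \<xi>
    have nz: "\<Phi> q \<noteq> 0" using \<Phi>_Omega[OF q] by auto
    have "fourier (convolution_power \<phi> n) (z + \<xi>) = \<Phi> (z + \<xi>) ^ n"
      by (rule fourier_power[OF n1])
    also have "\<Phi> (z + \<xi>) = \<Phi> q * exp (\<i> * of_real (\<alpha> q \<bullet> \<xi>)) * W q \<xi>"
      using nz by (simp add: z W_def exp_minus)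
    also have "(\<Phi> q * exp (\<i> * of_real (\<alpha> q \<bullet> \<xi>)) * W q \<xi>) ^ n
        = \<Phi> q ^ n * exp (\<i> * of_real (real n * (\<alpha> q \<bullet> \<xi>))) * W q \<xi> ^ n"
      by (simp add: power_mult_distrib exp_of_nat_mult[symmetric] mult_ac)
    finally show "fourier (convolution_power \<phi> n) (z + \<xi>) = \<Phi> q ^ n * exp (\<i> * of_real (real n * (\<alpha> q \<bullet> \<xi>))) * W q \<xi> ^ n" .
  qed (use n u \<tau> in auto)
  then show ?thesis using C(1,2) by blast
qed

lemma contract_small:
  assumes q: "q \<in> Omega \<phi>" and e: "e > 0"
  shows "\<exists>n0. \<forall>n\<ge>n0. \<forall>u. norm (contract n q u) \<le> e * norm u"
proof -
  interpret local_expansion "P q" "expo q" supp "\<lambda>k. \<phi> k * character k q / \<Phi> q" "\<lambda>k. real_vec k - \<alpha> q" "radius q" "W q"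
    using radius(2)[OF q] by (simp add: expansion_at_def)
  show ?thesis unfolding contract_def by (rule A_small[OF e]) blast
qed

definition far :: "(real ^ 'd) set" where
  "far = cube - (\<Union>z\<in>peaks. ball z (radius (rep z) / 4))"

lemma symbol_small_far:
  "\<exists>d>0. \<exists>\<rho>. 0 < \<rho> \<and> \<rho> < 1 \<and> (\<forall>\<xi>\<in>far. \<forall>\<xi>'. dist \<xi> \<xi>' \<le> d \<longrightarrow> cmod (\<Phi> \<xi>') \<le> \<rho>)"
proof (cases "far = {}")
  case True
  then show ?thesis by (intro exI[of _ 1] conjI exI[of _ "1 / 2"]) auto
next
  case False
  have compact: "compact far"
    unfolding far_def by (intro compact_diff open_UN) (auto simp: cube_def)
  obtain \<xi>1 where \<xi>1: "\<xi>1 \<in> far" "\<And>\<xi>. \<xi> \<in> far \<Longrightarrow> cmod (\<Phi> \<xi>) \<le> cmod (\<Phi> \<xi>1)"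
    using continuous_attains_sup[OF compact False continuous_on_norm[OF \<Phi>_continuous]] by blast
  define M where "M = cmod (\<Phi> \<xi>1)"
  have "M \<noteq> 1"
  proof
    assume "M = 1"
    then have "\<xi>1 \<in> peaks" using \<xi>1(1) by (auto simp: M_def peaks_def far_def)
    moreover have "radius (rep \<xi>1) > 0"
      using \<open>M = 1\<close> by (intro radius rep_in_Omega) (simp add: M_def)
    ultimately show False using \<xi>1(1) by (force simp: far_def)
  qed
  then have M: "0 \<le> M" "M < 1" using \<Phi>_le_1[of \<xi>1] by (auto simp: M_def)
  obtain B where B: "\<And>\<xi>. \<xi> \<in> far \<Longrightarrow> norm \<xi> \<le> B"
    using compact_imp_bounded[OF compact] by (auto simp: bounded_iff)
  have "uniformly_continuous_on (cball 0 (B + 1)) \<Phi>"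
    by (intro compact_uniformly_continuous \<Phi>_continuous compact_cball)
  then obtain d where d: "d > 0" "\<And>\<xi> \<xi>'. \<xi> \<in> cball 0 (B + 1) \<Longrightarrow> \<xi>' \<in> cball 0 (B + 1) \<Longrightarrow> dist \<xi>' \<xi> < d \<Longrightarrow> dist (\<Phi> \<xi>') (\<Phi> \<xi>) < (1 - M) / 2"
    using M(2) unfolding uniformly_continuous_on_def by (metis diff_gt_0_iff_gt half_gt_zero)
  have "cmod (\<Phi> \<xi>') \<le> (1 + M) / 2" if \<xi>: "\<xi> \<in> far" and dd: "dist \<xi> \<xi>' \<le> min 1 (d / 2)" for \<xi> \<xi>'
  proof -
    have "norm \<xi>' \<le> norm \<xi> + dist \<xi> \<xi>'"
      using norm_triangle_ineq4[of \<xi> "\<xi> - \<xi>'"] by (simp add: dist_norm)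
    then have "\<xi>' \<in> cball 0 (B + 1)" "\<xi> \<in> cball 0 (B + 1)" using B[OF \<xi>] dd by auto
    moreover have "dist \<xi>' \<xi> < d" using dd d(1) by (simp add: dist_commute)
    ultimately have "cmod (\<Phi> \<xi>' - \<Phi> \<xi>) < (1 - M) / 2" using d(2) by (simp add: dist_norm)
    moreover have "cmod (\<Phi> \<xi>) \<le> M" using \<xi>1(2)[OF \<xi>] by (simp add: M_def)
    ultimately show ?thesis
      using norm_triangle_sub[of "\<Phi> \<xi>'" "\<Phi> \<xi>"] by (simp add: field_simps)
  qed
  then show ?thesis using M d(1)
    by (intro exI[of _ "min 1 (d / 2)"] conjI exI[of _ "(1 + M) / 2"]) auto
qed

text \<open>For \<open>y = scaled n x q\<close> the step is \<open>h = n^(-E) (pi y / norm y ^ 2)\<close>. It satisfies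
  \<open>(x - n \<alpha>) \<bullet> h = pi\<close>, so the multiplier of the twist takes the value \<open>-2\<close> at \<open>x\<close>, while in the rescaled
  variable the step has the length \<open>pi / norm y\<close>.\<close>

definition step_length :: "nat \<Rightarrow> int ^ 'd \<Rightarrow> real ^ 'd \<Rightarrow> real" where
  "step_length n x q = pi / norm (scaled n x q)"

definition direction :: "nat \<Rightarrow> int ^ 'd \<Rightarrow> real ^ 'd \<Rightarrow> real ^ 'd" where
  "direction n x q = contract n q (scaled n x q /\<^sub>R norm (scaled n x q))"

definition step :: "nat \<Rightarrow> int ^ 'd \<Rightarrow> real ^ 'd \<Rightarrow> real ^ 'd" where
  "step n x q = step_length n x q *\<^sub>R direction n x q"

definition phase :: "nat \<Rightarrow> int ^ 'd \<Rightarrow> real ^ 'd \<Rightarrow> real" where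
  "phase n x q = step_length n x q * (real n * (\<alpha> q \<bullet> direction n x q))"

lemma step_phase:
  assumes "scaled n x q \<noteq> 0"
  shows "real_vec x \<bullet> step n x q - phase n x q = pi"
proof -
  let ?y = "scaled n x q"
  have "real_vec x \<bullet> step n x q - phase n x q = step_length n x q * ((real_vec x - real n *\<^sub>R \<alpha> q) \<bullet> direction n x q)"
    by (simp add: step_def phase_def inner_diff_left algebra_simps)
  also have "(real_vec x - real n *\<^sub>R \<alpha> q) \<bullet> direction n x q = ?y \<bullet> (?y /\<^sub>R norm ?y)"
    unfolding direction_def contract_def
    by (simp add: scaled_def dot_lmul_matrix[symmetric] transpose_matrix_vector)
  also have "\<dots> = norm ?y"
    using assms by (simp add: power2_norm_eq_inner[symmetric] power2_eq_square)
  finally show ?thesis using assms by (simp add: step_length_def)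
qed

text \<open>Twists are performed only for those \<open>q\<close> for which decay has to be gained; there the steps are at most
  \<open>pi\<close> in the rescaled variable.\<close>

definition shifted :: "nat \<Rightarrow> int ^ 'd \<Rightarrow> (real ^ 'd) set" where
  "shifted n x = {q \<in> Omega \<phi>. norm (scaled n x q) \<ge> 1}"

lemma shifted: "finite (shifted n x)" "shifted n x \<subseteq> Omega \<phi>" "card (shifted n x) \<le> card (Omega \<phi>)"
  using finite_Omega by (auto simp: shifted_def intro: card_mono)

lemma twists_at_x:
  "cmod (convolution_power \<phi> n x) \<le> cmod (twists (step n x) (phase n x) N (shifted n x) (convolution_power \<phi> n) x)"
proof -
  have "exp (\<i> * complex_of_real (real_vec x \<bullet> step n x q - phase n x q)) - 1 = - 2" if "q \<in> shifted n x" for q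
  proof -
    have "scaled n x q \<noteq> 0" using that by (auto simp: shifted_def)
    then show ?thesis by (simp add: step_phase mult.commute)
  qed
  then have "(\<Prod>q\<in>shifted n x. (exp (\<i> * complex_of_real (real_vec x \<bullet> step n x q - phase n x q)) - 1) ^ N)
      = (\<Prod>q\<in>shifted n x. (- 2) ^ N)"
    by (intro prod.cong refl) (simp only:)
  then have "twists (step n x) (phase n x) N (shifted n x) (convolution_power \<phi> n) x
      = ((- 2) ^ N) ^ card (shifted n x) * convolution_power \<phi> n x"
    by (simp add: twists_def)
  then have "cmod (twists (step n x) (phase n x) N (shifted n x) (convolution_power \<phi> n) x)
      = (2 ^ N) ^ card (shifted n x) * cmod (convolution_power \<phi> n x)"
    by (simp add: norm_mult norm_power)
  moreover have "1 * cmod (convolution_power \<phi> n x) \<le> (2 ^ N) ^ card (shifted n x) * cmod (convolution_power \<phi> n x)"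
    by (intro mult_right_mono one_le_power) auto
  ultimately show ?thesis by simp
qed

lemma shifted_step:
  assumes "q \<in> shifted n x"
  shows "norm (scaled n x q /\<^sub>R norm (scaled n x q)) = 1"
    and "0 \<le> step_length n x q" "step_length n x q \<le> pi"
    and "(\<And>u. norm (contract n q u) \<le> r / pi * norm u) \<Longrightarrow> norm (step n x q) \<le> r"
proof -
  have y: "norm (scaled n x q) \<ge> 1" using assms by (simp add: shifted_def)
  then have "norm (scaled n x q) \<noteq> 0" by linarith
  then show u: "norm (scaled n x q /\<^sub>R norm (scaled n x q)) = 1" by simp
  show l: "0 \<le> step_length n x q" "step_length n x q \<le> pi"
    using y by (auto simp: step_length_def divide_simps)
  assume small: "\<And>u. norm (contract n q u) \<le> r / pi * norm u"
  have "norm (direction n x q) \<le> r / pi * 1"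
    unfolding direction_def u[symmetric] by (rule small)
  then have "step_length n x q * norm (direction n x q) \<le> pi * (r / pi)"
    using l by (intro mult_mono) auto
  then show "norm (step n x q) \<le> r" using l by (simp add: step_def)
qed

text \<open>A difference of order \<open>N\<close> with step \<open>pi / norm y\<close> gains the factor \<open>(pi / norm y) ^ N\<close>, which for
  \<open>norm y \<ge> 1\<close> is comparable with \<open>(1 + norm y) ^ (-N)\<close>. For \<open>norm y < 1\<close> there is nothing to gain.\<close>

lemma near_profile:
  assumes q: "q \<in> Omega \<phi>"
  shows "\<exists>C>0. \<exists>n0\<ge>1. \<forall>n\<ge>n0. \<forall>x z. (\<forall>\<zeta>. \<Phi> (z + \<zeta>) = \<Phi> (q + \<zeta>)) \<longrightarrow>
    ball_integral (if q \<in> shifted n x then (twist (step n x q) (phase n x q) ^^ N) (convolution_power \<phi> n)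
      else convolution_power \<phi> n) z (radius q / 2) \<le> ennreal (C * profile N n x q)"
proof -
  obtain C0 n0 where C0: "C0 > 0" "n0 \<ge> 1"
    "\<And>n u \<tau> z. n \<ge> n0 \<Longrightarrow> norm u = 1 \<Longrightarrow> 0 \<le> \<tau> \<Longrightarrow> \<tau> \<le> pi \<Longrightarrow> (\<forall>\<zeta>. \<Phi> (z + \<zeta>) = \<Phi> (q + \<zeta>)) \<Longrightarrow>
     ball_integral ((twist (\<tau> *\<^sub>R contract n q u) (\<tau> * (real n * (\<alpha> q \<bullet> contract n q u))) ^^ 0) (convolution_power \<phi> n))
       z (radius q / 2) \<le> ennreal (C0 * \<tau> ^ 0 * real n powr (- mu (P q)))"
    using near_bound[OF q, where N = 0] by blast
  obtain C1 n1 where C1: "C1 > 0" "n1 \<ge> 1"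
    "\<And>n u \<tau> z. n \<ge> n1 \<Longrightarrow> norm u = 1 \<Longrightarrow> 0 \<le> \<tau> \<Longrightarrow> \<tau> \<le> pi \<Longrightarrow> (\<forall>\<zeta>. \<Phi> (z + \<zeta>) = \<Phi> (q + \<zeta>)) \<Longrightarrow>
     ball_integral ((twist (\<tau> *\<^sub>R contract n q u) (\<tau> * (real n * (\<alpha> q \<bullet> contract n q u))) ^^ N) (convolution_power \<phi> n))
       z (radius q / 2) \<le> ennreal (C1 * \<tau> ^ N * real n powr (- mu (P q)))"
    using near_bound[OF q, where N = N] by blast
  have "ball_integral (if q \<in> shifted n x then (twist (step n x q) (phase n x q) ^^ N) (convolution_power \<phi> n)
      else convolution_power \<phi> n) z (radius q / 2) \<le> ennreal ((2 * pi) ^ N * (C0 + C1) * profile N n x q)"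
    if n: "n \<ge> max n0 n1" and zq: "\<forall>\<zeta>. \<Phi> (z + \<zeta>) = \<Phi> (q + \<zeta>)" for n x z
  proof -
    let ?y = "norm (scaled n x q)" and ?t = "step_length n x q" and ?\<mu> = "real n powr (- mu (P q))"
    have pw: "(1 + ?y) ^ N > 0" by (intro zero_less_power add_pos_nonneg) auto
    have to_profile: "C * s * ?\<mu> \<le> (2 * pi) ^ N * (C0 + C1) * profile N n x q"
      if "0 < C" "C \<le> C0 + C1" "0 \<le> s" "s \<le> (2 * pi) ^ N * (1 / (1 + ?y) ^ N)" for C s
    proof -
      have "C * s * ?\<mu> \<le> (C0 + C1) * ((2 * pi) ^ N * (1 / (1 + ?y) ^ N)) * ?\<mu>"
        using that by (intro mult_right_mono mult_mono) auto
      then show ?thesis by (simp add: profile_def mult_ac)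
    qed
    show ?thesis
    proof (cases "q \<in> shifted n x")
      case True
      have "ball_integral ((twist (step n x q) (phase n x q) ^^ N) (convolution_power \<phi> n)) z (radius q / 2)
          \<le> ennreal (C1 * ?t ^ N * ?\<mu>)"
        unfolding step_def phase_def direction_def
        using n by (intro C1(3) zq shifted_step[OF True]) auto
      also have "\<dots> \<le> ennreal ((2 * pi) ^ N * (C0 + C1) * profile N n x q)"
      proof (intro ennreal_leI to_profile)
        have y: "?y \<ge> 1" using True by (simp add: shifted_def)
        then have "(1 + ?y) ^ N \<le> (2 * ?y) ^ N" by (intro power_mono) auto
        then have "1 / ?y ^ N \<le> 2 ^ N / (1 + ?y) ^ N"
          using y pw by (simp add: power_mult_distrib divide_simps)
        then have "pi ^ N * (1 / ?y ^ N) \<le> pi ^ N * (2 ^ N / (1 + ?y) ^ N)" by (intro mult_left_mono) auto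
        then show "?t ^ N \<le> (2 * pi) ^ N * (1 / (1 + ?y) ^ N)"
          by (simp add: step_length_def power_divide power_mult_distrib mult_ac)
      qed (use C0(1) C1(1) shifted_step(2)[OF True] in auto)
      finally show ?thesis using True by simp
    next
      case False
      have "ball_integral (convolution_power \<phi> n) z (radius q / 2) \<le> ennreal (C0 * 1 * ?\<mu>)"
        using C0(3)[of n "axis undefined 1" 0 z] n zq by (simp add: norm_axis_1)
      also have "\<dots> \<le> ennreal ((2 * pi) ^ N * (C0 + C1) * profile N n x q)"
      proof (intro ennreal_leI to_profile)
        have "?y < 1" using False q by (simp add: shifted_def)
        then have "(1 + ?y) ^ N \<le> (2 * pi) ^ N" using pi_gt3 by (intro power_mono) auto
        then show "1 \<le> (2 * pi) ^ N * (1 / (1 + ?y) ^ N)" using pw by (simp add: divide_simps)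
      qed (use C0(1) C1(1) in auto)
      finally show ?thesis using False by simp
    qed
  qed
  moreover have "(2 * pi) ^ N * (C0 + C1) > 0" using C0(1) C1(1) by simp
  moreover have "max n0 n1 \<ge> 1" using C0(2) by simp
  ultimately show ?thesis by blast
qed

abbreviation all_twists :: "nat \<Rightarrow> nat \<Rightarrow> int ^ 'd \<Rightarrow> int ^ 'd \<Rightarrow> complex" where
  "all_twists N n x \<equiv> twists (step n x) (phase n x) N (shifted n x) (convolution_power \<phi> n)"

lemma real_card_shifted_le: "0 \<le> r \<Longrightarrow> k \<le> card (Omega \<phi>) \<Longrightarrow> real (N * k) * r \<le> real (N * card (Omega \<phi>)) * r"
  by (intro mult_right_mono of_nat_mono mult_le_mono2)

text \<open>The twist belonging to \<open>q\<close> is performed first and the local estimate applies to it; the remaining ones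
  cost a constant and a small enlargement of the ball.\<close>

lemma ball_integral_all_twists:
  assumes n: "n \<ge> 1" and step_le: "\<And>p. p \<in> shifted n x \<Longrightarrow> norm (step n x p) \<le> r" and r: "r \<ge> 0"
    and \<rho>: "\<rho> + real (N * card (Omega \<phi>)) * r \<le> \<rho>'"
    and B: "ball_integral (if q \<in> shifted n x then (twist (step n x q) (phase n x q) ^^ N) (convolution_power \<phi> n)
      else convolution_power \<phi> n) z \<rho>' \<le> ennreal B"
  shows "ball_integral (all_twists N n x) z \<rho> \<le> ennreal (2 ^ (N * card (Omega \<phi>)) * B)"
proof -
  define b where "b = (if q \<in> shifted n x then (twist (step n x q) (phase n x q) ^^ N) (convolution_power \<phi> n)
      else convolution_power \<phi> n)"
  define Q where "Q = shifted n x - {q}"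
  have b: "all_twists N n x = twists (step n x) (phase n x) N Q b"
    using twists_remove[OF shifted(1), of q n x] by (auto simp: b_def Q_def)
  have Q: "finite Q" "card Q \<le> card (Omega \<phi>)" "\<And>p. p \<in> Q \<Longrightarrow> norm (step n x p) \<le> r"
    using shifted step_le by (auto simp: Q_def intro: order_trans[OF card_Diff1_le])
  have b0: "b y = 0" if "y \<notin> {y. convolution_power \<phi> n y \<noteq> 0}" for y
    using that by (simp add: b_def twist_funpow)
  have "ball_integral (all_twists N n x) z \<rho> \<le> 2 ^ (N * card Q) * ball_integral b z (\<rho> + real (N * card Q) * r)"
    unfolding b by (rule ball_integral_twists[where a = b, OF finite_convolution_power[OF n] b0 Q(1,3)])
  also have "\<dots> \<le> 2 ^ (N * card (Omega \<phi>)) * ennreal B"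
  proof (intro mult_mono power_increasing)
    have "\<rho> + real (N * card Q) * r \<le> \<rho>'" using real_card_shifted_le[OF r Q(2), of N] \<rho> by linarith
    from ball_integral_mono[OF this] show "ball_integral b z (\<rho> + real (N * card Q) * r) \<le> ennreal B"
      using B unfolding b_def by (rule order_trans)
  qed (use Q(2) in auto)
  also have "\<dots> = ennreal (2 ^ (N * card (Omega \<phi>)) * B)"
    by (simp add: ennreal_mult' ennreal_power[symmetric])
  finally show ?thesis .
qed

lemma all_twists_far:
  assumes n: "n \<ge> 1" and step_le: "\<And>p. p \<in> shifted n x \<Longrightarrow> norm (step n x p) \<le> r" and r: "r \<ge> 0"
    and \<rho>: "\<rho> \<ge> 0" "\<And>\<xi>'. dist \<xi> \<xi>' \<le> real (N * card (Omega \<phi>)) * r \<Longrightarrow> cmod (\<Phi> \<xi>') \<le> \<rho>"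
  shows "cmod (fourier (all_twists N n x) \<xi>) \<le> 2 ^ (N * card (Omega \<phi>)) * \<rho> ^ n"
proof -
  have a0: "convolution_power \<phi> n y = 0" if "y \<notin> {y. convolution_power \<phi> n y \<noteq> 0}" for y using that by simp
  have "cmod (fourier (all_twists N n x) \<xi>) \<le> 2 ^ (N * card (shifted n x)) * \<rho> ^ n"
  proof (rule sup_bound_twists[where a = "convolution_power \<phi> n" and \<rho> = 0 and r = r and \<xi> = \<xi>,
        OF finite_convolution_power[OF n] a0 shifted(1) step_le])
    fix \<xi>' assume "dist \<xi> \<xi>' \<le> 0 + real (N * card (shifted n x)) * r"
    then have "cmod (\<Phi> \<xi>') \<le> \<rho>" using real_card_shifted_le[OF r shifted(3), of N n x] by (intro \<rho>(2)) linarith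
    then show "cmod (fourier (convolution_power \<phi> n) \<xi>') \<le> \<rho> ^ n"
      by (simp add: fourier_power[OF n] norm_power power_mono)
  qed auto
  also have "\<dots> \<le> 2 ^ (N * card (Omega \<phi>)) * \<rho> ^ n"
    using shifted(3)[of n x] \<rho>(1) by (intro mult_right_mono power_increasing) auto
  finally show ?thesis .
qed

lemma coefficient_le_near_plus_far:
  assumes b: "finite T" "\<And>y. y \<notin> T \<Longrightarrow> b y = 0"
    and near: "\<And>z. z \<in> peaks \<Longrightarrow> ball_integral b z (radius (rep z) / 4) \<le> ennreal (S z)" "\<And>z. z \<in> peaks \<Longrightarrow> S z \<ge> 0"
    and far: "\<And>\<xi>. \<xi> \<in> far \<Longrightarrow> cmod (fourier b \<xi>) \<le> B" "B \<ge> 0"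
  shows "cmod (b x) \<le> (\<Sum>z\<in>peaks. S z) + B"
proof -
  have [measurable]: "fourier b \<in> borel_measurable borel"
    by (rule fourier_measurable[where a = b, OF b])
  have cover: "ennreal (cmod (fourier b \<xi>)) * indicator cube \<xi>
      \<le> (\<Sum>z\<in>peaks. ennreal (cmod (fourier b \<xi>)) * indicator (ball z (radius (rep z) / 4)) \<xi>)
        + ennreal B * indicator cube \<xi>" for \<xi>
  proof (cases "\<xi> \<in> cube")
    case True
    show ?thesis
    proof (cases "\<xi> \<in> far")
      case True
      then have "ennreal (cmod (fourier b \<xi>)) * indicator cube \<xi> \<le> ennreal B * indicator cube \<xi>"
        using far by (intro mult_right_mono ennreal_leI) auto
      then show ?thesis by (rule add_increasing[OF zero_le])
    next
      case False
      then obtain z where z: "z \<in> peaks" "\<xi> \<in> ball z (radius (rep z) / 4)"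
        using True by (auto simp: far_def)
      have "ennreal (cmod (fourier b \<xi>)) * indicator cube \<xi> = ennreal (cmod (fourier b \<xi>)) * indicator (ball z (radius (rep z) / 4)) \<xi>"
        using z True by (simp add: indicator_def)
      also have "\<dots> \<le> (\<Sum>z\<in>peaks. ennreal (cmod (fourier b \<xi>)) * indicator (ball z (radius (rep z) / 4)) \<xi>)"
        using z(1) finite_peaks by (intro member_le_sum) auto
      finally show ?thesis by (rule add_increasing2[rotated]) simp
    qed
  qed simp
  have "ennreal ((2 * pi) ^ CARD('d) * cmod (b x)) \<le> (\<integral>\<^sup>+\<xi>. ennreal (cmod (fourier b \<xi>)) * indicator cube \<xi> \<partial>lborel)"
    by (rule coefficient_le_integral[where a = b, OF b])
  also have "\<dots> \<le> (\<integral>\<^sup>+\<xi>. (\<Sum>z\<in>peaks. ennreal (cmod (fourier b \<xi>)) * indicator (ball z (radius (rep z) / 4)) \<xi>)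
        + ennreal B * indicator cube \<xi> \<partial>lborel)"
    by (intro nn_integral_mono cover)
  also have "\<dots> = (\<Sum>z\<in>peaks. ball_integral b z (radius (rep z) / 4)) + ennreal B * emeasure lborel (cube :: (real ^ 'd) set)"
  proof -
    have [measurable]: "(cube :: (real ^ 'd) set) \<in> sets borel" by (simp add: cube_def)
    have [measurable]: "ball z s \<in> sets borel" for z :: "real ^ 'd" and s by simp
    have m: "(\<lambda>\<xi>. ennreal (cmod (fourier b \<xi>)) * indicator (ball z s) \<xi>) \<in> borel_measurable lborel" for z s
      by measurable
    show ?thesis
      unfolding ball_integral_def
      by (subst nn_integral_add) (auto simp: nn_integral_sum[OF m] nn_integral_cmult_indicator intro!: borel_measurable_sum m)
  qed
  also have "\<dots> \<le> (\<Sum>z\<in>peaks. ennreal (S z)) + ennreal B * ennreal ((2 * pi) ^ CARD('d))"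
    unfolding emeasure_cube by (intro add_mono sum_mono near(1) order_refl)
  also have "\<dots> = ennreal ((\<Sum>z\<in>peaks. S z) + B * (2 * pi) ^ CARD('d))"
    using near(2) far(2) by (simp add: ennreal_mult[symmetric] sum_nonneg)
  finally have "(2 * pi) ^ CARD('d) * cmod (b x) \<le> (\<Sum>z\<in>peaks. S z) + B * (2 * pi) ^ CARD('d)"
    using near(2) far(2) by (subst (asm) ennreal_le_iff) (auto intro!: add_nonneg_nonneg sum_nonneg)
  also have "\<dots> \<le> (2 * pi) ^ CARD('d) * ((\<Sum>z\<in>peaks. S z) + B)"
  proof -
    have "1 \<le> (2 * pi) ^ CARD('d)" using pi_gt3 by (intro one_le_power) auto
    then have "1 * (\<Sum>z\<in>peaks. S z) \<le> (2 * pi) ^ CARD('d) * (\<Sum>z\<in>peaks. S z)"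
      using near(2) by (intro mult_right_mono sum_nonneg)
    then show ?thesis
      by (simp only: mult_1 distrib_left mult.commute[of B] add_le_cancel_right)
  qed
  finally show ?thesis by (subst (asm) mult_le_cancel_left_pos) auto
qed

text \<open>All twists are applied simultaneously, which can only enlarge the coefficient at \<open>x\<close>. Near the points
  of modulus one the profile appears; elsewhere the integrand is exponentially small in \<open>n\<close>, which the
  profile absorbs.\<close>

lemma convolution_power_bound:
  "\<exists>C>0. \<forall>n\<ge>1. \<forall>x. cmod (convolution_power \<phi> n x) \<le> C * (\<Sum>q\<in>Omega \<phi>. profile N n x q)"
proof -
  let ?m = "N * card (Omega \<phi>)"
  obtain C0 n1 where C0: "\<And>q. q \<in> Omega \<phi> \<Longrightarrow> C0 q > 0"
    "\<And>q n x z. q \<in> Omega \<phi> \<Longrightarrow> n \<ge> n1 q \<Longrightarrow> (\<forall>\<zeta>. \<Phi> (z + \<zeta>) = \<Phi> (q + \<zeta>)) \<Longrightarrow>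
      ball_integral (if q \<in> shifted n x then (twist (step n x q) (phase n x q) ^^ N) (convolution_power \<phi> n)
        else convolution_power \<phi> n) z (radius q / 2) \<le> ennreal (C0 q * profile N n x q)"
    using near_profile[where N = N] by metis
  obtain d \<rho> where d: "d > 0" and \<rho>: "0 < \<rho>" "\<rho> < 1"
    and far: "\<And>\<xi> \<xi>'. \<xi> \<in> far \<Longrightarrow> dist \<xi> \<xi>' \<le> d \<Longrightarrow> cmod (\<Phi> \<xi>') \<le> \<rho>"
    using symbol_small_far by blast
  \<comment> \<open>All twists together move a point by at most \<open>N * card (Omega \<phi>) * r\<close>; this has
    to fit between a quarter and half of every radius, and into the margin \<open>d\<close>.\<close>
  define r0 where "r0 = Min (insert d ((\<lambda>q. radius q / 4) ` Omega \<phi>))"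
  have r0: "r0 > 0" "r0 \<le> d"
    using finite_Omega d radius(1) by (auto simp: r0_def)
  have r0_radius: "r0 \<le> radius q / 4" if "q \<in> Omega \<phi>" for q
    unfolding r0_def by (rule Min_le) (use finite_Omega that in auto)
  define k where "k = real ?m"
  define r where "r = r0 / (k + 1)"
  have "k \<ge> 0" by (simp add: k_def)
  then have "r > 0" "k * r \<le> r0"
    using r0(1) by (auto simp: r_def divide_simps algebra_simps)
  then have r: "r > 0" "real ?m * r \<le> r0" by (simp_all add: k_def)
  obtain n2 where n2: "\<And>q n u. q \<in> Omega \<phi> \<Longrightarrow> n \<ge> n2 q \<Longrightarrow> norm (contract n q u) \<le> r / pi * norm u"
    using contract_small[where e = "r / pi"] r(1) by (metis divide_pos_pos pi_gt_zero)
  obtain c L where c: "c > 0" "\<And>n x. n \<ge> 1 \<Longrightarrow> convolution_power \<phi> n x \<noteq> 0 \<Longrightarrow>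
     c \<le> real n ^ L * (\<Sum>q\<in>Omega \<phi>. profile N n x q)"
    by (rule profile_lower_bound[where N = N]) blast
  obtain Cg where Cg: "Cg > 0" "\<And>n. real n ^ L * \<rho> ^ n \<le> Cg"
    by (rule power_times_geometric_bounded[OF \<rho>]) blast
  \<comment> \<open>Beyond \<open>nn\<close> all local estimates hold and all steps are shorter than \<open>r\<close>;
    the finitely many smaller \<open>n\<close> are covered by the trivial bound 1.\<close>
  define nn where "nn = Max (insert 1 ((\<lambda>q. max (n1 q) (n2 q)) ` Omega \<phi>))"
  have nn_ge_1: "nn \<ge> 1"
    unfolding nn_def by (rule Max_ge) (use finite_Omega in auto)
  have nn: "max (n1 q) (n2 q) \<le> nn" if "q \<in> Omega \<phi>" for q
    unfolding nn_def by (rule Max_ge) (use finite_Omega that in auto)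
  define G where "G = (\<Sum>z\<in>peaks. 2 ^ ?m * C0 (rep z))"
  have peaks: "rep z \<in> Omega \<phi>" "\<forall>\<zeta>. \<Phi> (z + \<zeta>) = \<Phi> (rep z + \<zeta>)" if "z \<in> peaks" for z
    using that rep(2) by (auto simp: peaks_def intro: rep_in_Omega)
  have G0: "G \<ge> 0"
    unfolding G_def using C0(1)[OF peaks(1)] by (intro sum_nonneg) (auto simp: less_imp_le)
  have large: "cmod (convolution_power \<phi> n x) \<le> G * (\<Sum>q\<in>Omega \<phi>. profile N n x q) + 2 ^ ?m * \<rho> ^ n"
    if n: "n \<ge> nn" for n x
  proof -
    have n_1: "n \<ge> 1" using n nn_ge_1 by simp
    let ?S = "\<Sum>q\<in>Omega \<phi>. profile N n x q"
    have step_le: "norm (step n x p) \<le> r" if p: "p \<in> shifted n x" for p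
      using n nn[of p] p by (intro shifted_step(4)[OF p] n2) (auto simp: shifted_def)
    have "cmod (all_twists N n x x) \<le> (\<Sum>z\<in>peaks. 2 ^ ?m * C0 (rep z) * ?S) + 2 ^ ?m * \<rho> ^ n"
    proof (rule coefficient_le_near_plus_far[where b = "all_twists N n x", OF finite_convolution_power[OF n_1]])
      fix z assume z: "z \<in> peaks"
      note q = peaks(1)[OF z]
      have "ball_integral (all_twists N n x) z (radius (rep z) / 4) \<le> ennreal (2 ^ ?m * (C0 (rep z) * profile N n x (rep z)))"
      proof (rule ball_integral_all_twists[OF n_1 step_le])
        show "radius (rep z) / 4 + real ?m * r \<le> radius (rep z) / 2"
          using r(2) r0_radius[OF q] by linarith
        show "ball_integral (if rep z \<in> shifted n x then (twist (step n x (rep z)) (phase n x (rep z)) ^^ N) (convolution_power \<phi> n)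
            else convolution_power \<phi> n) z (radius (rep z) / 2) \<le> ennreal (C0 (rep z) * profile N n x (rep z))"
          using n nn[OF q] by (intro C0(2) q peaks(2)[OF z]) auto
      qed (use r(1) in auto)
      also have "\<dots> \<le> ennreal (2 ^ ?m * (C0 (rep z) * ?S))"
        using q finite_Omega profile_pos[OF n_1] C0(1)[OF q]
        by (intro ennreal_leI mult_left_mono member_le_sum) (auto simp: less_imp_le)
      finally show "ball_integral (all_twists N n x) z (radius (rep z) / 4) \<le> ennreal (2 ^ ?m * C0 (rep z) * ?S)"
        by (simp add: mult.assoc)
      show "0 \<le> 2 ^ ?m * C0 (rep z) * ?S"
        using C0(1)[OF q] profile_pos[OF n_1] by (intro mult_nonneg_nonneg sum_nonneg) (auto simp: less_imp_le)
    next
      fix \<xi> assume "\<xi> \<in> far"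
      then show "cmod (fourier (all_twists N n x) \<xi>) \<le> 2 ^ ?m * \<rho> ^ n"
        using r r0(2) \<rho>(1) far by (intro all_twists_far[OF n_1 step_le]) auto
    qed (use \<rho>(1) in \<open>auto simp: twists_def\<close>)
    then show ?thesis
      using twists_at_x[of n x N] by (simp add: G_def sum_distrib_right)
  qed
  define C where "C = G + 2 ^ ?m * (Cg / c) + real nn ^ L / c"
  have "cmod (convolution_power \<phi> n x) \<le> C * (\<Sum>q\<in>Omega \<phi>. profile N n x q)" if n: "n \<ge> 1" for n x
  proof (cases "convolution_power \<phi> n x = 0")
    case True
    have "C \<ge> 0" using G0 Cg c by (simp add: C_def)
    then show ?thesis using True profile_pos[OF n] by (simp add: sum_nonneg less_imp_le)
  next
    case False
    let ?s = "\<Sum>q\<in>Omega \<phi>. profile N n x q"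
    have s: "c \<le> real n ^ L * ?s" using c(2)[OF n False] .
    have s0: "?s \<ge> 0" using profile_pos[OF n] by (simp add: sum_nonneg less_imp_le)
    have parts: "0 \<le> G * ?s" "0 \<le> 2 ^ (?m) * (Cg / c) * ?s" "0 \<le> real nn ^ L / c * ?s"
      using G0 Cg c s0 by simp_all
    have C: "C * ?s = G * ?s + 2 ^ (?m) * (Cg / c) * ?s + real nn ^ L / c * ?s"
      by (simp add: C_def distrib_right)
    show ?thesis
    proof (cases "n \<ge> nn")
      case True
      have npos: "real n ^ L > 0" using n by simp
      have "\<rho> ^ n * c \<le> \<rho> ^ n * (real n ^ L * ?s)" using s \<rho> by (intro mult_left_mono) auto
      also have "\<dots> = (real n ^ L * \<rho> ^ n) * ?s" by (simp add: mult_ac)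
      also have "\<dots> \<le> Cg * ?s" using Cg(2) s0 by (intro mult_right_mono)
      finally have "\<rho> ^ n \<le> Cg / c * ?s" using c(1) by (simp add: field_simps)
      then have "2 ^ (?m) * \<rho> ^ n \<le> 2 ^ (?m) * (Cg / c * ?s)" by (intro mult_left_mono) auto
      then show ?thesis using large[OF True, of x] parts unfolding C by (simp add: mult.assoc)
    next
      case False
      have "real n ^ L \<le> real nn ^ L" using False by (intro power_mono) auto
      then have "real n ^ L * ?s \<le> real nn ^ L * ?s" using s0 by (intro mult_right_mono)
      then have "1 \<le> real nn ^ L / c * ?s" using s c(1) by (simp add: field_simps)
      then show ?thesis using coefficient_le_1[OF n, of x] parts unfolding C by linarith
    qed
  qed
  moreover have "C > 0"
    using G0 Cg c nn_ge_1 by (auto simp: C_def intro!: add_nonneg_pos)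
  ultimately show ?thesis by blast
qed

end

theorem theorem5p10:
  fixes \<phi> :: "int ^ 'd \<Rightarrow> complex"
    and \<alpha> :: "real ^ 'd \<Rightarrow> real ^ 'd"
    and P :: "real ^ 'd \<Rightarrow> real ^ 'd \<Rightarrow> complex"
  assumes "finitely_supported \<phi>"
    and "(SUP \<xi>\<in>torus. cmod (fourier \<phi> \<xi>)) = 1"
    and "\<forall>\<xi>\<in>Omega \<phi>. positive_homogeneous_type \<phi> \<xi>"
    and "\<forall>\<xi>\<in>Omega \<phi>. associated_to \<phi> \<xi> (\<alpha> \<xi>) (P \<xi>)"
  shows "finite (Omega \<phi>) \<and>
    (\<forall>N::real. N \<ge> 0 \<longrightarrow>
      (\<exists>C>0. \<forall>E. (\<forall>\<xi>\<in>Omega \<phi>. E \<xi> \<in> Exp_set (P \<xi>)) \<longrightarrow>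
        (\<forall>x. \<forall>n\<ge>1.
          cmod (convolution_power \<phi> n x) \<le>
            C * (\<Sum>\<xi>\<in>Omega \<phi>.
                  1 / real n powr mu (P \<xi>) *
                  (1 + norm (matrix_powr (real n) (- transpose (E \<xi>)) *v
                          (real_vec x - real n *\<^sub>R \<alpha> \<xi>))) powr (- N)))))"
proof (intro conjI allI impI)
  interpret normalized_symbol \<phi> \<alpha> P
    by unfold_locales (use assms in auto)
  show "finite (Omega \<phi>)" by (rule finite_Omega)
  fix N :: real
  assume N: "N \<ge> 0"
  define M where "M = nat \<lceil>N\<rceil>"
  have M: "N \<le> real M" unfolding M_def by linarith
  obtain C where C: "C > 0" "\<And>n x. n \<ge> 1 \<Longrightarrow> cmod (convolution_power \<phi> n x) \<le> C * (\<Sum>q\<in>Omega \<phi>. profile M n x q)"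
    using convolution_power_bound[of M] by blast
  have "\<exists>D\<ge>1. \<forall>F t v. F \<in> Exp_set (P q) \<longrightarrow> t > 0 \<longrightarrow>
       norm (matrix_powr t (- transpose F) *v v) \<le> D * norm (matrix_powr t (- transpose (expo q)) *v v)"
    if q: "q \<in> Omega \<phi>" for q
  proof -
    interpret local_expansion "P q" "expo q" supp "\<lambda>k. \<phi> k * character k q / \<Phi> q" "\<lambda>k. real_vec k - \<alpha> q" "radius q" "W q"
      using radius(2)[OF q] by (simp add: expansion_at_def)
    show ?thesis by (rule exponents_comparable) blast
  qed
  then obtain D where D: "\<And>q. q \<in> Omega \<phi> \<Longrightarrow> D q \<ge> 1"
    "\<And>q F t v. q \<in> Omega \<phi> \<Longrightarrow> F \<in> Exp_set (P q) \<Longrightarrow> t > 0 \<Longrightarrow>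
       norm (matrix_powr t (- transpose F) *v v) \<le> D q * norm (matrix_powr t (- transpose (expo q)) *v v)"
    by metis
  define B where "B = (\<Sum>q\<in>Omega \<phi>. D q) + 1"
  have DB: "D q \<le> B" if "q \<in> Omega \<phi>" for q
  proof -
    have "D q \<le> (\<Sum>q\<in>Omega \<phi>. D q)"
      by (rule member_le_sum[OF that]) (use D(1) finite_Omega in \<open>auto intro: order_trans[OF zero_le_one]\<close>)
    then show ?thesis by (simp add: B_def)
  qed
  have "(\<Sum>q\<in>Omega \<phi>. D q) \<ge> 0"
    by (rule sum_nonneg) (use D(1) in \<open>auto intro: order_trans[OF zero_le_one]\<close>)
  then have B1: "B \<ge> 1" by (simp add: B_def)
  have bound: "cmod (convolution_power \<phi> n x) \<le> (C * B ^ M) * (\<Sum>\<xi>\<in>Omega \<phi>.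
                  1 / real n powr mu (P \<xi>) *
                  (1 + norm (matrix_powr (real n) (- transpose (E \<xi>)) *v
                          (real_vec x - real n *\<^sub>R \<alpha> \<xi>))) powr (- N))"
    if E: "\<forall>\<xi>\<in>Omega \<phi>. E \<xi> \<in> Exp_set (P \<xi>)" and n: "n \<ge> 1" for E x n
  proof -
    have "profile M n x q \<le> B ^ M * (1 / real n powr mu (P q) *
        (1 + norm (matrix_powr (real n) (- transpose (E q)) *v (real_vec x - real n *\<^sub>R \<alpha> q))) powr (- N))"
      if q: "q \<in> Omega \<phi>" for q
    proof -
      have npos: "real n > 0" using n by simp
      let ?y = "norm (matrix_powr (real n) (- transpose (E q)) *v (real_vec x - real n *\<^sub>R \<alpha> q))"
      let ?s = "norm (scaled n x q)"
      have "matrix_powr (real n) (- transpose (expo q)) *v (real_vec x - real n *\<^sub>R \<alpha> q) = scaled n x q"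
        using npos by (simp add: scaled_def transpose_matrix_powr matrix_powr_minus)
      then have "?y \<le> D q * ?s"
        using D(2)[OF q, of "E q" "real n" "real_vec x - real n *\<^sub>R \<alpha> q"] E q npos by simp
      also have "\<dots> \<le> B * ?s" using DB[OF q] by (intro mult_right_mono) auto
      finally have y: "1 + ?y \<le> B * (1 + ?s)" using B1 by (simp add: distrib_left)
      have "(1 + ?y) powr N \<le> (1 + ?y) powr real M" using M by (intro powr_mono) auto
      also have "\<dots> = (1 + ?y) ^ M" by (rule powr_realpow) (simp add: add_pos_nonneg)
      also have "\<dots> \<le> B ^ M * (1 + ?s) ^ M"
        unfolding power_mult_distrib[symmetric] using y by (intro power_mono) auto
      finally have "(1 + ?y) powr N \<le> B ^ M * (1 + ?s) ^ M" .
      moreover have "(1 + ?y) powr N > 0" "(1 + ?s) ^ M > 0"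
        by (auto intro!: zero_less_power add_pos_nonneg simp: add_nonneg_eq_0_iff)
      ultimately have "1 / (1 + ?s) ^ M \<le> B ^ M * (1 + ?y) powr (- N)"
        by (simp add: powr_minus divide_simps mult.commute)
      then have "1 / real n powr mu (P q) * (1 / (1 + ?s) ^ M) \<le> 1 / real n powr mu (P q) * (B ^ M * (1 + ?y) powr (- N))"
        by (intro mult_left_mono) auto
      then show ?thesis
        by (simp add: profile_def powr_minus_divide mult_ac)
    qed
    then have "(\<Sum>q\<in>Omega \<phi>. profile M n x q) \<le> B ^ M * (\<Sum>q\<in>Omega \<phi>. 1 / real n powr mu (P q) *
        (1 + norm (matrix_powr (real n) (- transpose (E q)) *v (real_vec x - real n *\<^sub>R \<alpha> q))) powr (- N))"
      unfolding sum_distrib_left by (rule sum_mono)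
    then show ?thesis
      using order_trans[OF C(2)[OF n, of x] mult_left_mono[OF _ less_imp_le[OF C(1)]]] by (simp add: mult.assoc)
  qed
  show "\<exists>C>0. \<forall>E. (\<forall>\<xi>\<in>Omega \<phi>. E \<xi> \<in> Exp_set (P \<xi>)) \<longrightarrow>
        (\<forall>x. \<forall>n\<ge>1.
          cmod (convolution_power \<phi> n x) \<le>
            C * (\<Sum>\<xi>\<in>Omega \<phi>.
                  1 / real n powr mu (P \<xi>) *
                  (1 + norm (matrix_powr (real n) (- transpose (E \<xi>)) *v
                          (real_vec x - real n *\<^sub>R \<alpha> \<xi>))) powr (- N)))"
  proof (intro exI[of _ "C * B ^ M"] conjI allI impI)
    show "C * B ^ M > 0" using C(1) B1 by simp
  qed (rule bound)
qed

end
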